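(* Let $Q$ be a smooth manifold, $\mathcal{D}\subset TQ$ a non-integrable distribution of constant rank, $\mathcal{D}^{(2)}\subset T\mathcal{D}$ the submanifold of velocities of admissible curves in $\mathcal{D}$, and $\mathcal{L}:\mathcal{D}^{(2)}\to\mathbb{R}$ a smooth function. Assume that the second-order nonholonomic system $(\mathcal{D}^{(2)},\Sigma_{\mathcal{L}})$ is regular, i.e. the Legendre transform $\mathbb{F}\mathcal{L}:\Sigma_{\mathcal{L}}\to T^{*}\mathcal{D}$ is a local diffeomorphism. Writing $p_i=\gamma_i$ and $p_A=\frac{\partial\mathcal{L}}{\partial\dot y^A}$, one can then write $\dot y^A=\dot y^A(q^i,y^A,p_A)$. Define the Hamiltonian function $\mathcal{H}:T^{*}\mathcal{D}\to\mathbb{R}$ by $$\mathcal{H}(\alpha)=\big\langle\alpha,\pi\big(\mathbb{F}\mathcal{L}^{-1}(\alpha)\big)\big\rangle-\mathcal{L}\big(\pi\big(\mathbb{F}\mathcal{L}^{-1}(\alpha)\big)\big),$$ where $\pi:\Sigma_{\mathcal{L}}\to\mathcal{D}^{(2)}$ is the restriction to $\Sigma_{\mathcal{L}}$ of the projection $T^{*}T\mathcal{D}\to T\mathcal{D}$; locally $$\mathcal{H}(q^i,y^A,p_i,p_A)=p_A\,\dot y^A(q^i,y^A,p_A)+p_i\rho_A^iy^A-\mathcal{L}\big(q^i,y^A,\dot y^A(q^i,y^A,p_A)\big).$$ Let $X_{\mathcal{H}}$ be defined by $i_{X_{\mathcal{H}}}\omega_{\mathcal{D}}=d\mathcal{H}$,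 where $\omega_{\mathcal{D}}$ is the canonical symplectic 2-form on $T^{*}\mathcal{D}$. Then the integral curves of $X_{\mathcal{H}}$ are the solutions of Hamilton's equations on $T^{*}\mathcal{D}$ $$\dot q^i=\frac{\partial\mathcal{H}}{\partial p_i},\quad \dot y^A=\frac{\partial\mathcal{H}}{\partial p_A},\quad \dot p_i=-\frac{\partial\mathcal{H}}{\partial q^i},\quad \dot p_A=-\frac{\partial\mathcal{H}}{\partial y^A},$$ that is, $$\dot q^i=\rho_A^iy^A,\qquad \dot p_i=\frac{\partial\mathcal{L}}{\partial q^i}\big(q^i,y^A,\dot y^A(q^i,y^A,p_A)\big)-p_j\frac{\partial\rho_A^j}{\partial q^i}y^A,\qquad \dot p_A=\frac{\partial\mathcal{L}}{\partial y^A}\big(q^i,y^A,\dot y^A(q^i,y^A,p_A)\big)-p_j\rho_A^j;$$ the flow of $X_{\mathcal{H}}$ preserves $\omega_{\mathcal{D}}$; and these equations are equivalent to the constrained Euler–Lagrange equations $$\dot\lambda_i-\frac{\partial\mathcal{L}}{\partial q^i}+\lambda_j\frac{\partial\rho_A^j}{\partial q^i}y^A=0,\qquad \frac{d}{dt}\left(\frac{\partial\mathcal{L}}{\partial\dot y^A}\right)-\frac{\partial\mathcal{L}}{\partial y^A}+\rho_A^i\lambda_i=0,\qquad \dot q^i=\rho_A^iy^A,$$ using the identification of the Lagrange multipliers $\lambda_i$ with the variables $p_i$ and the relation $p_A=\frac{\partial\mathcal{L}}{\partial\dot y^A}$.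
   Context: Summation over repeated indices is understood. $\mathcal{D}$ is regarded as a manifold, the total space of the vector bundle $\tau_{\mathcal{D}}:\mathcal{D}\to Q$. A curve $\gamma:I\subset\mathbb{R}\to\mathcal{D}$ is admissible if, with $\sigma=\tau_{\mathcal{D}}\circ\gamma$, one has $\gamma(t)=\frac{d\sigma}{dt}(t)$. Define $$\mathcal{D}^{(2)}=\{v\in T\mathcal{D}\mid v=\dot\gamma(0)\text{ where }\gamma:I\to\mathcal{D}\text{ is admissible}\}.$$ Coordinates: if $(q^i)$ are local coordinates on $Q$ and $\{e_A=\rho_A^i(q)\frac{\partial}{\partial q^i}\}$ is a local basis of sections of $\mathcal{D}$, there are induced coordinates $(q^i,y^A)$ on $\mathcal{D}$ (an element $e\in\mathcal{D}_q$ is written $e=y^Ae_A(q)$), $(q^i,y^A,p_i,p_A)$ on $T^{*}\mathcal{D}$, and $(q^i,y^A,\dot q^i,\dot y^A)$ on $T\mathcal{D}$. $\mathcal{D}^{(2)}$ is locally given by $\dot q^i=\rho_A^i(q)y^A$, with coordinates $(q^i,y^A,\dot y^A)$. On $T^{*}T\mathcal{D}$ there are induced coordinates $(q^i,y^A,\dot q^i,\dot y^A,\mu_i,\mu_A,\gamma_i,\gamma_A)$. $\Sigma_{\mathcal{L}}$ is the set of covectors $\mu\in T^{*}_vT\mathcal{D}$ with $v\in\mathcal{D}^{(2)}$ and $\langle\mu,w\rangle=\langle d\mathcal{L}(v),w\rangle$ for all $w\in T_v\mathcal{D}^{(2)}$; it is a Lagrangian submanifold of $T^{*}T\mathcal{D}$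 with its canonical symplectic form, with inclusion $i_{\Sigma_{\mathcal{L}}}$. Locally it is given by $$\mu_i+\gamma_j\frac{\partial\rho_A^j}{\partial q^i}y^A=\frac{\partial\mathcal{L}}{\partial q^i},\quad \mu_A+\gamma_j\rho_A^j=\frac{\partial\mathcal{L}}{\partial y^A},\quad \gamma_A=\frac{\partial\mathcal{L}}{\partial\dot y^A},\quad \dot q^i=\rho_A^iy^A,$$ so $(q^i,y^A,\dot y^A,\gamma_i)$ are local coordinates on $\Sigma_{\mathcal{L}}$, and $\pi(q^i,y^A,\dot y^A,\gamma_i)=(q^i,y^A,\dot y^A)$. The pair $(\mathcal{D}^{(2)},\Sigma_{\mathcal{L}})$ is called a second-order nonholonomic system. Define $\Psi:T^{*}T\mathcal{D}\to T^{*}\mathcal{D}$ by $\langle\Psi(\mu_v),X\rangle=\langle\mu_v,X^{V}(v)\rangle$ for $v\in T_x\mathcal{D}$, $\mu_v\in T_v^{*}T\mathcal{D}$, $X\in T_x\mathcal{D}$, where $X^{V}(v)\in T_vT\mathcal{D}$ is the vertical lift of $X$ to $v$. The Legendre transform is $\mathbb{F}\mathcal{L}=\Psi\circ i_{\Sigma_{\mathcal{L}}}$; locally $\mathbb{F}\mathcal{L}(q^i,y^A,\dot y^A,\gamma_i)=\left(q^i,y^A,\gamma_i,\frac{\partial\mathcal{L}}{\partial\dot y^A}\right)$. The constrained Euler–Lagrange equations are those of the extended Lagrangian $\mathcal{L}+\lambda_i(\dot q^i-\rho_A^iy^A)$ with Lagrange multipliers $\lambda_i$. In the motivating application, $\mathcal{L}$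 is the cost function of an optimal control problem for a fully actuated nonholonomic mechanical system, with the controls expressed in terms of $(q^i,y^A,\dot y^A)$ through the controlled equations of motion, and these equations describe the dynamics of the optimal control problem. *)

theory Defs
  imports "HOL-Analysis.Analysis"
begin

section \<open>Smooth manifolds given by atlases\<close>

primrec C_k_on :: "nat \<Rightarrow> 'e::euclidean_space set \<Rightarrow> ('e \<Rightarrow> 'f::euclidean_space) \<Rightarrow> bool" where
  "C_k_on 0 S f \<longleftrightarrow> continuous_on S f"
| "C_k_on (Suc k) S f \<longleftrightarrow> (\<forall>x\<in>S. f differentiable (at x)) \<and>
     (\<forall>h. C_k_on k S (\<lambda>x. frechet_derivative f (at x) h))"

text \<open>Only used for open \<open>S\<close>.\<close>
definition smooth_on :: "'e::euclidean_space set \<Rightarrow> ('e \<Rightarrow> 'f::euclidean_space) \<Rightarrow> bool" where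
  "smooth_on S f \<longleftrightarrow> (\<forall>k. C_k_on k S f)"

type_synonym ('a, 'e) chart = "'a set \<times> ('a \<Rightarrow> 'e)"
type_synonym ('a, 'e) atlas = "('a, 'e) chart set"

definition chart_inv :: "('a, 'e) chart \<Rightarrow> 'e \<Rightarrow> 'a" where
  "chart_inv c = inv_into (fst c) (snd c)"

definition is_chart :: "('a, 'e::euclidean_space) chart \<Rightarrow> bool" where
  "is_chart c \<longleftrightarrow> inj_on (snd c) (fst c) \<and> open (snd c ` fst c)"

definition smooth_transition :: "('a, 'e::euclidean_space) chart \<Rightarrow> ('a, 'e) chart \<Rightarrow> bool" where
  "smooth_transition c d \<longleftrightarrow> open (snd c ` (fst c \<inter> fst d)) \<and>
     smooth_on (snd c ` (fst c \<inter> fst d)) (snd d \<circ> chart_inv c)"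

definition smooth_atlas :: "('a, 'e::euclidean_space) atlas \<Rightarrow> bool" where
  "smooth_atlas A \<longleftrightarrow> (\<forall>c\<in>A. is_chart c) \<and> (\<forall>c\<in>A. \<forall>d\<in>A. smooth_transition c d)"

definition points :: "('a, 'e) atlas \<Rightarrow> 'a set" where
  "points A = (\<Union>c\<in>A. fst c)"

definition atlas_topology :: "('a, 'e::euclidean_space) atlas \<Rightarrow> 'a topology" where
  "atlas_topology A = topology (\<lambda>W. W \<subseteq> points A \<and> (\<forall>c\<in>A. open (snd c ` (W \<inter> fst c))))"

definition smooth_manifold :: "('a, 'e::euclidean_space) atlas \<Rightarrow> bool" where
  "smooth_manifold A \<longleftrightarrow> smooth_atlas A \<and> Hausdorff_space (atlas_topology A) \<and>
     second_countable (atlas_topology A)"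

definition max_atlas :: "('a, 'e::euclidean_space) atlas \<Rightarrow> ('a, 'e) atlas" where
  "max_atlas A = {c. is_chart c \<and> fst c \<subseteq> points A \<and>
     (\<forall>d\<in>A. smooth_transition c d \<and> smooth_transition d c)}"

definition euclidean_atlas :: "('e::euclidean_space, 'e) atlas" where
  "euclidean_atlas = {(UNIV, id)}"

definition prod_atlas :: "('a, 'e::euclidean_space) atlas \<Rightarrow> ('b, 'f::euclidean_space) atlas
    \<Rightarrow> ('a \<times> 'b, 'e \<times> 'f) atlas" where
  "prod_atlas A B = {(fst c \<times> fst d, map_prod (snd c) (snd d)) | c d. c \<in> A \<and> d \<in> B}"

text \<open>\<open>smooth_at A B F p\<close> says that \<open>F\<close> is smooth on a whole neighbourhood of \<open>p\<close>;
  the values of \<open>F\<close> away from \<open>p\<close> play no role.\<close>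
definition smooth_at :: "('a, 'e::euclidean_space) atlas \<Rightarrow> ('b, 'f::euclidean_space) atlas
    \<Rightarrow> ('a \<Rightarrow> 'b) \<Rightarrow> 'a \<Rightarrow> bool" where
  "smooth_at A B F p \<longleftrightarrow> (\<exists>c\<in>A. \<exists>d\<in>B. \<exists>N. p \<in> fst c \<and> open N \<and> snd c p \<in> N \<and> N \<subseteq> snd c ` fst c \<and>
     F ` (chart_inv c ` N) \<subseteq> fst d \<and> smooth_on N (snd d \<circ> F \<circ> chart_inv c))"

text \<open>Smoothness on an arbitrary subset \<open>S\<close> of a manifold: \<open>F\<close> extends, locally around each point
  of \<open>S\<close>, to a smooth map on the ambient manifold. For embedded submanifolds \<open>S\<close> this is smoothness
  with respect to the submanifold structure.\<close>
definition smooth_map_on :: "('a, 'e::euclidean_space) atlas \<Rightarrow> 'a set \<Rightarrow> ('b, 'f::euclidean_space) atlas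
    \<Rightarrow> ('a \<Rightarrow> 'b) \<Rightarrow> bool" where
  "smooth_map_on A S B F \<longleftrightarrow> (\<forall>p\<in>S. \<exists>G W. openin (atlas_topology A) W \<and> p \<in> W \<and>
     smooth_at A B G p \<and> (\<forall>x\<in>S \<inter> W. F x = G x))"

definition local_diffeo_on :: "('a, 'e::euclidean_space) atlas \<Rightarrow> 'a set \<Rightarrow> ('b, 'f::euclidean_space) atlas
    \<Rightarrow> ('a \<Rightarrow> 'b) \<Rightarrow> bool" where
  "local_diffeo_on A S B F \<longleftrightarrow> (\<forall>p\<in>S. \<exists>W. openin (atlas_topology A) W \<and> p \<in> W \<and>
     inj_on F (S \<inter> W) \<and> openin (atlas_topology B) (F ` (S \<inter> W)) \<and>
     smooth_map_on A (S \<inter> W) B F \<and>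
     smooth_map_on B (F ` (S \<inter> W)) A (inv_into (S \<inter> W) F))"

section \<open>Tangent and cotangent bundles\<close>

text \<open>A tangent vector is the derivation \<open>f \<mapsto> (f \<circ> c)'(0)\<close> induced by a smooth curve on the
  functions that are smooth near the base point; it is put to zero on all other functions, so that
  the linear structure of a tangent space is the pointwise one.\<close>
type_synonym 'a tvec = "('a \<Rightarrow> real) \<Rightarrow> real"
type_synonym 'a tpoint = "'a \<times> 'a tvec"
type_synonym 'a ctpoint = "'a \<times> ('a tvec \<Rightarrow> real)"

definition velocity :: "('a, 'e::euclidean_space) atlas \<Rightarrow> (real \<Rightarrow> 'a) \<Rightarrow> real \<Rightarrow> 'a tvec" where
  "velocity A c t = (\<lambda>f. if smooth_at A euclidean_atlas f (c t) then deriv (\<lambda>s. f (c s)) t else 0)"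

definition tangent_space :: "('a, 'e::euclidean_space) atlas \<Rightarrow> 'a \<Rightarrow> 'a tvec set" where
  "tangent_space A p = {velocity A c 0 | c. smooth_at euclidean_atlas A c 0 \<and> c 0 = p}"

definition pushforward :: "('a, 'e::euclidean_space) atlas \<Rightarrow> ('b, 'f::euclidean_space) atlas
    \<Rightarrow> ('a \<Rightarrow> 'b) \<Rightarrow> 'a \<Rightarrow> 'a tvec \<Rightarrow> 'b tvec" where
  "pushforward A B F p u = (\<lambda>f. if smooth_at B euclidean_atlas f (F p) then u (f \<circ> F) else 0)"

definition tvec_coords :: "('a, 'e::euclidean_space) chart \<Rightarrow> 'a tvec \<Rightarrow> 'e" where
  "tvec_coords c u = (\<Sum>b\<in>Basis. u (\<lambda>x. snd c x \<bullet> b) *\<^sub>R b)"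

definition coord_vector :: "('a, 'e::euclidean_space) atlas \<Rightarrow> ('a, 'e) chart \<Rightarrow> 'a \<Rightarrow> 'e \<Rightarrow> 'a tvec" where
  "coord_vector A c p h = velocity A (\<lambda>t. chart_inv c (snd c p + t *\<^sub>R h)) 0"

definition cotangent_space :: "('a, 'e::euclidean_space) atlas \<Rightarrow> 'a \<Rightarrow> ('a tvec \<Rightarrow> real) set" where
  "cotangent_space A p = {\<alpha>. (\<forall>u. u \<notin> tangent_space A p \<longrightarrow> \<alpha> u = 0) \<and>
     (\<forall>u\<in>tangent_space A p. \<forall>w\<in>tangent_space A p. \<forall>a b.
        \<alpha> (\<lambda>f. a * u f + b * w f) = a * \<alpha> u + b * \<alpha> w)}"

definition tangent_chart :: "('a, 'e::euclidean_space) atlas \<Rightarrow> ('a, 'e) chart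
    \<Rightarrow> ('a tpoint, 'e \<times> 'e) chart" where
  "tangent_chart A c = ({(p, u). p \<in> fst c \<and> u \<in> tangent_space A p},
     \<lambda>(p, u). (snd c p, tvec_coords c u))"

definition tangent_atlas :: "('a, 'e::euclidean_space) atlas \<Rightarrow> ('a tpoint, 'e \<times> 'e) atlas" where
  "tangent_atlas A = tangent_chart A ` A"

definition cotangent_chart :: "('a, 'e::euclidean_space) atlas \<Rightarrow> ('a, 'e) chart
    \<Rightarrow> ('a ctpoint, 'e \<times> 'e) chart" where
  "cotangent_chart A c = ({(p, \<alpha>). p \<in> fst c \<and> \<alpha> \<in> cotangent_space A p},
     \<lambda>(p, \<alpha>). (snd c p, \<Sum>b\<in>Basis. \<alpha> (coord_vector A c p b) *\<^sub>R b))"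

definition cotangent_atlas :: "('a, 'e::euclidean_space) atlas \<Rightarrow> ('a ctpoint, 'e \<times> 'e) atlas" where
  "cotangent_atlas A = cotangent_chart A ` A"

section \<open>The canonical symplectic form, Hamiltonian vector fields and flows\<close>

text \<open>The exterior derivative of the one-form \<open>\<theta>\<close>, evaluated on \<open>u, w\<close> at \<open>p\<close> by
  \<open>\<Sum> (\<partial>\<^sub>i \<theta>\<^sub>j - \<partial>\<^sub>j \<theta>\<^sub>i) u\<^sup>i w\<^sup>j\<close> in a chart around \<open>p\<close>; the value does not depend on the chart.\<close>
definition ext_deriv :: "('a, 'e::euclidean_space) atlas \<Rightarrow> ('a \<Rightarrow> 'a tvec \<Rightarrow> real)
    \<Rightarrow> 'a \<Rightarrow> 'a tvec \<Rightarrow> 'a tvec \<Rightarrow> real" where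
  "ext_deriv A \<theta> p u w =
     (let c = (SOME c. c \<in> A \<and> p \<in> fst c);
          \<theta>' = (\<lambda>h x. \<theta> (chart_inv c x) (coord_vector A c (chart_inv c x) h));
          u' = tvec_coords c u; w' = tvec_coords c w
      in frechet_derivative (\<theta>' w') (at (snd c p)) u' - frechet_derivative (\<theta>' u') (at (snd c p)) w')"

definition liouville_form :: "('a, 'e::euclidean_space) atlas \<Rightarrow> 'a ctpoint \<Rightarrow> 'a ctpoint tvec \<Rightarrow> real" where
  "liouville_form A a W = snd a (pushforward (cotangent_atlas A) A fst a W)"

text \<open>The sign is such that the form is \<open>dq\<^sup>i \<and> dp\<^sub>i\<close> in natural coordinates.\<close>
definition canonical_symplectic :: "('a, 'e::euclidean_space) atlas \<Rightarrow> 'a ctpoint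
    \<Rightarrow> 'a ctpoint tvec \<Rightarrow> 'a ctpoint tvec \<Rightarrow> real" where
  "canonical_symplectic A a u w = - ext_deriv (cotangent_atlas A) (liouville_form A) a u w"

text \<open>\<open>w H\<close> is \<open>dH(w)\<close>, for a function \<open>H\<close> that is smooth near \<open>a\<close>.\<close>
definition is_hamiltonian_vector :: "('a, 'e::euclidean_space) atlas \<Rightarrow> ('a ctpoint \<Rightarrow> real)
    \<Rightarrow> 'a ctpoint \<Rightarrow> 'a ctpoint tvec \<Rightarrow> bool" where
  "is_hamiltonian_vector A H a X \<longleftrightarrow> X \<in> tangent_space (cotangent_atlas A) a \<and>
     (\<forall>w\<in>tangent_space (cotangent_atlas A) a. canonical_symplectic A a X w = w H)"

definition hamiltonian_field :: "('a, 'e::euclidean_space) atlas \<Rightarrow> ('a ctpoint \<Rightarrow> real)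
    \<Rightarrow> 'a ctpoint \<Rightarrow> 'a ctpoint tvec" where
  "hamiltonian_field A H a = (THE X. is_hamiltonian_vector A H a X)"

definition integral_curve :: "('a, 'e::euclidean_space) atlas \<Rightarrow> ('a \<Rightarrow> 'a tvec)
    \<Rightarrow> real set \<Rightarrow> (real \<Rightarrow> 'a) \<Rightarrow> bool" where
  "integral_curve A X I x \<longleftrightarrow> open I \<and> is_interval I \<and>
     (\<forall>t\<in>I. smooth_at euclidean_atlas A x t \<and> velocity A x t = X (x t))"

text \<open>\<open>F\<close> is a flow of the vector field \<open>X\<close> (given on the open set \<open>U\<close>) with domain \<open>\<Omega>\<close>; this covers
  the maximal flow as well as its restrictions.\<close>
definition is_flow :: "('a, 'e::euclidean_space) atlas \<Rightarrow> ('a \<Rightarrow> 'a tvec) \<Rightarrow> 'a set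
    \<Rightarrow> (real \<times> 'a) set \<Rightarrow> (real \<Rightarrow> 'a \<Rightarrow> 'a) \<Rightarrow> bool" where
  "is_flow A X U \<Omega> F \<longleftrightarrow>
     openin (atlas_topology (prod_atlas euclidean_atlas A)) \<Omega> \<and>
     (\<forall>(t, a)\<in>\<Omega>. (0, a) \<in> \<Omega> \<and> F 0 a = a \<and> F t a \<in> U \<and>
        smooth_at (prod_atlas euclidean_atlas A) A (\<lambda>(t, a). F t a) (t, a)) \<and>
     (\<forall>a. integral_curve A X {t. (t, a) \<in> \<Omega>} (\<lambda>t. F t a))"

definition flow_preserves :: "('a, 'e::euclidean_space) atlas \<Rightarrow> (real \<times> 'a) set
    \<Rightarrow> (real \<Rightarrow> 'a \<Rightarrow> 'a) \<Rightarrow> ('a \<Rightarrow> 'a tvec \<Rightarrow> 'a tvec \<Rightarrow> real) \<Rightarrow> bool" where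
  "flow_preserves A \<Omega> F \<omega> \<longleftrightarrow> (\<forall>(t, a)\<in>\<Omega>. \<forall>u\<in>tangent_space A a. \<forall>w\<in>tangent_space A a.
     \<omega> (F t a) (pushforward A A (F t) a u) (pushforward A A (F t) a w) = \<omega> a u w)"

section \<open>Distributions\<close>

text \<open>The dimension of the manifold and the rank of the distribution are the cardinalities of the
  index types \<open>'n\<close> and \<open>'k\<close>.\<close>

definition frame_comb :: "('k::finite \<Rightarrow> 'a \<Rightarrow> 'a tvec) \<Rightarrow> 'a \<Rightarrow> real^'k \<Rightarrow> 'a tvec" where
  "frame_comb e x y = (\<lambda>f. \<Sum>A\<in>UNIV. y $ A * e A x f)"

definition local_frame :: "('a, 'e::euclidean_space) atlas \<Rightarrow> 'a tpoint set \<Rightarrow> 'a set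
    \<Rightarrow> ('k::finite \<Rightarrow> 'a \<Rightarrow> 'a tvec) \<Rightarrow> bool" where
  "local_frame Q D W e \<longleftrightarrow> (\<forall>x\<in>W.
     (\<forall>A. smooth_at Q (tangent_atlas Q) (\<lambda>x'. (x', e A x')) x) \<and>
     inj (frame_comb e x) \<and> {u. (x, u) \<in> D} = range (frame_comb e x))"

text \<open>Local coordinates \<open>(q\<^sup>i)\<close> on \<open>Q\<close> together with a local basis \<open>(e\<^sub>A)\<close> of sections of \<open>D\<close>.\<close>
definition adapted_chart :: "('a, 'e::euclidean_space) atlas \<Rightarrow> 'a tpoint set \<Rightarrow> ('a, 'e) chart
    \<Rightarrow> ('k::finite \<Rightarrow> 'a \<Rightarrow> 'a tvec) \<Rightarrow> bool" where
  "adapted_chart Q D c e \<longleftrightarrow> c \<in> max_atlas Q \<and> local_frame Q D (fst c) e"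

definition distribution :: "'k::finite itself \<Rightarrow> ('a, 'e::euclidean_space) atlas \<Rightarrow> 'a tpoint set \<Rightarrow> bool" where
  "distribution (_ :: 'k itself) Q D \<longleftrightarrow> D \<subseteq> points (tangent_atlas Q) \<and>
     (\<forall>x\<in>points Q. \<exists>c (e :: 'k \<Rightarrow> 'a \<Rightarrow> 'a tvec). x \<in> fst c \<and> adapted_chart Q D c e)"

text \<open>Integrability: through every point there is an integral manifold, given here by a local
  parametrisation \<open>F\<close> with \<open>TF(T\<^sub>uN) = D\<^bsub>F(u)\<^esub>\<close>; it is an immersion because the rank of \<open>D\<close> is the
  dimension of the parameter space.\<close>
definition integrable_distribution ::
    "'k::finite itself \<Rightarrow> ('a, 'e::euclidean_space) atlas \<Rightarrow> 'a tpoint set \<Rightarrow> bool" where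
  "integrable_distribution (_ :: 'k itself) Q D \<longleftrightarrow>
     (\<forall>x\<in>points Q. \<exists>N (F :: real^'k \<Rightarrow> 'a). open N \<and> 0 \<in> N \<and> F 0 = x \<and>
        (\<forall>u\<in>N. smooth_at euclidean_atlas Q F u \<and>
           {velocity Q (\<lambda>t. F (u + t *\<^sub>R h)) 0 | h. True} = {v. (F u, v) \<in> D}))"

text \<open>The coordinates \<open>(q\<^sup>i, y\<^sup>A)\<close> on the total space \<open>D\<close>.\<close>
definition dist_chart :: "'a tpoint set \<Rightarrow> ('a, 'e::euclidean_space) chart \<Rightarrow> ('k::finite \<Rightarrow> 'a \<Rightarrow> 'a tvec)
    \<Rightarrow> ('a tpoint, 'e \<times> (real^'k)) chart" where
  "dist_chart D c e = ({(x, u). (x, u) \<in> D \<and> x \<in> fst c},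
     \<lambda>(x, u). (snd c x, THE y. u = frame_comb e x y))"

definition dist_atlas :: "('a, 'e::euclidean_space) atlas \<Rightarrow> 'a tpoint set
    \<Rightarrow> ('a tpoint, 'e \<times> (real^'k::finite)) atlas" where
  "dist_atlas Q D = {dist_chart D c e | c e. adapted_chart Q D c e}"

section \<open>Second-order nonholonomic systems\<close>

text \<open>From here on \<open>E\<close> is the atlas of the total space \<open>D\<close>, see \<open>dist_atlas\<close>.\<close>

definition admissible :: "('a, 'e::euclidean_space) atlas \<Rightarrow> ('a tpoint, 'f::euclidean_space) atlas
    \<Rightarrow> (real \<Rightarrow> 'a tpoint) \<Rightarrow> real set \<Rightarrow> bool" where
  "admissible Q E \<gamma> I \<longleftrightarrow> open I \<and> is_interval I \<and>
     (\<forall>t\<in>I. smooth_at euclidean_atlas E \<gamma> t \<and>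
        \<gamma> t = (fst (\<gamma> t), velocity Q (\<lambda>s. fst (\<gamma> s)) t))"

definition admissible_velocities :: "('a, 'e::euclidean_space) atlas \<Rightarrow> ('a tpoint, 'f::euclidean_space) atlas
    \<Rightarrow> 'a tpoint tpoint set" where
  "admissible_velocities Q E = {(\<gamma> 0, velocity E \<gamma> 0) | \<gamma> I. admissible Q E \<gamma> I \<and> 0 \<in> I}"

text \<open>Tangent vectors of a subset \<open>S\<close> (in use: a submanifold), and the differential of a function
  that is smooth on \<open>S\<close> but need not be smooth, off \<open>S\<close>, on the ambient manifold.\<close>
definition curve_in :: "('a, 'e::euclidean_space) atlas \<Rightarrow> 'a set \<Rightarrow> 'a \<Rightarrow> (real \<Rightarrow> 'a) \<Rightarrow> bool" where
  "curve_in A S p c \<longleftrightarrow> smooth_at euclidean_atlas A c 0 \<and> c 0 = p \<and> (\<forall>\<^sub>F t in nhds 0. c t \<in> S)"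

definition sub_tangent_space :: "('a, 'e::euclidean_space) atlas \<Rightarrow> 'a set \<Rightarrow> 'a \<Rightarrow> 'a tvec set" where
  "sub_tangent_space A S p = {velocity A c 0 | c. curve_in A S p c}"

definition sub_differential :: "('a, 'e::euclidean_space) atlas \<Rightarrow> 'a set \<Rightarrow> ('a \<Rightarrow> real)
    \<Rightarrow> 'a \<Rightarrow> 'a tvec \<Rightarrow> real" where
  "sub_differential A S f p w =
     (THE r. \<exists>c. curve_in A S p c \<and> velocity A c 0 = w \<and> r = deriv (\<lambda>t. f (c t)) 0)"

definition Sigma_L :: "('a, 'e::euclidean_space) atlas \<Rightarrow> ('a tpoint, 'f::euclidean_space) atlas
    \<Rightarrow> ('a tpoint tpoint \<Rightarrow> real) \<Rightarrow> 'a tpoint tpoint ctpoint set" where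
  "Sigma_L Q E L =
     (let TD = tangent_atlas E; D2 = admissible_velocities Q E in
      {(v, \<mu>). v \<in> D2 \<and> \<mu> \<in> cotangent_space TD v \<and>
         (\<forall>w\<in>sub_tangent_space TD D2 v. \<mu> w = sub_differential TD D2 L v w)})"

definition vertical_lift :: "('b, 'f::euclidean_space) atlas \<Rightarrow> 'b tpoint \<Rightarrow> 'b tvec \<Rightarrow> 'b tpoint tvec" where
  "vertical_lift E v X = velocity (tangent_atlas E) (\<lambda>t. (fst v, \<lambda>f. snd v f + t * X f)) 0"

definition Psi_map :: "('b, 'f::euclidean_space) atlas \<Rightarrow> 'b tpoint ctpoint \<Rightarrow> 'b ctpoint" where
  "Psi_map E m = (fst (fst m),
     \<lambda>X. if X \<in> tangent_space E (fst (fst m)) then snd m (vertical_lift E (fst m) X) else 0)"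

text \<open>The Legendre transform is \<open>Psi_map\<close> restricted to \<open>Sigma_L\<close>.\<close>
definition regular_system :: "('a, 'e::euclidean_space) atlas \<Rightarrow> ('a tpoint, 'f::euclidean_space) atlas
    \<Rightarrow> ('a tpoint tpoint \<Rightarrow> real) \<Rightarrow> bool" where
  "regular_system Q E L \<longleftrightarrow>
     local_diffeo_on (cotangent_atlas (tangent_atlas E)) (Sigma_L Q E L) (cotangent_atlas E) (Psi_map E)"

text \<open>A smooth (local) inverse \<open>s\<close> of the Legendre transform on an open subset \<open>U\<close> of \<open>T\<^sup>*D\<close>.\<close>
definition legendre_inverse :: "('a, 'e::euclidean_space) atlas \<Rightarrow> ('a tpoint, 'f::euclidean_space) atlas
    \<Rightarrow> ('a tpoint tpoint \<Rightarrow> real) \<Rightarrow> 'a tpoint ctpoint set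
    \<Rightarrow> ('a tpoint ctpoint \<Rightarrow> 'a tpoint tpoint ctpoint) \<Rightarrow> bool" where
  "legendre_inverse Q E L U s \<longleftrightarrow> openin (atlas_topology (cotangent_atlas E)) U \<and>
     (\<forall>a\<in>U. s a \<in> Sigma_L Q E L \<and> Psi_map E (s a) = a \<and>
        smooth_at (cotangent_atlas E) (cotangent_atlas (tangent_atlas E)) s a)"

text \<open>\<open>fst (s a)\<close> is the projection of \<open>s a\<close> to \<open>TD\<close>.\<close>
definition hamiltonian :: "('b tpoint \<Rightarrow> real) \<Rightarrow> ('b ctpoint \<Rightarrow> 'b tpoint ctpoint) \<Rightarrow> 'b ctpoint \<Rightarrow> real" where
  "hamiltonian L s a = snd a (snd (fst (s a))) - L (fst (s a))"

section \<open>Coordinate expressions\<close>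

definition partial_deriv :: "('e::real_vector \<Rightarrow> real) \<Rightarrow> 'e \<Rightarrow> 'e \<Rightarrow> real" where
  "partial_deriv f x b = deriv (\<lambda>s. f (x + s *\<^sub>R b)) 0"

text \<open>The coefficient \<open>\<rho>\<^sub>A\<^sup>i\<close> of \<open>e\<^sub>A = \<rho>\<^sub>A\<^sup>i \<partial>/\<partial>q\<^sup>i\<close>, as a function of \<open>q\<close>.\<close>
definition rho :: "('a, real^'n) chart \<Rightarrow> ('k \<Rightarrow> 'a \<Rightarrow> 'a tvec) \<Rightarrow> 'k \<Rightarrow> 'n \<Rightarrow> real^'n \<Rightarrow> real" where
  "rho c e A i q = e A (chart_inv c q) (\<lambda>x. snd c x $ i)"

text \<open>\<open>L\<close> in the coordinates \<open>(q\<^sup>i, y\<^sup>A, ydot\<^sup>A)\<close> of the admissible velocities, which sit in the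
  coordinates \<open>((q\<^sup>i, y\<^sup>A), (qdot\<^sup>i, ydot\<^sup>A))\<close> of \<open>TD\<close> as \<open>qdot\<^sup>i = \<rho>\<^sub>A\<^sup>i(q) y\<^sup>A\<close>.\<close>
definition local_lagrangian :: "('a tpoint, (real^'n) \<times> (real^'k)) atlas \<Rightarrow> 'a tpoint set
    \<Rightarrow> ('a tpoint tpoint \<Rightarrow> real) \<Rightarrow> ('a, real^'n) chart \<Rightarrow> ('k \<Rightarrow> 'a \<Rightarrow> 'a tvec)
    \<Rightarrow> real^'n \<Rightarrow> real^'k \<Rightarrow> real^'k \<Rightarrow> real" where
  "local_lagrangian E D L c e q y z =
     L (chart_inv (tangent_chart E (dist_chart D c e))
          ((q, y), (\<chi> i. \<Sum>A\<in>UNIV. rho c e A i q * y $ A, z)))"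

text \<open>The curve components \<open>q, y, p, P\<close> below stand for \<open>q\<^sup>i, y\<^sup>A, p\<^sub>i, p\<^sub>A\<close>.\<close>
definition hamilton_equations ::
    "(real^'n \<Rightarrow> real^'k \<Rightarrow> real^'n \<Rightarrow> real^'k \<Rightarrow> real) \<Rightarrow> real set
     \<Rightarrow> (real \<Rightarrow> real^'n) \<Rightarrow> (real \<Rightarrow> real^'k) \<Rightarrow> (real \<Rightarrow> real^'n) \<Rightarrow> (real \<Rightarrow> real^'k) \<Rightarrow> bool" where
  "hamilton_equations h I q y p P \<longleftrightarrow> (\<forall>t\<in>I.
     (\<forall>i. ((\<lambda>t. q t $ i) has_real_derivative
        partial_deriv (\<lambda>p'. h (q t) (y t) p' (P t)) (p t) (axis i 1)) (at t)) \<and>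
     (\<forall>A. ((\<lambda>t. y t $ A) has_real_derivative
        partial_deriv (\<lambda>P'. h (q t) (y t) (p t) P') (P t) (axis A 1)) (at t)) \<and>
     (\<forall>i. ((\<lambda>t. p t $ i) has_real_derivative
        - partial_deriv (\<lambda>q'. h q' (y t) (p t) (P t)) (q t) (axis i 1)) (at t)) \<and>
     (\<forall>A. ((\<lambda>t. P t $ A) has_real_derivative
        - partial_deriv (\<lambda>y'. h (q t) y' (p t) (P t)) (y t) (axis A 1)) (at t)))"

text \<open>Hamilton's equations written out in terms of \<open>L\<close>, where \<open>z t\<close> is the value of
  \<open>ydot\<^sup>A(q\<^sup>i, y\<^sup>A, p\<^sub>A)\<close> along the curve.\<close>
definition explicit_equations ::
    "('k \<Rightarrow> 'n \<Rightarrow> real^'n \<Rightarrow> real) \<Rightarrow> (real^'n \<Rightarrow> real^'k \<Rightarrow> real^'k \<Rightarrow> real) \<Rightarrow> real set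
     \<Rightarrow> (real \<Rightarrow> real^'n) \<Rightarrow> (real \<Rightarrow> real^'k) \<Rightarrow> (real \<Rightarrow> real^'n) \<Rightarrow> (real \<Rightarrow> real^'k)
     \<Rightarrow> (real \<Rightarrow> real^'k) \<Rightarrow> bool" where
  "explicit_equations r l I q y p P z \<longleftrightarrow> (\<forall>t\<in>I.
     (\<forall>i. ((\<lambda>t. q t $ i) has_real_derivative (\<Sum>A\<in>UNIV. r A i (q t) * y t $ A)) (at t)) \<and>
     (\<forall>A. ((\<lambda>t. y t $ A) has_real_derivative z t $ A) (at t)) \<and>
     (\<forall>i. ((\<lambda>t. p t $ i) has_real_derivative
        partial_deriv (\<lambda>q'. l q' (y t) (z t)) (q t) (axis i 1)
        - (\<Sum>j\<in>UNIV. \<Sum>A\<in>UNIV. p t $ j * partial_deriv (r A j) (q t) (axis i 1) * y t $ A)) (at t)) \<and>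
     (\<forall>A. ((\<lambda>t. P t $ A) has_real_derivative
        partial_deriv (\<lambda>y'. l (q t) y' (z t)) (y t) (axis A 1)
        - (\<Sum>j\<in>UNIV. p t $ j * r A j (q t))) (at t)))"

definition constrained_euler_lagrange ::
    "('k \<Rightarrow> 'n \<Rightarrow> real^'n \<Rightarrow> real) \<Rightarrow> (real^'n \<Rightarrow> real^'k \<Rightarrow> real^'k \<Rightarrow> real) \<Rightarrow> real set
     \<Rightarrow> (real \<Rightarrow> real^'n) \<Rightarrow> (real \<Rightarrow> real^'k) \<Rightarrow> (real \<Rightarrow> real^'n) \<Rightarrow> bool" where
  "constrained_euler_lagrange r l I q y lam \<longleftrightarrow>
     (let yd = (\<lambda>t. vector_derivative y (at t));
          l_yd = (\<lambda>A t. partial_deriv (\<lambda>z'. l (q t) (y t) z') (yd t) (axis A 1))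
      in \<forall>t\<in>I. y differentiable (at t) \<and>
       (\<forall>i. (\<lambda>t. lam t $ i) differentiable (at t) \<and>
          deriv (\<lambda>t. lam t $ i) t - partial_deriv (\<lambda>q'. l q' (y t) (yd t)) (q t) (axis i 1)
          + (\<Sum>j\<in>UNIV. \<Sum>A\<in>UNIV. lam t $ j * partial_deriv (r A j) (q t) (axis i 1) * y t $ A) = 0) \<and>
       (\<forall>A. l_yd A differentiable (at t) \<and>
          deriv (l_yd A) t - partial_deriv (\<lambda>y'. l (q t) y' (yd t)) (y t) (axis A 1)
          + (\<Sum>i\<in>UNIV. r A i (q t) * lam t $ i) = 0) \<and>
       (\<forall>i. ((\<lambda>t. q t $ i) has_real_derivative (\<Sum>A\<in>UNIV. r A i (q t) * y t $ A)) (at t)))"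

end

theory Submission
  imports Defs
begin

text \<open>In coordinates \<open>(q, y, z)\<close> of the admissible velocities, \<open>z = dy/dt\<close>, the Legendre transform is
  \<open>(q, y, z, p) \<mapsto> (q, y, p, \<partial>l/\<partial>z)\<close>. If \<open>z = \<zeta>(q, y, p, P)\<close> is a local inverse, then \<open>P = \<partial>l/\<partial>z\<close> at
  \<open>z = \<zeta>\<close>; hence the derivatives of \<open>\<zeta>\<close> cancel in \<open>d(P \<zeta> + p \<rho>(q) y - l(q, y, \<zeta>))\<close>, and Hamilton's
  equations become the explicit ones, in which substituting \<open>P = \<partial>l/\<partial>z\<close> gives the constrained
  Euler-Lagrange equations. That \<open>\<Sigma>\<^sub>L\<close> has its local form rests on every solution \<open>(q, y, dq/dt, dy/dt)\<close> of
  \<open>dq/dt = \<rho>(q) y\<close> being the velocity of an admissible curve, that is on the existence theorem for ordinary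
  differential equations. The symplectic form is \<open>dq \<and> dp\<close> in every natural chart because changes of natural
  charts preserve the Liouville form, and the flow preserves it because its linearisation solves
  \<open>P' = J Hess(h) P\<close>.\<close>

section \<open>Smooth maps between Euclidean spaces\<close>

text \<open>The Legendre transform is only a local diffeomorphism, so a global Hamiltonian need not
  exist: the equations are proved for an arbitrary smooth local inverse \<open>s\<close> on an open
  \<open>U\<close>, and the way back from the Euler-Lagrange side is local in time, the inverse
  being chosen near one point of a lifted curve. Neither the admissible velocities nor
  \<open>Sigma_L\<close> carries an atlas; both are mere subsets of a bundle. The immersion
  \<open>emb\<close>, (q, y, z) -> (q, y, \<rho>(q) y, z), does the work of a chart: through it
  \<open>L\<close> becomes a smooth function \<open>lp\<close> on an open set, and a covector over
  an admissible velocity lies in \<open>Sigma_L\<close> exactly when its pullback along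
  \<open>emb\<close> is the differential of \<open>lp\<close>. Tangent vectors are functionals on
  all real functions. They are replaced by \<open>dvec\<close>, which is fixed by its components in
  one chart, and covectors by \<open>covec\<close>, so that geometric claims become claims about
  Frechet derivatives. Adapted charts belong only to the maximal atlas of \<open>Q\<close>. The
  independence of ydot from p is local as well: a vanishing p-derivative gives constancy only over
  convex pieces of the domain.\<close>

abbreviation fd :: "('e::euclidean_space \<Rightarrow> 'f::euclidean_space) \<Rightarrow> 'e \<Rightarrow> 'e \<Rightarrow> 'f" where
  "fd f x \<equiv> frechet_derivative f (at x)"

lemma fd_eq: "(f has_derivative f') (at x) \<Longrightarrow> fd f x = f'"
  using frechet_derivative_at by metis

lemma fd_works: "f differentiable (at x) \<Longrightarrow> (f has_derivative fd f x) (at x)"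
  using frechet_derivative_works by blast

section \<open>C^k maps: locality, bilinear operations and the chain rule\<close>

lemma C_k_on_subset: "C_k_on k S f \<Longrightarrow> T \<subseteq> S \<Longrightarrow> C_k_on k T f"
proof (induction k arbitrary: f)
  case 0
  then show ?case using continuous_on_subset by auto
next
  case (Suc k)
  then show ?case unfolding C_k_on.simps by blast
qed

text \<open>Openness matters: equality of values on a whole neighbourhood forces equality of
  derivatives, which carries the induction to the next order.\<close>

lemma C_k_on_cong:
  assumes "open S" "\<And>x. x \<in> S \<Longrightarrow> f x = g x" "C_k_on k S f"
  shows "C_k_on k S g"
  using assms(2,3)
proof (induction k arbitrary: f g)
  case 0
  then show ?case by (auto cong: continuous_on_cong_simp)
next
  case (Suc k)
  have d: "(g has_derivative fd f x) (at x)" if "x \<in> S" for x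
    using has_derivative_transform_within_open[OF fd_works assms(1) that] Suc.prems that
    unfolding C_k_on.simps by blast
  have "C_k_on k S (\<lambda>x. fd g x h)" for h
  proof (rule Suc.IH)
    show "fd f x h = fd g x h" if "x \<in> S" for x by (simp only: fd_eq[OF d[OF that]])
    show "C_k_on k S (\<lambda>x. fd f x h)" using Suc.prems(2) unfolding C_k_on.simps by blast
  qed
  with d show ?case unfolding C_k_on.simps using differentiableI by blast
qed

lemma C_k_on_imp_continuous: "C_k_on k S f \<Longrightarrow> continuous_on S f"
  by (cases k) (auto intro!: continuous_at_imp_continuous_on differentiable_imp_continuous_within)

lemma C_k_on_SucD: "C_k_on (Suc k) S f \<Longrightarrow> C_k_on k S f"
proof (induction k arbitrary: f)
  case 0
  then show ?case using C_k_on_imp_continuous by fastforce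
next
  case (Suc k)
  then show ?case unfolding C_k_on.simps(2)[of "Suc k"] C_k_on.simps(2)[of k S f] by blast
qed

lemma C_k_on_local:
  assumes "\<And>x. x \<in> S \<Longrightarrow> \<exists>T. open T \<and> x \<in> T \<and> C_k_on k T f"
  shows "C_k_on k S f"
  using assms
proof (induction k arbitrary: f)
  case 0
  then have "isCont f x" if "x \<in> S" for x
    using that by (metis C_k_on.simps(1) continuous_on_eq_continuous_at)
  then show ?case by (auto intro!: continuous_at_imp_continuous_on)
next
  case (Suc k)
  have "\<exists>T. open T \<and> x \<in> T \<and> C_k_on k T (\<lambda>x. fd f x h)" if "x \<in> S" for h x
    using Suc.prems[OF that] C_k_on.simps(2) by blast
  then have "C_k_on k S (\<lambda>x. fd f x h)" for h by (rule Suc.IH)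
  moreover have "f differentiable (at x)" if "x \<in> S" for x
    using Suc.prems[OF that] C_k_on.simps(2) by blast
  ultimately show ?case by simp
qed

lemma C_k_on_const: "C_k_on k S (\<lambda>x. c)"
  by (induction k arbitrary: c) auto

lemma C_k_on_linear: "bounded_linear f \<Longrightarrow> C_k_on k S f"
proof (cases k)
  case (Suc k')
  assume *: "bounded_linear f"
  then have "fd f x = f" for x by (intro fd_eq bounded_linear_imp_has_derivative)
  moreover have "f differentiable (at x)" for x using * bounded_linear_imp_differentiable by blast
  ultimately show ?thesis unfolding Suc C_k_on.simps(2) by (simp add: C_k_on_const)
qed (auto intro: linear_continuous_on)

lemma C_k_on_SucI:
  assumes "open S" "\<And>x. x \<in> S \<Longrightarrow> (f has_derivative f' x) (at x)" "\<And>h. C_k_on k S (\<lambda>x. f' x h)"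
  shows "C_k_on (Suc k) S f"
proof -
  have "C_k_on k S (\<lambda>x. fd f x h)" for h
    by (rule C_k_on_cong[OF assms(1) _ assms(3)]) (simp add: fd_eq[OF assms(2)])
  with assms(2) show ?thesis using differentiableI unfolding C_k_on.simps(2) by blast
qed

lemma C_k_on_add:
  assumes "open S" "C_k_on k S f" "C_k_on k S g"
  shows "C_k_on k S (\<lambda>x. f x + g x)"
  using assms(2,3)
proof (induction k arbitrary: f g)
  case (Suc k)
  show ?case
    using Suc.prems
    by (intro C_k_on_SucI[OF assms(1), of _ "\<lambda>x h. fd f x h + fd g x h"] Suc.IH has_derivative_add fd_works)
       auto
qed (auto intro: continuous_intros)

lemma C_k_on_bilinear:
  fixes f :: "'e::euclidean_space \<Rightarrow> 'f::euclidean_space" and g :: "'e \<Rightarrow> 'g::euclidean_space"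
    and b :: "'f \<Rightarrow> 'g \<Rightarrow> 'h::euclidean_space"
  assumes "open S" "bounded_bilinear b" "C_k_on k S f" "C_k_on k S g"
  shows "C_k_on k S (\<lambda>x. b (f x) (g x))"
  using assms(3,4)
proof (induction k arbitrary: f g)
  case 0
  then show ?case by (auto intro: bounded_bilinear.continuous_on[OF assms(2)])
next
  case (Suc k)
  have *: "((\<lambda>x. b (f x) (g x)) has_derivative (\<lambda>h. b (f x) (fd g x h) + b (fd f x h) (g x))) (at x)"
    if "x \<in> S" for x
    using Suc.prems that by (intro bounded_bilinear.FDERIV[OF assms(2)]) (auto intro!: fd_works)
  have "C_k_on k S (\<lambda>x. b (f x) (fd g x h) + b (fd f x h) (g x))" for h
    using Suc.prems C_k_on_SucD[OF Suc.prems(1)] C_k_on_SucD[OF Suc.prems(2)]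
    by (intro C_k_on_add assms(1) Suc.IH) auto
  with * show ?case by (rule C_k_on_SucI[OF assms(1)])
qed

lemma C_k_on_sum:
  "open S \<Longrightarrow> (\<And>i. i \<in> I \<Longrightarrow> C_k_on k S (f i)) \<Longrightarrow> C_k_on k S (\<lambda>x. \<Sum>i\<in>I. f i x)"
  by (induction I rule: infinite_finite_induct) (auto intro: C_k_on_const C_k_on_add)

lemma linear_fd: "f differentiable (at x) \<Longrightarrow> linear (fd f x)"
  by (rule linear_frechet_derivative)

text \<open>\<open>C_k_on\<close> controls derivatives along fixed directions only. Expanding a
  direction in the basis reduces derivatives along varying directions, as they occur in the chain
  rule, to these.\<close>

lemma fd_expand:
  fixes f :: "'e::euclidean_space \<Rightarrow> 'f::euclidean_space"
  assumes "f differentiable (at x)"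
  shows "fd f x h = (\<Sum>b\<in>Basis. (h \<bullet> b) *\<^sub>R fd f x b)"
proof -
  have "fd f x h = fd f x (\<Sum>b\<in>Basis. (h \<bullet> b) *\<^sub>R b)" by (simp add: euclidean_representation)
  also have "\<dots> = (\<Sum>b\<in>Basis. (h \<bullet> b) *\<^sub>R fd f x b)"
    using linear_fd[OF assms] by (simp add: linear_sum linear_cmul)
  finally show ?thesis .
qed

lemma C_k_on_compose:
  assumes "open S" "f ` S \<subseteq> T" "C_k_on k T g" "C_k_on k S f"
  shows "C_k_on k S (\<lambda>x. g (f x))"
  using assms(3,4)
proof (induction k arbitrary: g)
  case 0
  then show ?case using assms(2) continuous_on_compose2 by auto
next
  case (Suc k)
  have *: "((\<lambda>x. g (f x)) has_derivative (\<lambda>h. fd g (f x) (fd f x h))) (at x)" if "x \<in> S" for x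
  proof -
    have "(f has_derivative fd f x) (at x)" "(g has_derivative fd g (f x)) (at (f x))"
      using Suc.prems that assms(2) by (auto intro!: fd_works)
    from has_derivative_compose[OF this] show ?thesis .
  qed
  \<comment> \<open>The direction \<open>fd f x h\<close> moves with x; after the expansion the
    induction hypothesis applies to the derivative of g along each fixed b.\<close>
  have "C_k_on k S (\<lambda>x. \<Sum>b\<in>Basis. (fd f x h \<bullet> b) *\<^sub>R fd g (f x) b)" for h
    using Suc.prems C_k_on_SucD[OF Suc.prems(2)]
    by (intro C_k_on_sum C_k_on_bilinear[OF assms(1) bounded_bilinear_scaleR]
        C_k_on_bilinear[OF assms(1) bounded_bilinear_inner] C_k_on_const Suc.IH assms(1)) auto
  moreover have "(\<lambda>h. fd g (f x) (fd f x h)) = (\<lambda>h. \<Sum>b\<in>Basis. (fd f x h \<bullet> b) *\<^sub>R fd g (f x) b)" if "x \<in> S" for x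
    using Suc.prems(1) that assms(2) by (intro ext fd_expand) auto
  ultimately show ?case
    using * by (intro C_k_on_SucI[OF assms(1), of _ "\<lambda>x h. \<Sum>b\<in>Basis. (fd f x h \<bullet> b) *\<^sub>R fd g (f x) b"]) auto
qed

section \<open>Closure properties of smooth maps\<close>

lemma smooth_on_subset: "smooth_on S f \<Longrightarrow> T \<subseteq> S \<Longrightarrow> smooth_on T f"
  unfolding smooth_on_def using C_k_on_subset by blast

lemma smooth_on_cong: "smooth_on S f \<Longrightarrow> open S \<Longrightarrow> (\<And>x. x \<in> S \<Longrightarrow> f x = g x) \<Longrightarrow> smooth_on S g"
  unfolding smooth_on_def using C_k_on_cong by blast

lemma smooth_on_imp_continuous: "smooth_on S f \<Longrightarrow> continuous_on S f"
  unfolding smooth_on_def using C_k_on_imp_continuous by blast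

lemma smooth_on_imp_differentiable: "smooth_on S f \<Longrightarrow> x \<in> S \<Longrightarrow> f differentiable (at x)"
  unfolding smooth_on_def using C_k_on.simps(2) by blast

lemma smooth_on_has_derivative: "smooth_on S f \<Longrightarrow> x \<in> S \<Longrightarrow> (f has_derivative fd f x) (at x)"
  by (rule fd_works[OF smooth_on_imp_differentiable])

lemma smooth_on_local:
  "(\<And>x. x \<in> S \<Longrightarrow> \<exists>T. open T \<and> x \<in> T \<and> smooth_on T f) \<Longrightarrow> smooth_on S f"
  unfolding smooth_on_def by (meson C_k_on_local)

lemma smooth_on_fd_dir: "smooth_on S f \<Longrightarrow> smooth_on S (\<lambda>x. fd f x h)"
  unfolding smooth_on_def by (metis C_k_on.simps(2))

lemma smooth_on_compose:
  "smooth_on T g \<Longrightarrow> smooth_on S f \<Longrightarrow> open S \<Longrightarrow> f ` S \<subseteq> T \<Longrightarrow> smooth_on S (\<lambda>x. g (f x))"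
  unfolding smooth_on_def using C_k_on_compose by blast

named_theorems smooth_intros

lemma smooth_on_const [smooth_intros]: "smooth_on S (\<lambda>x. c)"
  by (simp add: smooth_on_def C_k_on_const)

lemma smooth_on_linear: "bounded_linear f \<Longrightarrow> smooth_on S f"
  by (simp add: smooth_on_def C_k_on_linear)

lemma smooth_on_ident [smooth_intros]: "smooth_on S (\<lambda>x. x)"
  by (rule smooth_on_linear) (rule bounded_linear_ident)

lemma smooth_on_linear_compose: "bounded_linear l \<Longrightarrow> open S \<Longrightarrow> smooth_on S f \<Longrightarrow> smooth_on S (\<lambda>x. l (f x))"
  by (rule smooth_on_compose[of UNIV l, OF smooth_on_linear]) auto

lemma smooth_on_add [smooth_intros]:
  "open S \<Longrightarrow> smooth_on S f \<Longrightarrow> smooth_on S g \<Longrightarrow> smooth_on S (\<lambda>x. f x + g x)"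
  by (simp add: smooth_on_def C_k_on_add)

lemma smooth_on_bilinear:
  "open S \<Longrightarrow> bounded_bilinear b \<Longrightarrow> smooth_on S f \<Longrightarrow> smooth_on S g \<Longrightarrow> smooth_on S (\<lambda>x. b (f x) (g x))"
  by (simp add: smooth_on_def C_k_on_bilinear)

lemmas smooth_on_scaleR [smooth_intros] = smooth_on_bilinear[OF _ bounded_bilinear_scaleR]
lemmas smooth_on_inner [smooth_intros] = smooth_on_bilinear[OF _ bounded_bilinear_inner]
lemmas smooth_on_mult [smooth_intros] =
  smooth_on_bilinear[where b = "(*) :: real \<Rightarrow> _", OF _ bounded_bilinear_mult]
lemmas smooth_on_fst [smooth_intros] = smooth_on_linear_compose[OF bounded_linear_fst]
lemmas smooth_on_snd [smooth_intros] = smooth_on_linear_compose[OF bounded_linear_snd]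
lemmas smooth_on_minus [smooth_intros] = smooth_on_linear_compose[OF bounded_linear_minus[OF bounded_linear_ident]]

lemma smooth_on_diff [smooth_intros]:
  "open S \<Longrightarrow> smooth_on S f \<Longrightarrow> smooth_on S g \<Longrightarrow> smooth_on S (\<lambda>x. f x - g x)"
  using smooth_on_add[OF _ _ smooth_on_minus, of S f g] by simp

lemma smooth_on_sum [smooth_intros]:
  "open S \<Longrightarrow> (\<And>i. i \<in> I \<Longrightarrow> smooth_on S (f i)) \<Longrightarrow> smooth_on S (\<lambda>x. \<Sum>i\<in>I. f i x)"
  by (simp add: smooth_on_def C_k_on_sum)

lemma smooth_on_prod [smooth_intros]:
  fixes f :: "'i \<Rightarrow> 'e::euclidean_space \<Rightarrow> real"
  shows "open S \<Longrightarrow> (\<And>i. i \<in> I \<Longrightarrow> smooth_on S (f i)) \<Longrightarrow> smooth_on S (\<lambda>x. \<Prod>i\<in>I. f i x)"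
  by (induction I rule: infinite_finite_induct) (auto intro: smooth_intros)

lemma smooth_on_Pair [smooth_intros]:
  assumes "open S" "smooth_on S f" "smooth_on S g"
  shows "smooth_on S (\<lambda>x. (f x, g x))"
proof -
  have bl: "bounded_linear (\<lambda>x. (x, 0))" "bounded_linear (\<lambda>x. (0, x))"
    by (intro bounded_linear_Pair bounded_linear_ident bounded_linear_zero)+
  have "smooth_on S (\<lambda>x. (f x, 0) + (0, g x))"
    by (rule smooth_on_add[OF assms(1) smooth_on_linear_compose[OF bl(1) assms(1,2)]
        smooth_on_linear_compose[OF bl(2) assms(1,3)]])
  then show ?thesis by simp
qed

lemma smooth_on_euclidean:
  assumes "open S" "\<And>b. b \<in> Basis \<Longrightarrow> smooth_on S (\<lambda>x. f x \<bullet> b)"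
  shows "smooth_on S f"
proof -
  have "smooth_on S (\<lambda>x. \<Sum>b\<in>Basis. (f x \<bullet> b) *\<^sub>R b)"
    by (intro smooth_on_sum smooth_on_scaleR smooth_on_const assms)
  then show ?thesis by (simp add: euclidean_representation)
qed

lemma smooth_on_vec_nth [smooth_intros]:
  "open S \<Longrightarrow> smooth_on S f \<Longrightarrow> smooth_on S (\<lambda>x. f x $ (i::'n::finite) :: real)"
  by (rule smooth_on_linear_compose[OF bounded_linear_vec_nth])

lemma smooth_on_vec [smooth_intros]:
  assumes "open S" "\<And>i. smooth_on S (f i)"
  shows "smooth_on S (\<lambda>x. (\<chi> i. f i x) :: real^'n::finite)"
proof (rule smooth_on_euclidean[OF assms(1)])
  fix b :: "real^'n" assume "b \<in> Basis"
  then obtain i where "b = axis i 1" by (auto simp: Basis_vec_def)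
  with assms(2) show "smooth_on S (\<lambda>x. (\<chi> i. f i x) \<bullet> b)" by (simp add: inner_axis)
qed

text \<open>Joint smoothness in base point and direction, again by expanding the direction in the
  basis; transitions of tangent charts have this form.\<close>

lemma smooth_on_fd [smooth_intros]:
  assumes "open S" "open T" "smooth_on T f" "smooth_on S g" "smooth_on S v" "g ` S \<subseteq> T"
  shows "smooth_on S (\<lambda>x. fd f (g x) (v x))"
proof -
  have "smooth_on S (\<lambda>x. fd f (g x) b)" for b
    by (rule smooth_on_compose[OF smooth_on_fd_dir[OF assms(3)] assms(4,1,6)])
  then have "smooth_on S (\<lambda>x. \<Sum>b\<in>Basis. (v x \<bullet> b) *\<^sub>R fd f (g x) b)"
    by (intro smooth_on_sum smooth_on_scaleR smooth_on_inner smooth_on_const assms)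
  moreover have "(\<Sum>b\<in>Basis. (v x \<bullet> b) *\<^sub>R fd f (g x) b) = fd f (g x) (v x)" if "x \<in> S" for x
    using fd_expand[OF smooth_on_imp_differentiable[OF assms(3)], of "g x" "v x"] assms(6) that by auto
  ultimately show ?thesis by (rule smooth_on_cong[OF _ assms(1)])
qed

text \<open>The derivative of 1/f is a polynomial in 1/f and the derivative of f, so each order of
  smoothness of 1/f yields the next.\<close>

lemma smooth_on_inverse:
  fixes f :: "'e::euclidean_space \<Rightarrow> real"
  assumes "open S" "smooth_on S f" "\<And>x. x \<in> S \<Longrightarrow> f x \<noteq> 0"
  shows "smooth_on S (\<lambda>x. inverse (f x))"
proof -
  have "C_k_on k S (\<lambda>x. inverse (f x))" for k
  proof (induction k)
    case 0
    then show ?case using assms(3) smooth_on_imp_continuous[OF assms(2)] by (auto intro: continuous_intros)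
  next
    case (Suc k)
    have *: "((\<lambda>x. inverse (f x)) has_derivative (\<lambda>h. - (inverse (f x) * fd f x h * inverse (f x)))) (at x)"
      if "x \<in> S" for x
      by (rule Deriv.has_derivative_inverse[OF assms(3) smooth_on_has_derivative[OF assms(2)]]) (use that in auto)
    have f': "C_k_on k S (\<lambda>x. fd f x h)" for h
      using smooth_on_fd_dir[OF assms(2)] by (simp add: smooth_on_def)
    have "C_k_on k S (\<lambda>x. - (inverse (f x) * fd f x h * inverse (f x)))" for h
      by (rule C_k_on_compose[of S _ UNIV k uminus])
         (intro C_k_on_linear bounded_linear_minus bounded_linear_ident assms(1) subset_UNIV
            C_k_on_bilinear[OF assms(1) bounded_bilinear_mult] Suc f')+
    with * show ?case by (rule C_k_on_SucI[OF assms(1)])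
  qed
  then show ?thesis by (simp add: smooth_on_def)
qed

lemma smooth_on_divide:
  fixes f :: "'e::euclidean_space \<Rightarrow> real"
  assumes "open S" "smooth_on S f" "smooth_on S g" "\<And>x. x \<in> S \<Longrightarrow> g x \<noteq> 0"
  shows "smooth_on S (\<lambda>x. f x / g x)"
  using assms smooth_on_mult[OF _ _ smooth_on_inverse, of S f g] by (simp add: divide_inverse)

lemma smooth_on_det:
  fixes M :: "'e::euclidean_space \<Rightarrow> real^'k::finite^'k"
  assumes "open S" "\<And>i j. smooth_on S (\<lambda>x. M x $ i $ j)"
  shows "smooth_on S (\<lambda>x. det (M x))"
  unfolding det_def using assms by (intro smooth_on_sum smooth_on_mult smooth_on_const smooth_on_prod)

text \<open>By Cramer's rule the solution is a quotient of determinants, a rational expression in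
  the smooth data.\<close>

lemma smooth_on_linear_system:
  fixes M :: "'e::euclidean_space \<Rightarrow> real^'k::finite^'k"
  assumes "open S" "\<And>i j. smooth_on S (\<lambda>x. M x $ i $ j)" "smooth_on S b"
    and "\<And>x. x \<in> S \<Longrightarrow> invertible (M x)" "\<And>x. x \<in> S \<Longrightarrow> M x *v y x = b x"
  shows "smooth_on S y"
proof -
  have "smooth_on S (\<lambda>x. \<chi> k. det (\<chi> i j. if j = k then b x $ i else M x $ i $ j) / det (M x))"
  proof (rule smooth_on_vec[OF assms(1)], rule smooth_on_divide[OF assms(1)])
    fix k
    have "smooth_on S (\<lambda>x. (\<chi> i j. if j = k then b x $ i else M x $ i $ j) $ i $ j)" for i j
      using assms(2) smooth_on_vec_nth[OF assms(1,3)] by (cases "j = k") simp_all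
    then show "smooth_on S (\<lambda>x. det (\<chi> i j. if j = k then b x $ i else M x $ i $ j))"
      by (rule smooth_on_det[OF assms(1)])
    show "smooth_on S (\<lambda>x. det (M x))" by (rule smooth_on_det[OF assms(1,2)])
    show "det (M x) \<noteq> 0" if "x \<in> S" for x using assms(4)[OF that] by (simp add: invertible_det_nz)
  qed
  moreover have "(\<chi> k. det (\<chi> i j. if j = k then b x $ i else M x $ i $ j) / det (M x)) = y x"
    if "x \<in> S" for x
    using cramer[of "M x" "y x" "b x"] assms that invertible_det_nz by metis
  ultimately show ?thesis by (rule smooth_on_cong[OF _ assms(1)])
qed

text \<open>Schwarz's theorem by the second difference f(x + su + sw) - f(x + su) - f(x + sw) +
  f(x). It is symmetric in u and w, and the mean value theorem, applied twice, identifies it with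
  s^2 times either mixed derivative at a point near x, where continuity takes over.\<close>

lemma fd_symmetric_real:
  fixes f :: "'e::euclidean_space \<Rightarrow> real"
  assumes "open S" "smooth_on S f" "x \<in> S"
  shows "fd (\<lambda>y. fd f y u) x w = fd (\<lambda>y. fd f y w) x u"
proof -
  define G where "G = (\<lambda>u w y. fd (\<lambda>y. fd f y u) y w)"
  have G: "isCont (G u w) x" for u w
    using smooth_on_fd_dir[OF smooth_on_fd_dir[OF assms(2)]] assms(1,3) smooth_on_imp_continuous
    unfolding G_def using continuous_on_eq_continuous_at by blast
  obtain r where r: "r > 0" "ball x r \<subseteq> S"
    using assms open_contains_ball by blast
  \<comment> \<open>Stated for arbitrary directions, since it is used once for (u, w) and once for
    (w, u).\<close>
  have main: "\<exists>z\<in>ball x e. f (x + s *\<^sub>R u + s *\<^sub>R w) - f (x + s *\<^sub>R u) - f (x + s *\<^sub>R w) + f x = s * s * G u w z"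
    if s: "0 < s" and e: "s * (norm u + norm w) < e" "e \<le> r" for u w s e
  proof -
    have in_ball: "x + a *\<^sub>R u + b *\<^sub>R w \<in> ball x e" if "0 \<le> a" "a \<le> s" "0 \<le> b" "b \<le> s" for a b
    proof -
      have "norm (a *\<^sub>R u + b *\<^sub>R w) \<le> a * norm u + b * norm w"
        using that norm_triangle_ineq[of "a *\<^sub>R u" "b *\<^sub>R w"] by simp
      also have "\<dots> \<le> s * norm u + s * norm w"
        using that by (intro add_mono mult_right_mono) auto
      finally have "norm (a *\<^sub>R u + b *\<^sub>R w) < e" using e by (simp add: algebra_simps)
      moreover have "dist x (x + a *\<^sub>R u + b *\<^sub>R w) = norm (a *\<^sub>R u + b *\<^sub>R w)"
        by (metis add.assoc add_diff_cancel_left' dist_commute dist_norm)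
      ultimately show ?thesis by simp
    qed
    then have inS: "x + a *\<^sub>R u + b *\<^sub>R w \<in> S" if "0 \<le> a" "a \<le> s" "0 \<le> b" "b \<le> s" for a b
      using r e that by (meson subsetD subset_ball)
    have d1: "((\<lambda>a. f (x + a *\<^sub>R u + b *\<^sub>R w)) has_real_derivative fd f (x + a *\<^sub>R u + b *\<^sub>R w) u) (at a)"
      if "0 \<le> a" "a \<le> s" "0 \<le> b" "b \<le> s" for a b
    proof -
      have "((\<lambda>a. x + a *\<^sub>R u + b *\<^sub>R w) has_derivative (\<lambda>h. h *\<^sub>R u)) (at a)"
        by (auto intro!: derivative_eq_intros)
      from has_derivative_compose[OF this smooth_on_has_derivative[OF assms(2) inS[OF that]]]
      show ?thesis
        by (rule has_derivative_imp_has_field_derivative)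
           (simp add: linear_cmul[OF linear_fd[OF smooth_on_imp_differentiable[OF assms(2) inS[OF that]]]])
    qed
    have d2: "((\<lambda>b. fd f (x + a *\<^sub>R u + b *\<^sub>R w) u) has_real_derivative G u w (x + a *\<^sub>R u + b *\<^sub>R w)) (at b)"
      if "0 \<le> a" "a \<le> s" "0 \<le> b" "b \<le> s" for a b
    proof -
      have "((\<lambda>b. x + a *\<^sub>R u + b *\<^sub>R w) has_derivative (\<lambda>h. h *\<^sub>R w)) (at b)"
        by (auto intro!: derivative_eq_intros)
      from has_derivative_compose[OF this smooth_on_has_derivative[OF smooth_on_fd_dir[OF assms(2), of u] inS[OF that]]]
      show ?thesis unfolding G_def
        by (rule has_derivative_imp_has_field_derivative)
           (simp add: linear_cmul[OF linear_fd[OF smooth_on_imp_differentiable[OF smooth_on_fd_dir[OF assms(2)] inS[OF that]]]])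
    qed
    \<comment> \<open>The first mean value runs along u and compares the two edges at w-offsets s
      and 0; the second runs along w at the intermediate value a.\<close>
    obtain a where a: "0 < a" "a < s" and a_eq:
      "(f (x + s *\<^sub>R u + s *\<^sub>R w) - f (x + s *\<^sub>R u + 0 *\<^sub>R w)) - (f (x + 0 *\<^sub>R u + s *\<^sub>R w) - f (x + 0 *\<^sub>R u + 0 *\<^sub>R w))
        = (s - 0) * (fd f (x + a *\<^sub>R u + s *\<^sub>R w) u - fd f (x + a *\<^sub>R u + 0 *\<^sub>R w) u)"
      using MVT2[of 0 s "\<lambda>a. f (x + a *\<^sub>R u + s *\<^sub>R w) - f (x + a *\<^sub>R u + 0 *\<^sub>R w)"
          "\<lambda>a. fd f (x + a *\<^sub>R u + s *\<^sub>R w) u - fd f (x + a *\<^sub>R u + 0 *\<^sub>R w) u", OF s DERIV_diff[OF d1 d1]] s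
      by auto
    obtain b where b: "0 < b" "b < s" and b_eq:
      "fd f (x + a *\<^sub>R u + s *\<^sub>R w) u - fd f (x + a *\<^sub>R u + 0 *\<^sub>R w) u = (s - 0) * G u w (x + a *\<^sub>R u + b *\<^sub>R w)"
      using MVT2[of 0 s "\<lambda>b. fd f (x + a *\<^sub>R u + b *\<^sub>R w) u" "\<lambda>b. G u w (x + a *\<^sub>R u + b *\<^sub>R w)", OF s d2] a
      by auto
    show ?thesis
      using a_eq b_eq a b in_ball[of a b]
      by (intro bexI[of _ "x + a *\<^sub>R u + b *\<^sub>R w"]) (auto simp: algebra_simps)
  qed
  show ?thesis
  proof (rule ccontr)
    assume ne: "\<not> ?thesis"
    define m where "m = \<bar>G u w x - G w u x\<bar>"
    have m: "m > 0" using ne by (simp add: m_def G_def)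
    obtain e1 where e1: "e1 > 0" "\<And>z. dist z x < e1 \<Longrightarrow> dist (G u w z) (G u w x) < m / 2"
      using G[of u w] half_gt_zero[OF m] unfolding continuous_at_eps_delta by blast
    obtain e2 where e2: "e2 > 0" "\<And>z. dist z x < e2 \<Longrightarrow> dist (G w u z) (G w u x) < m / 2"
      using G[of w u] half_gt_zero[OF m] unfolding continuous_at_eps_delta by blast
    define e where "e = min r (min e1 e2)"
    \<comment> \<open>Small enough to keep the parallelogram spanned by s u and s w inside the ball
      of radius e; the summand 1 avoids division by zero when u = w = 0.\<close>
    define s where "s = e / (2 * (norm u + norm w + 1))"
    have e: "e > 0" using r e1 e2 by (simp add: e_def)
    have pos: "norm u + norm w + 1 > 0"
      by (simp add: add_nonneg_pos)
    have s: "s > 0" using e pos by (simp add: s_def)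
    have "s * (norm u + norm w) \<le> s * (norm u + norm w + 1)" using s by simp
    also have "\<dots> = e / 2" using pos by (simp add: s_def field_simps)
    finally have se: "s * (norm u + norm w) < e" using e by simp
    obtain z1 where z1: "z1 \<in> ball x e"
      "f (x + s *\<^sub>R u + s *\<^sub>R w) - f (x + s *\<^sub>R u) - f (x + s *\<^sub>R w) + f x = s * s * G u w z1"
      using main[OF s se] by (auto simp: e_def)
    obtain z2 where z2: "z2 \<in> ball x e"
      "f (x + s *\<^sub>R w + s *\<^sub>R u) - f (x + s *\<^sub>R w) - f (x + s *\<^sub>R u) + f x = s * s * G w u z2"
      using main[OF s, of w u e] se by (auto simp: e_def add.commute)
    have "s * s * G u w z1 = s * s * G w u z2"
      using z1(2) z2(2) by (simp add: algebra_simps)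
    then have "G u w z1 = G w u z2" using s by simp
    moreover have "dist (G u w z1) (G u w x) < m / 2" "dist (G w u z2) (G w u x) < m / 2"
      using z1(1) z2(1) e1(2)[of z1] e2(2)[of z2] by (simp_all add: e_def dist_commute)
    ultimately show False unfolding m_def dist_real_def by (smt (verit) field_sum_of_halves)
  qed
qed

lemma fd_linear_compose:
  assumes "bounded_linear l" "f differentiable (at x)"
  shows "fd (\<lambda>y. l (f y)) x h = l (fd f x h)"
  using fd_eq[OF bounded_linear.has_derivative[OF assms(1) fd_works[OF assms(2)]]] by simp

lemma fd_symmetric:
  assumes "open S" "smooth_on S f" "x \<in> S"
  shows "fd (\<lambda>y. fd f y u) x w = fd (\<lambda>y. fd f y w) x u"
proof (rule euclidean_eqI)
  fix b :: 'b assume "b \<in> Basis"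
  have sm: "smooth_on S (\<lambda>y. f y \<bullet> b)" using assms by (intro smooth_intros)
  have *: "fd (\<lambda>y. f y \<bullet> b) y u = fd f y u \<bullet> b" if "y \<in> S" for y u
    using that assms by (intro fd_linear_compose bounded_linear_inner_left smooth_on_imp_differentiable)
  have "fd (\<lambda>y. fd (\<lambda>y. f y \<bullet> b) y u) x = fd (\<lambda>y. fd f y u \<bullet> b) x" for u
    using assms * sm smooth_on_imp_differentiable[OF smooth_on_fd_dir[OF sm]]
    by (intro frechet_derivative_transform_within_open) auto
  then have "fd (\<lambda>y. fd (\<lambda>y. f y \<bullet> b) y u) x w = fd (\<lambda>y. fd f y u) x w \<bullet> b" for u w
    using fd_linear_compose[OF bounded_linear_inner_left smooth_on_imp_differentiable[OF smooth_on_fd_dir[OF assms(2)] assms(3)]]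
    by simp
  then show "fd (\<lambda>y. fd f y u) x w \<bullet> b = fd (\<lambda>y. fd f y w) x u \<bullet> b"
    using fd_symmetric_real[OF assms(1) sm assms(3)] by simp
qed

text \<open>Bootstrapping: if w is C^k, then so is its derivative G(w), hence w is C^(k+1). It
  serves both the solutions from Picard iteration and curves that satisfy Hamilton's
  equations.\<close>

lemma smooth_on_ode:
  fixes w :: "real \<Rightarrow> 'e::euclidean_space"
  assumes "open I" "open S" "smooth_on S G"
    and w: "\<And>t. t \<in> I \<Longrightarrow> w t \<in> S" "\<And>t. t \<in> I \<Longrightarrow> (w has_vector_derivative G (w t)) (at t)"
  shows "smooth_on I w"
  unfolding smooth_on_def
proof
  fix k show "C_k_on k I w"
  proof (induction k)
    case 0
    have "continuous_on I w"
      using w(2) has_vector_derivative_continuous continuous_at_imp_continuous_on by blast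
    then show ?case by simp
  next
    case (Suc k)
    have "C_k_on k I (\<lambda>t. G (w t))"
      using C_k_on_compose[OF assms(1) _ _ Suc, of S G] assms(3) w(1) by (auto simp: smooth_on_def)
    then have "C_k_on k I (\<lambda>t. h *\<^sub>R G (w t))" for h
      by (rule C_k_on_bilinear[OF assms(1) bounded_bilinear_scaleR C_k_on_const])
    with w(2) show ?case
      unfolding has_vector_derivative_def by (rule C_k_on_SucI[OF assms(1)])
  qed
qed

text \<open>On a compact ball the sum of the norms of the basis derivatives is bounded, and it
  dominates the operator norm; convexity turns this into a Lipschitz bound.\<close>

lemma smooth_on_lipschitz_cball:
  fixes G :: "'e::euclidean_space \<Rightarrow> 'f::euclidean_space"
  assumes "smooth_on S G" "cball w r \<subseteq> S"
  obtains L where "L > 0" "\<And>x y. x \<in> cball w r \<Longrightarrow> y \<in> cball w r \<Longrightarrow> norm (G x - G y) \<le> L * norm (x - y)"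
proof -
  have "continuous_on (cball w r) (\<lambda>x. \<Sum>b\<in>Basis. norm (fd G x b))"
    using smooth_on_imp_continuous[OF smooth_on_fd_dir[OF assms(1)]] assms(2)
    by (intro continuous_intros) (rule continuous_on_subset)
  then have "bounded ((\<lambda>x. \<Sum>b\<in>Basis. norm (fd G x b)) ` cball w r)"
    using compact_cball compact_continuous_image compact_imp_bounded by blast
  then obtain L where L: "L > 0" "\<And>x. x \<in> cball w r \<Longrightarrow> \<bar>\<Sum>b\<in>Basis. norm (fd G x b)\<bar> \<le> L"
    unfolding bounded_pos by auto
  have "norm (G x - G y) \<le> L * norm (x - y)" if "x \<in> cball w r" "y \<in> cball w r" for x y
  proof (rule differentiable_bound[OF convex_cball _ _ that])
    fix z assume z: "z \<in> cball w r"
    have d: "G differentiable (at z)"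
      using z assms by (auto intro: smooth_on_imp_differentiable)
    show "(G has_derivative fd G z) (at z within cball w r)"
      by (rule has_derivative_at_withinI[OF fd_works[OF d]])
    show "onorm (fd G z) \<le> L"
    proof (rule onorm_le)
      fix h
      have "norm (fd G z h) \<le> (\<Sum>b\<in>Basis. norm ((h \<bullet> b) *\<^sub>R fd G z b))"
        unfolding fd_expand[OF d, of h] by (rule norm_sum)
      also have "\<dots> \<le> (\<Sum>b\<in>Basis. norm h * norm (fd G z b))"
        by (intro sum_mono) (auto intro!: mult_right_mono Basis_le_norm)
      also have "\<dots> = norm h * (\<Sum>b\<in>Basis. norm (fd G z b))" by (simp add: sum_distrib_left)
      also have "\<dots> \<le> norm h * L" using L(2)[OF z] by (intro mult_left_mono) auto
      finally show "norm (fd G z h) \<le> L * norm h" by (simp add: mult.commute)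
    qed
  qed
  with L(1) that show ?thesis by blast
qed

text \<open>Picard iteration on \<open>[-\<epsilon>, \<epsilon>]\<close>; a curve on this interval is represented by its extension to
  the real line that is constant on either side.\<close>

lemma ode_local_solution:
  fixes G :: "'e::euclidean_space \<Rightarrow> 'e"
  assumes "open S" "smooth_on S G" "w0 \<in> S"
  obtains \<epsilon> w where "\<epsilon> > 0" "w 0 = w0" "\<And>t. \<bar>t\<bar> < \<epsilon> \<Longrightarrow> w t \<in> S"
    "\<And>t. \<bar>t\<bar> < \<epsilon> \<Longrightarrow> (w has_vector_derivative G (w t)) (at t)"
proof -
  obtain r where r: "r > 0" "cball w0 r \<subseteq> S"
    using assms open_contains_cball by blast
  obtain L where L: "L > 0"
      "\<And>x y. x \<in> cball w0 r \<Longrightarrow> y \<in> cball w0 r \<Longrightarrow> norm (G x - G y) \<le> L * norm (x - y)"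
    using smooth_on_lipschitz_cball[OF assms(2) r(2)] by blast
  have contG: "continuous_on (cball w0 r) G"
    using smooth_on_imp_continuous[OF assms(2)] r(2) by (rule continuous_on_subset)
  then have "bounded (G ` cball w0 r)"
    using compact_cball compact_continuous_image compact_imp_bounded by blast
  then obtain M where M: "M > 0" "\<And>x. x \<in> cball w0 r \<Longrightarrow> norm (G x) \<le> M"
    unfolding bounded_pos by auto
  \<comment> \<open>An iterate moves away from \<open>w0\<close> by at most M (2 \<epsilon>) + M
    \<epsilon> = 3 M \<epsilon>, which has to stay below r. The same count for differences of
    iterates gives the factor 3 L \<epsilon>, and the bound 1 / (4 L) makes it at most 3/4.\<close>
  define \<epsilon> where "\<epsilon> = min (r / (3 * M)) (1 / (4 * L))"
  have e: "\<epsilon> > 0" "3 * M * \<epsilon> \<le> r" "4 * L * \<epsilon> \<le> 1"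
    using r L M by (auto simp: \<epsilon>_def min_def field_simps)
  define c where "c = (\<lambda>t. max (-\<epsilon>) (min \<epsilon> t))"
  have c: "c t \<in> {-\<epsilon>..\<epsilon>}" for t using e by (auto simp: c_def)
  have contc: "continuous_on UNIV c" unfolding c_def by (intro continuous_intros)
  \<comment> \<open>Bounded continuous curves on the line with values in the ball form a closed,
    hence complete, set in the supremum metric, as Banach's fixed point theorem requires.\<close>
  define X where "X = PiC (UNIV :: real set) (\<lambda>_. cball w0 r)"
  \<comment> \<open>Integrating from the left end point gives one primitive for the whole interval;
    J(c t) - J(0) is then the signed integral from 0 for either sign of t.\<close>
  define J where "J = (\<lambda>x t. integral {-\<epsilon>..t} (\<lambda>s. G (apply_bcontfun x s)))"
  define P0 where "P0 = (\<lambda>x t. w0 + (J x (c t) - J x 0))"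
  have contx: "continuous_on T (\<lambda>s. G (apply_bcontfun x s))" if "x \<in> X" for x T
  proof (rule continuous_on_compose2[OF contG])
    show "apply_bcontfun x ` T \<subseteq> cball w0 r" using that by (auto simp: X_def mem_PiC_iff)
  qed simp
  have xin: "apply_bcontfun x s \<in> cball w0 r" if "x \<in> X" for x s
    using that by (auto simp: X_def mem_PiC_iff)
  have Jbound: "norm (J x t) \<le> M * (t + \<epsilon>)" if "x \<in> X" "t \<in> {-\<epsilon>..\<epsilon>}" for x t
    using integral_bound[OF _ contx[OF that(1)], of "-\<epsilon>" t M] that(2) M(2)[OF xin[OF that(1)]]
    by (simp add: J_def)
  have Jdiff: "norm (J x t - J y t) \<le> L * dist x y * (t + \<epsilon>)" if "x \<in> X" "y \<in> X" "t \<in> {-\<epsilon>..\<epsilon>}" for x y t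
  proof -
    have "norm (G (apply_bcontfun x s) - G (apply_bcontfun y s)) \<le> L * dist x y" for s
    proof -
      have "norm (G (apply_bcontfun x s) - G (apply_bcontfun y s)) \<le> L * norm (apply_bcontfun x s - apply_bcontfun y s)"
        using that by (intro L(2) xin)
      also have "\<dots> \<le> L * dist x y"
        using L(1) dist_bounded[of x s y] by (intro mult_left_mono) (auto simp: dist_norm)
      finally show ?thesis .
    qed
    moreover have "J x t - J y t = integral {-\<epsilon>..t} (\<lambda>s. G (apply_bcontfun x s) - G (apply_bcontfun y s))"
      unfolding J_def
      by (intro integral_diff[symmetric] integrable_continuous_real contx that)
    ultimately show ?thesis
      using integral_bound[of "-\<epsilon>" t "\<lambda>s. G (apply_bcontfun x s) - G (apply_bcontfun y s)" "L * dist x y"] that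
      by (simp add: continuous_on_diff contx)
  qed
  have P0_cball: "P0 x t \<in> cball w0 r" if "x \<in> X" for x t
  proof -
    have "norm (J x (c t) - J x 0) \<le> M * (c t + \<epsilon>) + M * (0 + \<epsilon>)"
      using Jbound[OF that c[of t]] Jbound[OF that, of 0] e norm_triangle_ineq4[of "J x (c t)" "J x 0"] by auto
    also have "\<dots> \<le> M * (\<epsilon> + \<epsilon>) + M * (0 + \<epsilon>)"
      using c[of t] M by (intro add_mono mult_left_mono) auto
    also have "\<dots> \<le> r" using e by (simp add: algebra_simps)
    finally show ?thesis by (simp add: P0_def dist_norm norm_minus_commute)
  qed
  have P0_cont: "P0 x \<in> bcontfun" if "x \<in> X" for x
  proof -
    have "continuous_on {-\<epsilon>..\<epsilon>} (J x)"
      unfolding J_def by (intro indefinite_integral_continuous_1 integrable_continuous_real contx that)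
    then have "continuous_on UNIV (\<lambda>t. J x (c t))"
      by (rule continuous_on_compose2[OF _ contc]) (use c in auto)
    then have "continuous_on UNIV (P0 x)" unfolding P0_def by (intro continuous_intros)
    moreover have "bounded (range (P0 x))"
      using P0_cball[OF that] bounded_cball by (meson bounded_subset image_subsetI)
    ultimately show ?thesis by (simp add: bcontfun_def)
  qed
  define P where "P = (\<lambda>x. Bcontfun (P0 x))"
  have P: "apply_bcontfun (P x) = P0 x" if "x \<in> X" for x
    unfolding P_def using P0_cont[OF that] by (rule Bcontfun_inverse)
  have "\<exists>!x\<in>X. P x = x"
  proof (rule Banach_fix)
    show "complete X" unfolding X_def complete_eq_closed by (rule closed_PiC) auto
    have "const_bcontfun w0 \<in> X" using r by (simp add: X_def mem_PiC_iff)
    then show "X \<noteq> {}" by blast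
    show "P ` X \<subseteq> X" using P P0_cball by (auto simp: X_def mem_PiC_iff)
    show "dist (P x) (P y) \<le> 3/4 * dist x y" if "x \<in> X" "y \<in> X" for x y
    proof (rule dist_bound)
      fix t
      have "dist (P x t) (P y t) = norm ((J x (c t) - J y (c t)) - (J x 0 - J y 0))"
        by (simp add: P that P0_def dist_norm algebra_simps)
      also have "\<dots> \<le> L * dist x y * (c t + \<epsilon>) + L * dist x y * (0 + \<epsilon>)"
        using Jdiff[OF that c[of t]] Jdiff[OF that, of 0] e
          norm_triangle_ineq4[of "J x (c t) - J y (c t)" "J x 0 - J y 0"] by auto
      also have "\<dots> \<le> L * dist x y * (\<epsilon> + \<epsilon>) + L * dist x y * (0 + \<epsilon>)"
        using c[of t] L(1) by (intro add_mono mult_left_mono) auto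
      also have "\<dots> = 3/4 * (4 * L * \<epsilon>) * dist x y" by (simp add: algebra_simps)
      also have "\<dots> \<le> 3/4 * 1 * dist x y" using e(3) by (intro mult_right_mono mult_left_mono) auto
      finally show "dist (P x t) (P y t) \<le> 3/4 * dist x y" by simp
    qed
  qed auto
  then obtain x where x: "x \<in> X" "P x = x" by blast
  have x_eq: "apply_bcontfun x t = P0 x t" for t using P[OF x(1)] x(2) by simp
  have "(apply_bcontfun x has_vector_derivative G (apply_bcontfun x t)) (at t)" if "\<bar>t\<bar> < \<epsilon>" for t
  proof -
    have t: "t \<in> {-\<epsilon><..<\<epsilon>}" "t \<in> {-\<epsilon>..\<epsilon>}" using that by auto
    have "(J x has_vector_derivative G (apply_bcontfun x t)) (at t within {-\<epsilon>..\<epsilon>})"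
      unfolding J_def using integral_has_vector_derivative[OF contx[OF x(1)] t(2)] by simp
    then have "(J x has_vector_derivative G (apply_bcontfun x t)) (at t)"
      using t(1) at_within_interior[of t "{-\<epsilon>..\<epsilon>}"] by simp
    then have "((\<lambda>t. w0 + (J x t - J x 0)) has_vector_derivative G (apply_bcontfun x t)) (at t)"
      by (auto intro!: derivative_eq_intros)
    then show ?thesis
      by (rule has_vector_derivative_transform_within_open[OF _ open_greaterThanLessThan t(1)])
         (auto simp: x_eq[abs_def] P0_def c_def)
  qed
  moreover have "apply_bcontfun x 0 = w0" using e by (simp add: x_eq P0_def c_def)
  moreover have "apply_bcontfun x t \<in> S" for t using x(1) r(2) by (auto simp: X_def mem_PiC_iff)
  ultimately show ?thesis using that[of \<epsilon> "apply_bcontfun x"] e(1) by blast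
qed

section \<open>Charts and smooth maps between manifolds\<close>

lemma chart_inv_left: "is_chart c \<Longrightarrow> p \<in> fst c \<Longrightarrow> chart_inv c (snd c p) = p"
  by (simp add: is_chart_def chart_inv_def)

lemma chart_inv_right: "x \<in> snd c ` fst c \<Longrightarrow> snd c (chart_inv c x) = x"
  by (simp add: chart_inv_def f_inv_into_f)

lemma chart_inv_in: "x \<in> snd c ` fst c \<Longrightarrow> chart_inv c x \<in> fst c"
  by (simp add: chart_inv_def inv_into_into)

lemma chart_inv_eqI: "is_chart c \<Longrightarrow> p \<in> fst c \<Longrightarrow> snd c p = x \<Longrightarrow> chart_inv c x = p"
  using chart_inv_left by fastforce

lemma chart_eqI: "is_chart c \<Longrightarrow> p \<in> fst c \<Longrightarrow> p' \<in> fst c \<Longrightarrow> snd c p = snd c p' \<Longrightarrow> p = p'"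
  by (metis chart_inv_left)

lemma open_chart_image: "is_chart c \<Longrightarrow> open (snd c ` fst c)"
  by (simp add: is_chart_def)

lemma open_preimage:
  "open S \<Longrightarrow> smooth_on S f \<Longrightarrow> open T \<Longrightarrow> open {x \<in> S. f x \<in> T}"
  using continuous_open_preimage[OF smooth_on_imp_continuous, of S f T] by (simp add: Int_def vimage_def)

section \<open>Compatible charts and the topology of an atlas\<close>

lemma atlas_chart: "smooth_atlas A \<Longrightarrow> c \<in> A \<Longrightarrow> is_chart c"
  by (simp add: smooth_atlas_def)

lemma atlas_transition:
  assumes "smooth_atlas A" "c \<in> A" "d \<in> A"
  shows "open (snd c ` (fst c \<inter> fst d))" "smooth_on (snd c ` (fst c \<inter> fst d)) (\<lambda>x. snd d (chart_inv c x))"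
  using assms by (auto simp: smooth_atlas_def smooth_transition_def o_def)

lemma pointsI: "c \<in> A \<Longrightarrow> p \<in> fst c \<Longrightarrow> p \<in> points A"
  by (auto simp: points_def)

lemma pointsE: assumes "p \<in> points A" obtains c where "c \<in> A" "p \<in> fst c"
  using assms by (auto simp: points_def)

text \<open>\<open>topology\<close> has the intended open sets once the family is known to be closed
  under intersections and unions; for intersections this rests on the injectivity of charts. It is
  stated for a mere family of charts so that it also applies to \<open>prod_atlas\<close>.\<close>

lemma openin_atlas_topology:
  assumes "\<And>c. c \<in> A \<Longrightarrow> is_chart c"
  shows "openin (atlas_topology A) W \<longleftrightarrow> W \<subseteq> points A \<and> (\<forall>c\<in>A. open (snd c ` (W \<inter> fst c)))"
proof -
  have int: "snd c ` (V \<inter> W \<inter> fst c) = snd c ` (V \<inter> fst c) \<inter> snd c ` (W \<inter> fst c)" if "c \<in> A" for c V W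
  proof -
    have "inj_on (snd c) (fst c)" using assms[OF that] by (simp add: is_chart_def)
    from inj_on_image_Int[OF this, of "V \<inter> fst c" "W \<inter> fst c"] show ?thesis
      by (simp add: Int_ac)
  qed
  have un: "snd c ` (\<Union>\<K> \<inter> fst c) = (\<Union>K\<in>\<K>. snd c ` (K \<inter> fst c))" for c :: "('a, 'b) chart" and \<K>
    by blast
  have "istopology (\<lambda>W. W \<subseteq> points A \<and> (\<forall>c\<in>A. open (snd c ` (W \<inter> fst c))))"
    unfolding istopology_def by (auto simp: int un intro!: open_Int open_UN simp del: Sup_upper)
  then show ?thesis unfolding atlas_topology_def by (simp add: topology_inverse')
qed

lemma openin_atlas:
  "smooth_atlas A \<Longrightarrow> openin (atlas_topology A) W \<longleftrightarrow> W \<subseteq> points A \<and> (\<forall>c\<in>A. open (snd c ` (W \<inter> fst c)))"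
  by (rule openin_atlas_topology[OF atlas_chart])

lemma openin_atlasD:
  "smooth_atlas A \<Longrightarrow> openin (atlas_topology A) W \<Longrightarrow> c \<in> A \<Longrightarrow> open (snd c ` (W \<inter> fst c))"
  by (simp add: openin_atlas)

text \<open>In another chart the set appears as the preimage of N under a transition map.\<close>

lemma openin_chart_inv_image:
  assumes A: "smooth_atlas A" "c \<in> A" and N: "open N" "N \<subseteq> snd c ` fst c"
  shows "openin (atlas_topology A) (chart_inv c ` N)"
  unfolding openin_atlas[OF A(1)]
proof (intro conjI ballI subsetI)
  fix p assume "p \<in> chart_inv c ` N"
  then obtain x where x: "x \<in> N" "p = chart_inv c x" by blast
  have "x \<in> snd c ` fst c" using x(1) N(2) by (rule subsetD[rotated])
  then show "p \<in> points A" unfolding x(2) by (rule pointsI[OF A(2) chart_inv_in])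
next
  fix d assume d: "d \<in> A"
  note cc = atlas_chart[OF A] and dc = atlas_chart[OF A(1) d]
  have "snd d ` (chart_inv c ` N \<inter> fst d) = {x \<in> snd d ` (fst d \<inter> fst c). snd c (chart_inv d x) \<in> N}"
  proof (intro equalityI subsetI)
    fix x assume "x \<in> snd d ` (chart_inv c ` N \<inter> fst d)"
    then obtain y where y: "y \<in> N" "chart_inv c y \<in> fst d" "x = snd d (chart_inv c y)" by auto
    have "y \<in> snd c ` fst c" using y(1) N(2) by blast
    from chart_inv_in[OF this] chart_inv_right[OF this] y
    show "x \<in> {x \<in> snd d ` (fst d \<inter> fst c). snd c (chart_inv d x) \<in> N}"
      by (simp add: chart_inv_left[OF dc])
  next
    fix x assume "x \<in> {x \<in> snd d ` (fst d \<inter> fst c). snd c (chart_inv d x) \<in> N}"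
    then obtain p where p: "p \<in> fst d" "p \<in> fst c" "x = snd d p" "snd c p \<in> N"
      by (auto simp: chart_inv_left[OF dc])
    then have "p = chart_inv c (snd c p)" by (simp add: chart_inv_left[OF cc])
    with p show "x \<in> snd d ` (chart_inv c ` N \<inter> fst d)" by blast
  qed
  also have "open \<dots>" using atlas_transition[OF A(1) d A(2)] N(1) by (intro open_preimage)
  finally show "open (snd d ` (chart_inv c ` N \<inter> fst d))" .
qed

section \<open>Smooth maps between manifolds, read in charts\<close>

lemma smooth_atI:
  assumes "c \<in> A" "d \<in> B" "p \<in> fst c" "open N" "snd c p \<in> N" "N \<subseteq> snd c ` fst c"
    "\<And>x. x \<in> N \<Longrightarrow> F (chart_inv c x) \<in> fst d" "smooth_on N (\<lambda>x. snd d (F (chart_inv c x)))"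
  shows "smooth_at A B F p"
proof -
  have "F ` (chart_inv c ` N) \<subseteq> fst d" using assms(7) by blast
  moreover have "smooth_on N (snd d \<circ> F \<circ> chart_inv c)" using assms(8) by (simp add: o_def)
  ultimately show ?thesis unfolding smooth_at_def using assms(1-6) by blast
qed

lemma smooth_at_chartE:
  assumes "smooth_at A B F p" "smooth_atlas A"
  obtains c d N where "c \<in> A" "d \<in> B" "p \<in> fst c" "F p \<in> fst d" "open N" "snd c p \<in> N" "N \<subseteq> snd c ` fst c"
    "\<And>x. x \<in> N \<Longrightarrow> F (chart_inv c x) \<in> fst d" "smooth_on N (\<lambda>x. snd d (F (chart_inv c x)))"
proof -
  obtain c d N where *: "c \<in> A" "d \<in> B" "p \<in> fst c" "open N" "snd c p \<in> N" "N \<subseteq> snd c ` fst c"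
    "F ` (chart_inv c ` N) \<subseteq> fst d" "smooth_on N (snd d \<circ> F \<circ> chart_inv c)"
    using assms(1) unfolding smooth_at_def by blast
  moreover have "F p \<in> fst d"
    using *(5,7) chart_inv_left[OF atlas_chart[OF assms(2) *(1)] *(3)] by (metis image_eqI subsetD)
  moreover have "F (chart_inv c x) \<in> fst d" if "x \<in> N" for x using *(7) that by blast
  ultimately show ?thesis using that[of c d N] by (simp add: o_def)
qed

lemma smooth_at_points:
  assumes "smooth_at A B F p" "smooth_atlas A"
  shows "p \<in> points A" "F p \<in> points B"
  using smooth_at_chartE[OF assms] pointsI by metis+

text \<open>\<open>smooth_at\<close> provides one pair of charts of its own choosing. Any other pair
  is reached by composing with transitions, on a neighbourhood shrunk so that points stay in the old
  source chart and their images in the new target chart.\<close>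

lemma smooth_atE:
  assumes "smooth_at A B F p" "smooth_atlas A" "smooth_atlas B" "c \<in> A" "d \<in> B" "p \<in> fst c" "F p \<in> fst d"
  obtains N where "open N" "snd c p \<in> N" "N \<subseteq> snd c ` fst c"
    "\<And>x. x \<in> N \<Longrightarrow> F (chart_inv c x) \<in> fst d" "smooth_on N (\<lambda>x. snd d (F (chart_inv c x)))"
proof -
  obtain c' d' N' where *: "c' \<in> A" "d' \<in> B" "p \<in> fst c'" "F p \<in> fst d'" "open N'" "snd c' p \<in> N'"
    "N' \<subseteq> snd c' ` fst c'" and F: "\<And>x. x \<in> N' \<Longrightarrow> F (chart_inv c' x) \<in> fst d'"
    and sF: "smooth_on N' (\<lambda>x. snd d' (F (chart_inv c' x)))"
    using smooth_at_chartE[OF assms(1,2)] by metis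
  note ch = atlas_chart[OF assms(2,4)] atlas_chart[OF assms(2) *(1)]
    atlas_chart[OF assms(3,5)] atlas_chart[OF assms(3) *(2)]
  define D1 where "D1 = snd c ` (fst c \<inter> fst c')"
  define D2 where "D2 = snd d' ` (fst d' \<inter> fst d)"
  define \<tau> where "\<tau> = (\<lambda>x. snd c' (chart_inv c x))"
  define g where "g = (\<lambda>x. snd d' (F (chart_inv c' x)))"
  define N1 where "N1 = {x \<in> D1. \<tau> x \<in> N'}"
  define N2 where "N2 = {x \<in> N1. g (\<tau> x) \<in> D2}"
  have D: "open D1" "open D2" "smooth_on D1 \<tau>" "smooth_on D2 (\<lambda>x. snd d (chart_inv d' x))"
    using atlas_transition[OF assms(2,4) *(1)] atlas_transition[OF assms(3) *(2) assms(5)]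
    by (simp_all add: D1_def D2_def \<tau>_def)
  have N1: "open N1" unfolding N1_def by (rule open_preimage[OF D(1,3) *(5)])
  have \<tau>N1: "smooth_on N1 \<tau>" by (rule smooth_on_subset[OF D(3)]) (auto simp: N1_def)
  have g\<tau>: "smooth_on N1 (\<lambda>x. g (\<tau> x))"
    by (rule smooth_on_compose[OF sF[folded g_def] \<tau>N1 N1]) (auto simp: N1_def)
  have N2: "open N2" unfolding N2_def by (rule open_preimage[OF N1 g\<tau> D(2)])
  have x: "chart_inv c x \<in> fst c" "chart_inv c x \<in> fst c'" "chart_inv c' (\<tau> x) = chart_inv c x"
    if "x \<in> N1" for x
    using that by (auto simp: N1_def D1_def \<tau>_def chart_inv_left[OF ch(1)] chart_inv_left[OF ch(2)])
  have gx: "g (\<tau> x) = snd d' (F (chart_inv c x))" "F (chart_inv c x) \<in> fst d'" if "x \<in> N1" for x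
    using x[OF that] that F[of "\<tau> x"] by (auto simp: g_def N1_def)
  have dx: "F (chart_inv c x) \<in> fst d" if x2: "x \<in> N2" for x
  proof -
    obtain q where q: "q \<in> fst d'" "q \<in> fst d" "g (\<tau> x) = snd d' q"
      using x2 by (auto simp: N2_def D2_def)
    with x2 gx[of x] have "F (chart_inv c x) = q"
      by (intro chart_eqI[OF ch(4)]) (auto simp: N2_def)
    with q show ?thesis by simp
  qed
  have s: "smooth_on N2 (\<lambda>x. snd d (F (chart_inv c x)))"
  proof (rule smooth_on_cong[OF _ N2])
    show "smooth_on N2 (\<lambda>x. snd d (chart_inv d' (g (\<tau> x))))"
      by (rule smooth_on_compose[OF D(4) smooth_on_subset[OF g\<tau>] N2]) (auto simp: N2_def)
    show "snd d (chart_inv d' (g (\<tau> x))) = snd d (F (chart_inv c x))" if "x \<in> N2" for x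
      using that gx[of x] by (simp add: N2_def chart_inv_left[OF ch(4)])
  qed
  have sub: "N2 \<subseteq> snd c ` fst c" by (auto simp: N2_def N1_def D1_def)
  have "snd c p \<in> D1" using assms(6) *(3) by (auto simp: D1_def)
  moreover have "\<tau> (snd c p) = snd c' p" by (simp add: \<tau>_def chart_inv_left[OF ch(1) assms(6)])
  ultimately have "snd c p \<in> N1" using * by (simp add: N1_def)
  moreover have "g (\<tau> (snd c p)) = snd d' (F p)"
    using gx(1)[OF \<open>snd c p \<in> N1\<close>] by (simp add: chart_inv_left[OF ch(1) assms(6)])
  ultimately have "snd c p \<in> N2" using *(4) assms(7) by (auto simp: N2_def D2_def)
  from that[OF N2 this sub dx s] show ?thesis .
qed

lemma smooth_at_mono: "smooth_at A B F p \<Longrightarrow> A \<subseteq> A' \<Longrightarrow> B \<subseteq> B' \<Longrightarrow> smooth_at A' B' F p"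
  unfolding smooth_at_def by (meson subsetD)

lemma smooth_at_cong:
  assumes "smooth_at A B F p" "smooth_atlas A" "openin (atlas_topology A) W" "p \<in> W"
    "\<And>x. x \<in> W \<Longrightarrow> F x = G x"
  shows "smooth_at A B G p"
proof -
  obtain c d N where *: "c \<in> A" "d \<in> B" "p \<in> fst c" "F p \<in> fst d" "open N" "snd c p \<in> N" "N \<subseteq> snd c ` fst c"
    and F: "\<And>x. x \<in> N \<Longrightarrow> F (chart_inv c x) \<in> fst d" and s: "smooth_on N (\<lambda>x. snd d (F (chart_inv c x)))"
    using smooth_at_chartE[OF assms(1,2)] by metis
  define N' where "N' = N \<inter> snd c ` (W \<inter> fst c)"
  have N': "open N'" using *(5) openin_atlasD[OF assms(2,3) *(1)] by (auto simp: N'_def)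
  have eq: "F (chart_inv c x) = G (chart_inv c x)" if "x \<in> N'" for x
    using that assms(5) chart_inv_left[OF atlas_chart[OF assms(2) *(1)]] by (auto simp: N'_def)
  show ?thesis
  proof (rule smooth_atI[OF *(1-3) N'])
    show "snd c p \<in> N'" using * assms(4) by (auto simp: N'_def)
    show "N' \<subseteq> snd c ` fst c" using *(7) by (auto simp: N'_def)
    show "G (chart_inv c x) \<in> fst d" if "x \<in> N'" for x
      using F[of x] eq[OF that] that by (auto simp: N'_def)
    have "smooth_on N' (\<lambda>x. snd d (F (chart_inv c x)))"
      by (rule smooth_on_subset[OF s]) (auto simp: N'_def)
    then show "smooth_on N' (\<lambda>x. snd d (G (chart_inv c x)))"
      by (rule smooth_on_cong[OF _ N']) (simp add: eq)
  qed
qed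

lemma smooth_at_compose:
  assumes "smooth_at A B F p" "smooth_at B C G (F p)" "smooth_atlas A" "smooth_atlas B"
  shows "smooth_at A C (\<lambda>x. G (F x)) p"
proof -
  obtain d e M where *: "d \<in> B" "e \<in> C" "F p \<in> fst d" "open M" "snd d (F p) \<in> M" "M \<subseteq> snd d ` fst d"
    and G: "\<And>x. x \<in> M \<Longrightarrow> G (chart_inv d x) \<in> fst e" "smooth_on M (\<lambda>x. snd e (G (chart_inv d x)))"
    using smooth_at_chartE[OF assms(2,4)] by metis
  obtain c where c: "c \<in> A" "p \<in> fst c" using smooth_at_points(1)[OF assms(1,3)] by (rule pointsE)
  obtain N where N: "open N" "snd c p \<in> N" "N \<subseteq> snd c ` fst c"
    and F: "\<And>x. x \<in> N \<Longrightarrow> F (chart_inv c x) \<in> fst d" "smooth_on N (\<lambda>x. snd d (F (chart_inv c x)))"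
    using smooth_atE[OF assms(1,3,4) c(1) *(1) c(2) *(3)] by metis
  define N' where "N' = {x \<in> N. snd d (F (chart_inv c x)) \<in> M}"
  have N': "open N'" unfolding N'_def by (rule open_preimage[OF N(1) F(2) *(4)])
  have eq: "chart_inv d (snd d (F (chart_inv c x))) = F (chart_inv c x)" if "x \<in> N'" for x
    using that F(1) by (simp add: N'_def chart_inv_left[OF atlas_chart[OF assms(4) *(1)]])
  show ?thesis
  proof (rule smooth_atI[OF c(1) *(2) c(2) N'])
    show "snd c p \<in> N'"
      using N(2) *(5) by (simp add: N'_def chart_inv_left[OF atlas_chart[OF assms(3) c(1)] c(2)])
    show "N' \<subseteq> snd c ` fst c" using N(3) by (auto simp: N'_def)
    show "G (F (chart_inv c x)) \<in> fst e" if "x \<in> N'" for x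
      using G(1)[of "snd d (F (chart_inv c x))"] that by (simp add: eq) (simp add: N'_def)
    have "smooth_on N' (\<lambda>x. snd e (G (chart_inv d (snd d (F (chart_inv c x))))))"
      by (rule smooth_on_compose[OF G(2) smooth_on_subset[OF F(2)] N']) (auto simp: N'_def)
    then show "smooth_on N' (\<lambda>x. snd e (G (F (chart_inv c x))))"
      by (rule smooth_on_cong[OF _ N']) (simp add: eq)
  qed
qed

section \<open>Smooth real functions and smooth curves\<close>

lemma chart_inv_euclidean: "chart_inv (UNIV, id) x = x"
  by (simp add: chart_inv_def)

lemma euclidean_chart: "(UNIV, id) \<in> euclidean_atlas"
  by (simp add: euclidean_atlas_def)

lemma smooth_euclidean_atlas: "smooth_atlas (euclidean_atlas :: ('e::euclidean_space, 'e) atlas)"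
  by (simp add: smooth_atlas_def euclidean_atlas_def is_chart_def smooth_transition_def o_def
      chart_inv_euclidean smooth_on_ident)

lemma smooth_at_realE:
  assumes "smooth_at A euclidean_atlas f p" "smooth_atlas A" "c \<in> A" "p \<in> fst c"
  obtains N where "open N" "snd c p \<in> N" "N \<subseteq> snd c ` fst c" "smooth_on N (\<lambda>x. f (chart_inv c x))"
  using smooth_atE[OF assms(1,2) smooth_euclidean_atlas assms(3) euclidean_chart assms(4)] by auto

lemma smooth_at_realI:
  assumes "c \<in> A" "p \<in> fst c" "open N" "snd c p \<in> N" "N \<subseteq> snd c ` fst c" "smooth_on N (\<lambda>x. f (chart_inv c x))"
  shows "smooth_at A euclidean_atlas f p"
  using assms by (intro smooth_atI[OF assms(1) euclidean_chart assms(2-5)]) auto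

lemma smooth_at_curveE:
  assumes "smooth_at euclidean_atlas A \<gamma> t" "smooth_atlas A" "c \<in> A" "\<gamma> t \<in> fst c"
  obtains N where "open N" "t \<in> N" "\<And>s. s \<in> N \<Longrightarrow> \<gamma> s \<in> fst c" "smooth_on N (\<lambda>s. snd c (\<gamma> s))"
  using smooth_atE[OF assms(1) smooth_euclidean_atlas assms(2) euclidean_chart assms(3) _ assms(4)]
  by (auto simp: chart_inv_euclidean)

lemma smooth_at_curveI:
  assumes "c \<in> A" "open N" "t \<in> N" "\<And>s. s \<in> N \<Longrightarrow> \<gamma> s \<in> fst c" "smooth_on N (\<lambda>s. snd c (\<gamma> s))"
  shows "smooth_at euclidean_atlas A \<gamma> t"
  using assms by (intro smooth_atI[OF euclidean_chart assms(1) _ assms(2)]) (auto simp: chart_inv_euclidean)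

section \<open>Tangent and cotangent bundles in coordinates\<close>

text \<open>The vector h^i \<partial>/\<partial>x^i at p in the chart c. The value 0 on functions
  that are not smooth at p copies the convention of \<open>velocity\<close>, so that the two can be
  equal as functionals.\<close>

definition dvec :: "('a, 'e::euclidean_space) atlas \<Rightarrow> ('a, 'e) chart \<Rightarrow> 'a \<Rightarrow> 'e \<Rightarrow> 'a tvec" where
  "dvec A c p h = (\<lambda>f. if smooth_at A euclidean_atlas f p then fd (\<lambda>x. f (chart_inv c x)) (snd c p) h else 0)"

lemma smooth_at_real_differentiable:
  assumes "smooth_at A euclidean_atlas f p" "smooth_atlas A" "c \<in> A" "p \<in> fst c"
  shows "(\<lambda>x. f (chart_inv c x)) differentiable (at (snd c p))"
  using smooth_at_realE[OF assms] smooth_on_imp_differentiable by metis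

text \<open>Chain rule. Only the derivative of the coordinate curve at the time t enters, so a
  velocity can be computed before the curve is known to be smooth.\<close>

lemma velocity_eq_dvec:
  assumes "smooth_atlas A" "c \<in> A" "open N" "t \<in> N" "\<And>s. s \<in> N \<Longrightarrow> \<gamma> s \<in> fst c"
    "((\<lambda>s. snd c (\<gamma> s)) has_vector_derivative h) (at t)"
  shows "velocity A \<gamma> t = dvec A c (\<gamma> t) h"
proof
  fix f
  show "velocity A \<gamma> t f = dvec A c (\<gamma> t) h f"
  proof (cases "smooth_at A euclidean_atlas f (\<gamma> t)")
    case True
    note d = smooth_at_real_differentiable[OF True assms(1,2) assms(5)[OF assms(4)]]
    have "((\<lambda>s. f (chart_inv c (snd c (\<gamma> s)))) has_derivative
        (\<lambda>k. fd (\<lambda>x. f (chart_inv c x)) (snd c (\<gamma> t)) (k *\<^sub>R h))) (at t)"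
      using has_derivative_compose[OF assms(6)[unfolded has_vector_derivative_def] fd_works[OF d]] .
    then have "((\<lambda>s. f (\<gamma> s)) has_derivative
        (\<lambda>k. fd (\<lambda>x. f (chart_inv c x)) (snd c (\<gamma> t)) (k *\<^sub>R h))) (at t)"
      by (rule has_derivative_transform_within_open[OF _ assms(3,4)])
         (simp add: chart_inv_left[OF atlas_chart[OF assms(1,2)] assms(5)])
    then have "((\<lambda>s. f (\<gamma> s)) has_field_derivative fd (\<lambda>x. f (chart_inv c x)) (snd c (\<gamma> t)) h) (at t)"
      by (rule has_derivative_imp_has_field_derivative) (simp add: linear_cmul[OF linear_fd[OF d]])
    with True show ?thesis by (simp add: velocity_def dvec_def DERIV_imp_deriv)
  qed (simp add: velocity_def dvec_def)
qed

lemma smooth_at_coordinate: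
  assumes "smooth_atlas A" "c \<in> A" "p \<in> fst c" "bounded_linear (l :: 'e::euclidean_space \<Rightarrow> real)"
  shows "smooth_at A euclidean_atlas (\<lambda>x. l (snd c x)) p"
proof (rule smooth_at_realI[OF assms(2,3)])
  show op: "open (snd c ` fst c)" using atlas_chart[OF assms(1,2)] by (rule open_chart_image)
  show "smooth_on (snd c ` fst c) (\<lambda>x. l (snd c (chart_inv c x)))"
    by (rule smooth_on_cong[OF smooth_on_linear[OF assms(4)] op]) (simp add: chart_inv_right)
qed (use assms in auto)

lemma dvec_coordinate:
  assumes "smooth_atlas A" "c \<in> A" "p \<in> fst c" "bounded_linear (l :: 'e::euclidean_space \<Rightarrow> real)"
  shows "dvec A c p h (\<lambda>x. l (snd c x)) = l h"
proof -
  have "((\<lambda>x. l (snd c (chart_inv c x))) has_derivative l) (at (snd c p))"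
    by (rule has_derivative_transform_within_open[OF bounded_linear_imp_has_derivative[OF assms(4)]
          open_chart_image[OF atlas_chart[OF assms(1,2)]]])
       (use assms(3) in \<open>auto simp: chart_inv_right\<close>)
  then show ?thesis
    using smooth_at_coordinate[OF assms] by (simp add: dvec_def fd_eq)
qed

lemma tvec_coords_dvec:
  assumes "smooth_atlas A" "c \<in> A" "p \<in> fst c"
  shows "tvec_coords c (dvec A c p h) = h"
  unfolding tvec_coords_def
  by (simp add: dvec_coordinate[OF assms bounded_linear_inner_left] euclidean_representation)

lemma dvec_inject:
  assumes "smooth_atlas A" "c \<in> A" "p \<in> fst c"
  shows "dvec A c p h = dvec A c p k \<longleftrightarrow> h = k"
  using tvec_coords_dvec[OF assms] by metis

lemma dvec_straight_curve:
  assumes "smooth_atlas A" "c \<in> A" "p \<in> fst c"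
  shows "smooth_at euclidean_atlas A (\<lambda>t. chart_inv c (snd c p + t *\<^sub>R h)) 0"
    and "velocity A (\<lambda>t. chart_inv c (snd c p + t *\<^sub>R h)) 0 = dvec A c p h"
proof -
  note ch = atlas_chart[OF assms(1,2)]
  let ?N = "(\<lambda>t. snd c p + t *\<^sub>R h) -` (snd c ` fst c)"
  have N: "open ?N" "0 \<in> ?N"
    using assms(3) by (auto intro!: open_vimage open_chart_image[OF ch] continuous_intros)
  have in_chart: "chart_inv c (snd c p + t *\<^sub>R h) \<in> fst c" if "t \<in> ?N" for t
    by (rule chart_inv_in) (use that in simp)
  have sm: "smooth_on ?N (\<lambda>t. snd c p + t *\<^sub>R h)"
    by (intro smooth_on_add smooth_on_scaleR smooth_on_const smooth_on_ident N)
  show "smooth_at euclidean_atlas A (\<lambda>t. chart_inv c (snd c p + t *\<^sub>R h)) 0"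
    by (rule smooth_at_curveI[OF assms(2) N in_chart smooth_on_cong[OF sm N(1)]]) (simp_all add: chart_inv_right)
  have "((\<lambda>t. snd c p + t *\<^sub>R h) has_vector_derivative h) (at 0)"
    by (auto intro!: derivative_eq_intros)
  then have "((\<lambda>t. snd c (chart_inv c (snd c p + t *\<^sub>R h))) has_vector_derivative h) (at 0)"
    by (rule has_vector_derivative_transform_within_open[OF _ N]) (simp add: chart_inv_right)
  from velocity_eq_dvec[OF assms(1,2) N in_chart this]
  show "velocity A (\<lambda>t. chart_inv c (snd c p + t *\<^sub>R h)) 0 = dvec A c p h"
    by (simp add: chart_inv_left[OF ch assms(3)])
qed

lemma coord_vector_eq:
  assumes "smooth_atlas A" "c \<in> A" "p \<in> fst c"
  shows "coord_vector A c p h = dvec A c p h"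
  unfolding coord_vector_def by (rule dvec_straight_curve(2)[OF assms])

text \<open>A smooth curve contributes the derivative of its coordinates; conversely every h is
  realised by a straight line in the chart.\<close>

lemma tangent_space_eq:
  assumes "smooth_atlas A" "c \<in> A" "p \<in> fst c"
  shows "tangent_space A p = range (dvec A c p)"
proof (intro equalityI subsetI)
  fix u assume "u \<in> tangent_space A p"
  then obtain \<gamma> where \<gamma>: "u = velocity A \<gamma> 0" "smooth_at euclidean_atlas A \<gamma> 0" "\<gamma> 0 = p"
    unfolding tangent_space_def by blast
  obtain N where N: "open N" "0 \<in> N" "\<And>s. s \<in> N \<Longrightarrow> \<gamma> s \<in> fst c" "smooth_on N (\<lambda>s. snd c (\<gamma> s))"
    using smooth_at_curveE[OF \<gamma>(2) assms(1,2)] assms(3) \<gamma>(3) by metis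
  have "((\<lambda>s. snd c (\<gamma> s)) has_vector_derivative vector_derivative (\<lambda>s. snd c (\<gamma> s)) (at 0)) (at 0)"
    using smooth_on_imp_differentiable[OF N(4,2)] by (simp add: vector_derivative_works)
  from velocity_eq_dvec[OF assms(1,2) N(1-3) this] show "u \<in> range (dvec A c p)"
    unfolding \<gamma>(1) \<gamma>(3) by simp
next
  fix u assume "u \<in> range (dvec A c p)"
  then obtain h where "u = dvec A c p h" by blast
  with dvec_straight_curve[OF assms, of h] show "u \<in> tangent_space A p"
    unfolding tangent_space_def
    by (intro CollectI exI[of _ "\<lambda>t. chart_inv c (snd c p + t *\<^sub>R h)"])
       (simp add: chart_inv_left[OF atlas_chart[OF assms(1,2)] assms(3)])
qed

lemma dvec_in_tangent_space:
  assumes "smooth_atlas A" "c \<in> A" "p \<in> fst c"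
  shows "dvec A c p h \<in> tangent_space A p"
  by (simp add: tangent_space_eq[OF assms])

lemma dvec_sum:
  assumes "smooth_atlas A" "c \<in> A" "p \<in> fst c"
  shows "dvec A c p (\<Sum>i\<in>I. y i *\<^sub>R h i) = (\<lambda>f. \<Sum>i\<in>I. y i * dvec A c p (h i) f)"
proof
  fix f
  show "dvec A c p (\<Sum>i\<in>I. y i *\<^sub>R h i) f = (\<Sum>i\<in>I. y i * dvec A c p (h i) f)"
  proof (cases "smooth_at A euclidean_atlas f p")
    case True
    note l = linear_fd[OF smooth_at_real_differentiable[OF True assms]]
    show ?thesis using True by (simp add: dvec_def linear_sum[OF l] linear_cmul[OF l])
  qed (simp add: dvec_def)
qed

lemma dvec_lincomb:
  assumes "smooth_atlas A" "c \<in> A" "p \<in> fst c"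
  shows "dvec A c p (a *\<^sub>R h + b *\<^sub>R k) = (\<lambda>f. a * dvec A c p h f + b * dvec A c p k f)"
proof
  fix f
  show "dvec A c p (a *\<^sub>R h + b *\<^sub>R k) f = a * dvec A c p h f + b * dvec A c p k f"
  proof (cases "smooth_at A euclidean_atlas f p")
    case True
    note l = linear_fd[OF smooth_at_real_differentiable[OF True assms]]
    show ?thesis using True by (simp add: dvec_def linear_add[OF l] linear_cmul[OF l])
  qed (simp add: dvec_def)
qed

lemma pushforward_dvec:
  assumes "smooth_atlas A" "smooth_atlas B" "smooth_at A B F p" "c \<in> A" "p \<in> fst c" "d \<in> B" "F p \<in> fst d"
  shows "pushforward A B F p (dvec A c p h) =
    dvec B d (F p) (fd (\<lambda>x. snd d (F (chart_inv c x))) (snd c p) h)"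
proof
  fix f
  show "pushforward A B F p (dvec A c p h) f =
    dvec B d (F p) (fd (\<lambda>x. snd d (F (chart_inv c x))) (snd c p) h) f"
  proof (cases "smooth_at B euclidean_atlas f (F p)")
    case True
    obtain N where N: "open N" "snd c p \<in> N" "N \<subseteq> snd c ` fst c"
      "\<And>x. x \<in> N \<Longrightarrow> F (chart_inv c x) \<in> fst d" "smooth_on N (\<lambda>x. snd d (F (chart_inv c x)))"
      using smooth_atE[OF assms(3,1,2,4,6,5,7)] by metis
    have pp: "chart_inv c (snd c p) = p" by (rule chart_inv_left[OF atlas_chart[OF assms(1,4)] assms(5)])
    have "((\<lambda>x. f (chart_inv d (snd d (F (chart_inv c x))))) has_derivative
       (\<lambda>h. fd (\<lambda>y. f (chart_inv d y)) (snd d (F p)) (fd (\<lambda>x. snd d (F (chart_inv c x))) (snd c p) h))) (at (snd c p))"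
      using has_derivative_compose[OF smooth_on_has_derivative[OF N(5,2)],
          of "\<lambda>y. f (chart_inv d y)" "fd (\<lambda>y. f (chart_inv d y)) (snd d (F p))"]
        fd_works[OF smooth_at_real_differentiable[OF True assms(2,6,7)]]
      by (simp add: pp)
    then have "((\<lambda>x. f (F (chart_inv c x))) has_derivative
       (\<lambda>h. fd (\<lambda>y. f (chart_inv d y)) (snd d (F p)) (fd (\<lambda>x. snd d (F (chart_inv c x))) (snd c p) h))) (at (snd c p))"
      by (rule has_derivative_transform_within_open[OF _ N(1,2)])
         (simp add: chart_inv_left[OF atlas_chart[OF assms(2,6)] N(4)])
    moreover have "smooth_at A euclidean_atlas (\<lambda>x. f (F x)) p"
      by (rule smooth_at_compose[OF assms(3) True assms(1,2)])
    ultimately show ?thesis using True by (simp add: pushforward_def dvec_def o_def fd_eq)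
  qed (simp add: pushforward_def dvec_def)
qed

lemma dvec_change:
  assumes "smooth_atlas A" "c \<in> A" "d \<in> A" "p \<in> fst c" "p \<in> fst d"
  shows "dvec A c p h = dvec A d p (fd (\<lambda>x. snd d (chart_inv c x)) (snd c p) h)"
proof
  fix f
  show "dvec A c p h f = dvec A d p (fd (\<lambda>x. snd d (chart_inv c x)) (snd c p) h) f"
  proof (cases "smooth_at A euclidean_atlas f p")
    case True
    let ?D = "snd c ` (fst c \<inter> fst d)"
    note ch = atlas_chart[OF assms(1,2)] atlas_chart[OF assms(1,3)]
    have x: "snd c p \<in> ?D" "chart_inv c (snd c p) = p" using assms chart_inv_left[OF ch(1)] by auto
    have "((\<lambda>x. f (chart_inv d (snd d (chart_inv c x)))) has_derivative
       (\<lambda>h. fd (\<lambda>y. f (chart_inv d y)) (snd d p) (fd (\<lambda>x. snd d (chart_inv c x)) (snd c p) h))) (at (snd c p))"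
      using has_derivative_compose[OF smooth_on_has_derivative[OF atlas_transition(2)[OF assms(1-3)] x(1)],
          of "\<lambda>y. f (chart_inv d y)" "fd (\<lambda>y. f (chart_inv d y)) (snd d p)"]
        fd_works[OF smooth_at_real_differentiable[OF True assms(1,3,5)]]
      by (simp add: x)
    then have "((\<lambda>x. f (chart_inv c x)) has_derivative
       (\<lambda>h. fd (\<lambda>y. f (chart_inv d y)) (snd d p) (fd (\<lambda>x. snd d (chart_inv c x)) (snd c p) h))) (at (snd c p))"
      by (rule has_derivative_transform_within_open[OF _ atlas_transition(1)[OF assms(1-3)] x(1)])
         (auto simp: chart_inv_left[OF ch(1)] chart_inv_left[OF ch(2)])
    with True show ?thesis by (simp add: dvec_def fd_eq)
  qed (simp add: dvec_def)
qed

lemma tvec_coords_change: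
  assumes "smooth_atlas A" "c \<in> A" "d \<in> A" "p \<in> fst c" "p \<in> fst d"
  shows "tvec_coords d (dvec A c p h) = fd (\<lambda>x. snd d (chart_inv c x)) (snd c p) h"
  unfolding dvec_change[OF assms] by (rule tvec_coords_dvec[OF assms(1,3,5)])

section \<open>The smooth structure of the tangent bundle\<close>

lemma fst_tangent_chart: "fst (tangent_chart A c) = {(p, u). p \<in> fst c \<and> u \<in> tangent_space A p}"
  and snd_tangent_chart: "snd (tangent_chart A c) (p, u) = (snd c p, tvec_coords c u)"
  by (simp_all add: tangent_chart_def)

lemma mem_tangent_chart:
  assumes "smooth_atlas A" "c \<in> A"
  shows "v \<in> fst (tangent_chart A c) \<longleftrightarrow> (\<exists>p\<in>fst c. \<exists>h. v = (p, dvec A c p h))"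
  using tangent_space_eq[OF assms] by (cases v) (auto simp: fst_tangent_chart)

lemma tangent_chart_dvec:
  assumes "smooth_atlas A" "c \<in> A" "p \<in> fst c"
  shows "(p, dvec A c p h) \<in> fst (tangent_chart A c)"
    and "snd (tangent_chart A c) (p, dvec A c p h) = (snd c p, h)"
  using assms by (auto simp: fst_tangent_chart snd_tangent_chart tvec_coords_dvec dvec_in_tangent_space)

lemma tangent_chart_image:
  assumes "smooth_atlas A" "c \<in> A"
  shows "snd (tangent_chart A c) ` fst (tangent_chart A c) = (snd c ` fst c) \<times> UNIV"
proof (intro equalityI subsetI)
  fix z assume "z \<in> (snd c ` fst c) \<times> (UNIV :: 'b set)"
  then obtain p h where "p \<in> fst c" "z = (snd c p, h)" by auto
  with tangent_chart_dvec[OF assms] show "z \<in> snd (tangent_chart A c) ` fst (tangent_chart A c)"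
    by (metis image_eqI)
qed (auto simp: fst_tangent_chart snd_tangent_chart)

lemma is_chart_tangent:
  assumes "smooth_atlas A" "c \<in> A"
  shows "is_chart (tangent_chart A c)"
  unfolding is_chart_def
proof
  show "open (snd (tangent_chart A c) ` fst (tangent_chart A c))"
    unfolding tangent_chart_image[OF assms]
    by (intro open_Times open_chart_image[OF atlas_chart[OF assms]] open_UNIV)
  show "inj_on (snd (tangent_chart A c)) (fst (tangent_chart A c))"
  proof (rule inj_onI)
    fix v w assume *: "v \<in> fst (tangent_chart A c)" "w \<in> fst (tangent_chart A c)"
      "snd (tangent_chart A c) v = snd (tangent_chart A c) w"
    then obtain p h q k where "p \<in> fst c" "q \<in> fst c" "v = (p, dvec A c p h)" "w = (q, dvec A c q k)"
      unfolding mem_tangent_chart[OF assms] by blast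
    with *(3) show "v = w"
      using chart_eqI[OF atlas_chart[OF assms]] by (auto simp: tangent_chart_dvec(2)[OF assms])
  qed
qed

lemma tangent_chart_inv:
  assumes "smooth_atlas A" "c \<in> A" "x \<in> snd c ` fst c"
  shows "chart_inv (tangent_chart A c) (x, h) = (chart_inv c x, dvec A c (chart_inv c x) h)"
  by (rule chart_inv_eqI[OF is_chart_tangent[OF assms(1,2)]])
     (simp_all add: tangent_chart_dvec[OF assms(1,2) chart_inv_in[OF assms(3)]] chart_inv_right[OF assms(3)])

text \<open>Over a transition \<phi> of the base the tangent charts change by (x, h) -> (\<phi>(x),
  d\<phi>(x) h), for all h.\<close>

lemma smooth_tangent_atlas:
  assumes "smooth_atlas A"
  shows "smooth_atlas (tangent_atlas A)"
  unfolding smooth_atlas_def tangent_atlas_def ball_simps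
proof (intro conjI ballI)
  show "is_chart (tangent_chart A c)" if "c \<in> A" for c by (rule is_chart_tangent[OF assms that])
next
  fix c d assume cd: "c \<in> A" "d \<in> A"
  let ?D = "snd c ` (fst c \<inter> fst d)"
  let ?\<phi> = "\<lambda>x. snd d (chart_inv c x)"
  note tr = atlas_transition[OF assms cd]
  have op: "open (?D \<times> (UNIV :: 'b set))" using tr(1) by (intro open_Times open_UNIV)
  have dom: "snd (tangent_chart A c) ` (fst (tangent_chart A c) \<inter> fst (tangent_chart A d)) = ?D \<times> UNIV"
  proof (intro equalityI subsetI)
    fix z assume "z \<in> ?D \<times> (UNIV :: 'b set)"
    then obtain p h where p: "p \<in> fst c" "p \<in> fst d" "z = (snd c p, h)" by auto
    then have "(p, dvec A c p h) \<in> fst (tangent_chart A c) \<inter> fst (tangent_chart A d)"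
      using dvec_in_tangent_space[OF assms cd(1)] by (simp add: fst_tangent_chart)
    with p tangent_chart_dvec(2)[OF assms cd(1) p(1)]
    show "z \<in> snd (tangent_chart A c) ` (fst (tangent_chart A c) \<inter> fst (tangent_chart A d))"
      by (metis image_eqI)
  qed (auto simp: fst_tangent_chart snd_tangent_chart)
  have "smooth_on (?D \<times> UNIV) (\<lambda>z. (?\<phi> (fst z), fd ?\<phi> (fst z) (snd z)))"
    by (intro smooth_on_Pair smooth_on_fd[OF op tr(1)] op tr(2) smooth_on_compose[OF tr(2) _ op]
        smooth_on_fst[OF op] smooth_on_snd[OF op] smooth_on_ident) auto
  then have "smooth_on (?D \<times> UNIV) (snd (tangent_chart A d) \<circ> chart_inv (tangent_chart A c))"
  proof (rule smooth_on_cong[OF _ op])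
    fix z assume "z \<in> ?D \<times> (UNIV :: 'b set)"
    then obtain p h where p: "p \<in> fst c" "p \<in> fst d" "z = (snd c p, h)" by auto
    then show "(?\<phi> (fst z), fd ?\<phi> (fst z) (snd z)) = (snd (tangent_chart A d) \<circ> chart_inv (tangent_chart A c)) z"
      by (simp add: tangent_chart_inv[OF assms cd(1)] chart_inv_left[OF atlas_chart[OF assms cd(1)]]
          snd_tangent_chart tvec_coords_change[OF assms cd])
  qed
  with op show "smooth_transition (tangent_chart A c) (tangent_chart A d)"
    unfolding smooth_transition_def dom by simp
qed

lemma tangent_chart_in: "c \<in> A \<Longrightarrow> tangent_chart A c \<in> tangent_atlas A"
  by (simp add: tangent_atlas_def)

text \<open>The covector with components \<eta> in the basis dual to the coordinate vectors. It
  vanishes off the tangent space because \<open>cotangent_space\<close> demands this of its members;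
  only so do the components determine it.\<close>

definition covec :: "('a, 'e::euclidean_space) atlas \<Rightarrow> ('a, 'e) chart \<Rightarrow> 'a \<Rightarrow> 'e \<Rightarrow> 'a tvec \<Rightarrow> real" where
  "covec A c p \<eta> = (\<lambda>u. if u \<in> tangent_space A p then \<eta> \<bullet> tvec_coords c u else 0)"

lemma covec_dvec:
  assumes "smooth_atlas A" "c \<in> A" "p \<in> fst c"
  shows "covec A c p \<eta> (dvec A c p h) = \<eta> \<bullet> h"
  by (simp add: covec_def dvec_in_tangent_space[OF assms] tvec_coords_dvec[OF assms])

lemma cotangent_space_linear:
  assumes "smooth_atlas A" "c \<in> A" "p \<in> fst c" "\<alpha> \<in> cotangent_space A p"
  shows "linear (\<lambda>h. \<alpha> (dvec A c p h))"
proof -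
  have *: "\<alpha> (dvec A c p (a *\<^sub>R h + b *\<^sub>R k)) = a * \<alpha> (dvec A c p h) + b * \<alpha> (dvec A c p k)" for a b h k
    unfolding dvec_lincomb[OF assms(1-3)]
    using assms(4) dvec_in_tangent_space[OF assms(1-3)] by (simp add: cotangent_space_def)
  show ?thesis
    by (rule linearI) (use *[of 1 _ 1] *[of _ _ 0] in simp_all)
qed

lemma covec_in_cotangent_space:
  assumes "smooth_atlas A" "c \<in> A" "p \<in> fst c"
  shows "covec A c p \<eta> \<in> cotangent_space A p"
proof -
  have "covec A c p \<eta> (\<lambda>f. a * u f + b * w f) = a * covec A c p \<eta> u + b * covec A c p \<eta> w"
    if uw: "u \<in> tangent_space A p" "w \<in> tangent_space A p" for u w a b
  proof -
    obtain h k where hk: "u = dvec A c p h" "w = dvec A c p k"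
      using uw unfolding tangent_space_eq[OF assms] by blast
    show ?thesis
      unfolding hk dvec_lincomb[OF assms, symmetric] covec_dvec[OF assms] by (simp add: inner_add_right)
  qed
  then show ?thesis unfolding cotangent_space_def by (simp add: covec_def)
qed

lemma cotangent_eq_covec:
  assumes "smooth_atlas A" "c \<in> A" "p \<in> fst c" "\<alpha> \<in> cotangent_space A p"
  shows "\<alpha> = covec A c p (\<Sum>b\<in>Basis. \<alpha> (coord_vector A c p b) *\<^sub>R b)"
proof
  fix u
  show "\<alpha> u = covec A c p (\<Sum>b\<in>Basis. \<alpha> (coord_vector A c p b) *\<^sub>R b) u"
  proof (cases "u \<in> tangent_space A p")
    case True
    then obtain h where u: "u = dvec A c p h" unfolding tangent_space_eq[OF assms(1-3)] by blast
    note l = cotangent_space_linear[OF assms]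
    have "\<alpha> (dvec A c p h) = \<alpha> (dvec A c p (\<Sum>b\<in>Basis. (h \<bullet> b) *\<^sub>R b))"
      by (simp add: euclidean_representation)
    also have "\<dots> = (\<Sum>b\<in>Basis. (h \<bullet> b) * \<alpha> (dvec A c p b))"
      using linear_sum[OF l, of "\<lambda>b. (h \<bullet> b) *\<^sub>R b"] linear_cmul[OF l] by simp
    also have "\<dots> = (\<Sum>b\<in>Basis. \<alpha> (dvec A c p b) *\<^sub>R b) \<bullet> h"
      by (simp add: inner_sum_left inner_commute[of h] mult.commute)
    finally show ?thesis
      unfolding u covec_dvec[OF assms(1-3)] by (simp add: coord_vector_eq[OF assms(1-3)])
  next
    case False
    then show ?thesis using assms(4) by (simp add: covec_def cotangent_space_def)
  qed
qed

lemma covec_coords: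
  assumes "smooth_atlas A" "c \<in> A" "p \<in> fst c"
  shows "(\<Sum>b\<in>Basis. covec A c p \<eta> (coord_vector A c p b) *\<^sub>R b) = \<eta>"
  by (simp add: coord_vector_eq[OF assms] covec_dvec[OF assms] euclidean_representation)

section \<open>The smooth structure of the cotangent bundle\<close>

lemma fst_cotangent_chart: "fst (cotangent_chart A c) = {(p, \<alpha>). p \<in> fst c \<and> \<alpha> \<in> cotangent_space A p}"
  and snd_cotangent_chart:
    "snd (cotangent_chart A c) (p, \<alpha>) = (snd c p, \<Sum>b\<in>Basis. \<alpha> (coord_vector A c p b) *\<^sub>R b)"
  by (simp_all add: cotangent_chart_def)

lemma cotangent_chart_covec:
  assumes "smooth_atlas A" "c \<in> A" "p \<in> fst c"
  shows "(p, covec A c p \<eta>) \<in> fst (cotangent_chart A c)"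
    and "snd (cotangent_chart A c) (p, covec A c p \<eta>) = (snd c p, \<eta>)"
  using assms by (simp_all add: fst_cotangent_chart snd_cotangent_chart covec_in_cotangent_space covec_coords)

lemma mem_cotangent_chart:
  assumes "smooth_atlas A" "c \<in> A"
  shows "a \<in> fst (cotangent_chart A c) \<longleftrightarrow> (\<exists>p\<in>fst c. \<exists>\<eta>. a = (p, covec A c p \<eta>))"
proof
  assume "a \<in> fst (cotangent_chart A c)"
  then obtain p \<alpha> where "a = (p, \<alpha>)" "p \<in> fst c" "\<alpha> \<in> cotangent_space A p"
    by (auto simp: fst_cotangent_chart)
  with cotangent_eq_covec[OF assms] show "\<exists>p\<in>fst c. \<exists>\<eta>. a = (p, covec A c p \<eta>)" by blast
qed (use cotangent_chart_covec(1)[OF assms] in auto)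

lemma cotangent_chart_image:
  assumes "smooth_atlas A" "c \<in> A"
  shows "snd (cotangent_chart A c) ` fst (cotangent_chart A c) = (snd c ` fst c) \<times> UNIV"
proof (intro equalityI subsetI)
  fix z assume "z \<in> (snd c ` fst c) \<times> (UNIV :: 'b set)"
  then obtain p h where "p \<in> fst c" "z = (snd c p, h)" by auto
  with cotangent_chart_covec[OF assms] show "z \<in> snd (cotangent_chart A c) ` fst (cotangent_chart A c)"
    by (metis image_eqI)
qed (auto simp: fst_cotangent_chart snd_cotangent_chart)

lemma is_chart_cotangent:
  assumes "smooth_atlas A" "c \<in> A"
  shows "is_chart (cotangent_chart A c)"
  unfolding is_chart_def
proof
  show "open (snd (cotangent_chart A c) ` fst (cotangent_chart A c))"
    unfolding cotangent_chart_image[OF assms]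
    by (intro open_Times open_chart_image[OF atlas_chart[OF assms]] open_UNIV)
  show "inj_on (snd (cotangent_chart A c)) (fst (cotangent_chart A c))"
  proof (rule inj_onI)
    fix v w assume *: "v \<in> fst (cotangent_chart A c)" "w \<in> fst (cotangent_chart A c)"
      "snd (cotangent_chart A c) v = snd (cotangent_chart A c) w"
    then obtain p h q k where "p \<in> fst c" "q \<in> fst c" "v = (p, covec A c p h)" "w = (q, covec A c q k)"
      unfolding mem_cotangent_chart[OF assms] by blast
    with *(3) show "v = w"
      using chart_eqI[OF atlas_chart[OF assms]] by (auto simp: cotangent_chart_covec(2)[OF assms])
  qed
qed

lemma cotangent_chart_inv:
  assumes "smooth_atlas A" "c \<in> A" "x \<in> snd c ` fst c"
  shows "chart_inv (cotangent_chart A c) (x, \<eta>) = (chart_inv c x, covec A c (chart_inv c x) \<eta>)"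
  by (rule chart_inv_eqI[OF is_chart_cotangent[OF assms(1,2)]])
     (simp_all add: cotangent_chart_covec[OF assms(1,2) chart_inv_in[OF assms(3)]] chart_inv_right[OF assms(3)])

lemma cotangent_chart_in: "c \<in> A \<Longrightarrow> cotangent_chart A c \<in> cotangent_atlas A"
  by (simp add: cotangent_atlas_def)

lemma cotangent_atlasE: assumes "K \<in> cotangent_atlas A" obtains c where "c \<in> A" "K = cotangent_chart A c"
  using assms by (auto simp: cotangent_atlas_def)

text \<open>Components change by the transpose of the derivative of the inverse transition \<psi>.
  Using \<psi> itself, evaluated at \<phi>(x), makes this visibly smooth without inverting a
  Jacobian.\<close>

lemma smooth_cotangent_atlas:
  assumes "smooth_atlas A"
  shows "smooth_atlas (cotangent_atlas A)"
  unfolding smooth_atlas_def cotangent_atlas_def ball_simps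
proof (intro conjI ballI)
  show "is_chart (cotangent_chart A c)" if "c \<in> A" for c by (rule is_chart_cotangent[OF assms that])
next
  fix c d assume cd: "c \<in> A" "d \<in> A"
  let ?D = "snd c ` (fst c \<inter> fst d)" and ?D' = "snd d ` (fst d \<inter> fst c)"
  let ?\<phi> = "\<lambda>x. snd d (chart_inv c x)" and ?\<psi> = "\<lambda>x. snd c (chart_inv d x)"
  note tr = atlas_transition[OF assms cd] and tr' = atlas_transition[OF assms cd(2,1)]
  have op: "open (?D \<times> (UNIV :: 'b set))" using tr(1) by (intro open_Times open_UNIV)
  have dom: "snd (cotangent_chart A c) ` (fst (cotangent_chart A c) \<inter> fst (cotangent_chart A d)) = ?D \<times> UNIV"
  proof (intro equalityI subsetI)
    fix z assume "z \<in> ?D \<times> (UNIV :: 'b set)"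
    then obtain p h where p: "p \<in> fst c" "p \<in> fst d" "z = (snd c p, h)" by auto
    then have "(p, covec A c p h) \<in> fst (cotangent_chart A c) \<inter> fst (cotangent_chart A d)"
      using covec_in_cotangent_space[OF assms cd(1)] by (simp add: fst_cotangent_chart)
    with p cotangent_chart_covec(2)[OF assms cd(1) p(1)]
    show "z \<in> snd (cotangent_chart A c) ` (fst (cotangent_chart A c) \<inter> fst (cotangent_chart A d))"
      by (metis image_eqI)
  qed (auto simp: fst_cotangent_chart snd_cotangent_chart)
  have \<phi>: "smooth_on (?D \<times> (UNIV :: 'b set)) (\<lambda>z. ?\<phi> (fst z))"
    by (rule smooth_on_compose[OF tr(2) smooth_on_fst[OF op smooth_on_ident] op]) auto
  have \<phi>D: "?\<phi> (fst z) \<in> ?D'" if "z \<in> ?D \<times> (UNIV :: 'b set)" for z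
    using that by (auto simp: chart_inv_left[OF atlas_chart[OF assms cd(1)]])
  have "smooth_on (?D \<times> (UNIV :: 'b set)) (\<lambda>z. fd ?\<psi> (?\<phi> (fst z)) b)" for b
    by (rule smooth_on_compose[OF smooth_on_fd_dir[OF tr'(2)] \<phi> op]) (use \<phi>D in blast)
  then have "smooth_on (?D \<times> UNIV) (\<lambda>z. (?\<phi> (fst z), \<Sum>b\<in>Basis. (snd z \<bullet> fd ?\<psi> (?\<phi> (fst z)) b) *\<^sub>R b))"
    by (intro smooth_on_Pair \<phi> op smooth_on_sum smooth_on_scaleR smooth_on_inner smooth_on_const
        smooth_on_snd[OF op smooth_on_ident])
  then have "smooth_on (?D \<times> UNIV) (snd (cotangent_chart A d) \<circ> chart_inv (cotangent_chart A c))"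
  proof (rule smooth_on_cong[OF _ op])
    fix z assume "z \<in> ?D \<times> (UNIV :: 'b set)"
    then obtain p \<eta> where p: "p \<in> fst c" "p \<in> fst d" "z = (snd c p, \<eta>)" by auto
    have "covec A c p \<eta> (dvec A d p b) = \<eta> \<bullet> fd ?\<psi> (snd d p) b" for b
      by (simp add: covec_def dvec_in_tangent_space[OF assms cd(2) p(2)]
          tvec_coords_change[OF assms cd(2,1) p(2,1)])
    then show "(?\<phi> (fst z), \<Sum>b\<in>Basis. (snd z \<bullet> fd ?\<psi> (?\<phi> (fst z)) b) *\<^sub>R b) =
        (snd (cotangent_chart A d) \<circ> chart_inv (cotangent_chart A c)) z"
      using p by (simp add: cotangent_chart_inv[OF assms cd(1)] chart_inv_left[OF atlas_chart[OF assms cd(1)]]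
          snd_cotangent_chart coord_vector_eq[OF assms cd(2)])
  qed
  with op show "smooth_transition (cotangent_chart A c) (cotangent_chart A d)"
    unfolding smooth_transition_def dom by simp
qed

section \<open>The canonical symplectic form and Hamiltonian flows\<close>

lemma fd_inner:
  assumes "f differentiable (at x)" "g differentiable (at x)"
  shows "fd (\<lambda>y. f y \<bullet> g y) x h = f x \<bullet> fd g x h + fd f x h \<bullet> g x"
  using fd_eq[OF has_derivative_inner[OF fd_works[OF assms(1)] fd_works[OF assms(2)]]] by simp

lemma fd_fst: "f differentiable (at x) \<Longrightarrow> fd (\<lambda>y. fst (f y)) x h = fst (fd f x h)"
  by (rule fd_linear_compose[OF bounded_linear_fst])

lemma fd_snd: "f differentiable (at x) \<Longrightarrow> fd (\<lambda>y. snd (f y)) x h = snd (fd f x h)"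
  by (rule fd_linear_compose[OF bounded_linear_snd])

lemma fd_cong_open:
  assumes "open N" "x \<in> N" "\<And>y. y \<in> N \<Longrightarrow> f y = g y" "g differentiable (at x)"
  shows "fd f x = fd g x"
  by (rule frechet_derivative_transform_within_open[OF assms(4,1,2), symmetric]) (simp add: assms(3))

lemma fd_linear_eq: "bounded_linear l \<Longrightarrow> fd l x h = l h"
  by (simp add: fd_eq[OF bounded_linear_imp_has_derivative])

lemma fd_comp:
  assumes "f differentiable (at x)" "g differentiable (at (f x))"
  shows "fd (\<lambda>y. g (f y)) x h = fd g (f x) (fd f x h)"
  using fd_eq[OF has_derivative_compose[OF fd_works[OF assms(1)] fd_works[OF assms(2)]]] by simp

text \<open>Differentiating the invariance \<open>\<tau>\<^sup>*(p dq) = p dq\<close> of the Liouville form and antisymmetrising.\<close>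

lemma symplectic_of_liouville:
  fixes \<tau> :: "'e::euclidean_space \<times> 'e \<Rightarrow> 'e \<times> 'e"
  assumes N: "open N" "x \<in> N" and \<tau>: "smooth_on N \<tau>"
    and inv: "\<And>z h. z \<in> N \<Longrightarrow> snd (\<tau> z) \<bullet> fst (fd \<tau> z h) = snd z \<bullet> fst h"
  shows "fst (fd \<tau> x u) \<bullet> snd (fd \<tau> x w) - snd (fd \<tau> x u) \<bullet> fst (fd \<tau> x w) = fst u \<bullet> snd w - snd u \<bullet> fst w"
proof -
  note d = smooth_on_imp_differentiable[OF \<tau> N(2)]
  note d2 = smooth_on_imp_differentiable[OF smooth_on_fd_dir[OF \<tau>] N(2)]
  have ds: "(\<lambda>z. snd (\<tau> z)) differentiable (at x)" "(\<lambda>z. fst (fd \<tau> z h)) differentiable (at x)" for h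
    using smooth_on_imp_differentiable[OF smooth_on_snd[OF N(1) \<tau>] N(2)]
      smooth_on_imp_differentiable[OF smooth_on_fst[OF N(1) smooth_on_fd_dir[OF \<tau>]] N(2)] by auto
  \<comment> \<open>The invariance, differentiated along k. The term with the second derivative of
    \<tau> is symmetric in h and k and drops out when the two orders are subtracted.\<close>
  have "snd (\<tau> x) \<bullet> fst (fd (\<lambda>z. fd \<tau> z h) x k) + snd (fd \<tau> x k) \<bullet> fst (fd \<tau> x h) = snd k \<bullet> fst h" for h k
  proof -
    have "bounded_linear (\<lambda>z :: 'e \<times> 'e. snd z \<bullet> fst h)"
      by (rule bounded_linear_compose[OF bounded_linear_inner_left bounded_linear_snd])
    note l = this
    have "fd (\<lambda>z. snd (\<tau> z) \<bullet> fst (fd \<tau> z h)) x k = fd (\<lambda>z. snd z \<bullet> fst h) x k"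
      by (subst fd_cong_open[OF N]) (simp_all add: inv bounded_linear_imp_differentiable[OF l])
    then show ?thesis
      unfolding fd_inner[OF ds] fd_linear_eq[OF l] fd_snd[OF d] fd_fst[OF d2] .
  qed
  from this[of w u] this[of u w] show ?thesis
    unfolding fd_symmetric[OF N(1) \<tau> N(2), of u w] by (simp add: inner_commute)
qed

section \<open>The Liouville form and the canonical 2-form in natural charts\<close>

lemma smooth_at_fst_cotangent:
  assumes "smooth_atlas A" "c \<in> A" "a \<in> fst (cotangent_chart A c)"
  shows "smooth_at (cotangent_atlas A) A fst a"
proof -
  note ch = is_chart_cotangent[OF assms(1,2)]
  let ?N = "(snd c ` fst c) \<times> (UNIV :: 'b set)"
  note op = open_chart_image[OF ch, unfolded cotangent_chart_image[OF assms(1,2)]]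
  show ?thesis
  proof (rule smooth_atI[OF cotangent_chart_in[OF assms(2)] assms(2,3) op])
    show "snd (cotangent_chart A c) a \<in> ?N" using assms(3) cotangent_chart_image[OF assms(1,2)] by blast
    show "fst (chart_inv (cotangent_chart A c) x) \<in> fst c" if "x \<in> ?N" for x
      using that by (cases x) (simp add: cotangent_chart_inv[OF assms(1,2)] chart_inv_in)
    show "smooth_on ?N (\<lambda>x. snd c (fst (chart_inv (cotangent_chart A c) x)))"
      by (rule smooth_on_cong[OF smooth_on_fst[OF op smooth_on_ident] op])
         (auto simp: cotangent_chart_inv[OF assms(1,2)] chart_inv_right)
  qed (simp add: cotangent_chart_image[OF assms(1,2)])
qed

text \<open>In natural charts the projection to the base is \<open>fst\<close>, so the tautological
  form reads p dq.\<close>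

lemma liouville_form_dvec:
  assumes "smooth_atlas A" "c \<in> A" "a \<in> fst (cotangent_chart A c)"
  shows "liouville_form A a (dvec (cotangent_atlas A) (cotangent_chart A c) a h) =
    snd (snd (cotangent_chart A c) a) \<bullet> fst h"
proof -
  let ?K = "cotangent_chart A c"
  obtain p \<eta> where a: "p \<in> fst c" "a = (p, covec A c p \<eta>)"
    using assms(3) unfolding mem_cotangent_chart[OF assms(1,2)] by blast
  note ch = is_chart_cotangent[OF assms(1,2)]
  have "fd (\<lambda>x. snd c (fst (chart_inv ?K x))) (snd ?K a) = fd fst (snd ?K a)"
  proof (rule fd_cong_open[OF open_chart_image[OF ch]])
    fix x assume "x \<in> snd ?K ` fst ?K"
    then show "snd c (fst (chart_inv ?K x)) = fst x"
      unfolding cotangent_chart_image[OF assms(1,2)]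
      by (auto simp: cotangent_chart_inv[OF assms(1,2)] chart_inv_right)
  qed (use assms(3) bounded_linear_imp_differentiable[OF bounded_linear_fst] in auto)
  then have "pushforward (cotangent_atlas A) A fst a (dvec (cotangent_atlas A) ?K a h) = dvec A c p (fst h)"
    using pushforward_dvec[OF smooth_cotangent_atlas[OF assms(1)] assms(1) smooth_at_fst_cotangent[OF assms]
        cotangent_chart_in[OF assms(2)] assms(3) assms(2), of h] a
    by (simp add: fd_linear_eq[OF bounded_linear_fst])
  then show ?thesis
    unfolding liouville_form_def by (simp add: a covec_dvec[OF assms(1,2)] cotangent_chart_covec[OF assms(1,2)])
qed

text \<open>\<open>ext_deriv\<close> works in a chart picked by choice, about which only membership
  in the atlas is known. Evaluating there and passing through the transition from the chart at hand
  covers every possible choice.\<close>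

lemma canonical_symplectic_dvec:
  assumes "smooth_atlas A" "c \<in> A" "a \<in> fst (cotangent_chart A c)"
  shows "canonical_symplectic A a (dvec (cotangent_atlas A) (cotangent_chart A c) a u)
      (dvec (cotangent_atlas A) (cotangent_chart A c) a w) = fst u \<bullet> snd w - snd u \<bullet> fst w"
proof -
  let ?C = "cotangent_atlas A" and ?K = "cotangent_chart A c"
  define K where "K = (SOME K. K \<in> ?C \<and> a \<in> fst K)"
  note sC = smooth_cotangent_atlas[OF assms(1)]
  have "K \<in> ?C \<and> a \<in> fst K"
    unfolding K_def by (rule someI[of _ ?K]) (use assms cotangent_chart_in in blast)
  then have K: "K \<in> ?C" "a \<in> fst K" by auto
  obtain d where d: "d \<in> A" "K = cotangent_chart A d" using K(1) by (rule cotangent_atlasE)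
  note KK = cotangent_chart_in[OF assms(2)]
  note ch = atlas_chart[OF sC K(1)]
  have theta: "fd (\<lambda>x. liouville_form A (chart_inv K x) (coord_vector ?C K (chart_inv K x) h)) (snd K a) k
      = snd k \<bullet> fst h" for h k
  proof -
    have l: "bounded_linear (\<lambda>z :: 'b \<times> 'b. snd z \<bullet> fst h)"
      by (rule bounded_linear_compose[OF bounded_linear_inner_left bounded_linear_snd])
    have "fd (\<lambda>x. liouville_form A (chart_inv K x) (coord_vector ?C K (chart_inv K x) h)) (snd K a)
        = fd (\<lambda>z. snd z \<bullet> fst h) (snd K a)"
    proof (rule fd_cong_open[OF open_chart_image[OF ch]])
      fix x assume x: "x \<in> snd K ` fst K"
      show "liouville_form A (chart_inv K x) (coord_vector ?C K (chart_inv K x) h) = snd x \<bullet> fst h"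
        using liouville_form_dvec[OF assms(1) d(1), of "chart_inv K x" h] chart_inv_in[OF x]
        by (simp add: coord_vector_eq[OF sC K(1)] d(2)[symmetric] chart_inv_right[OF x])
    qed (use K(2) bounded_linear_imp_differentiable[OF l] in auto)
    then show ?thesis by (simp add: fd_linear_eq[OF l])
  qed
  let ?\<tau> = "\<lambda>x. snd K (chart_inv ?K x)" and ?N = "snd ?K ` (fst ?K \<inter> fst K)"
  note tr = atlas_transition[OF sC KK K(1)]
  \<comment> \<open>Both sides are the Liouville form on one and the same vector, read in the two
    charts.\<close>
  have "snd (?\<tau> z) \<bullet> fst (fd ?\<tau> z h) = snd z \<bullet> fst h" if zN: "z \<in> ?N" for z h
  proof -
    obtain b where b: "b \<in> fst ?K" "b \<in> fst K" "z = snd ?K b" using zN by blast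
    then have bz: "chart_inv ?K z = b" by (simp add: chart_inv_left[OF is_chart_cotangent[OF assms(1,2)]])
    have "liouville_form A b (dvec ?C ?K b h) = snd z \<bullet> fst h"
      using liouville_form_dvec[OF assms(1,2) b(1)] b(3) by simp
    moreover have "liouville_form A b (dvec ?C ?K b h) = snd (?\<tau> z) \<bullet> fst (fd ?\<tau> z h)"
      unfolding dvec_change[OF sC KK K(1) b(1,2)]
      using liouville_form_dvec[OF assms(1) d(1), of b] b by (simp add: d(2)[symmetric] bz b(3)[symmetric])
    ultimately show ?thesis by simp
  qed
  from symplectic_of_liouville[OF tr(1) _ tr(2) this, of "snd ?K a" u w] show ?thesis
    using K(2) assms(3)
    unfolding canonical_symplectic_def ext_deriv_def Let_def K_def[symmetric] theta
    by (simp add: tvec_coords_change[OF sC KK K(1)] inner_commute algebra_simps)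
qed

text \<open>The vector (\<partial>f/\<partial>p, -\<partial>f/\<partial>q) at x = (q, p), with the
  gradients assembled from basis derivatives.\<close>

definition ham_vec :: "('e::euclidean_space \<times> 'e \<Rightarrow> real) \<Rightarrow> 'e \<times> 'e \<Rightarrow> 'e \<times> 'e" where
  "ham_vec f x = (\<Sum>b\<in>Basis. fd f x (0, b) *\<^sub>R b, - (\<Sum>b\<in>Basis. fd f x (b, 0) *\<^sub>R b))"

lemma linear_functional_inner:
  assumes "linear (l :: 'e::euclidean_space \<Rightarrow> real)"
  shows "(\<Sum>b\<in>Basis. l b *\<^sub>R b) \<bullet> k = l k"
proof -
  have "l k = l (\<Sum>b\<in>Basis. (k \<bullet> b) *\<^sub>R b)" by (simp add: euclidean_representation)
  also have "\<dots> = (\<Sum>b\<in>Basis. (k \<bullet> b) * l b)" using assms by (simp add: linear_sum linear_cmul)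
  finally show ?thesis by (simp add: inner_sum_left inner_commute[of k] mult.commute)
qed

lemma ham_vec_inner:
  assumes "f differentiable (at x)"
  shows "fst (ham_vec f x) \<bullet> k = fd f x (0, k)" "snd (ham_vec f x) \<bullet> k = - fd f x (k, 0)"
proof -
  note l = linear_fd[OF assms]
  have l1: "linear (\<lambda>k. fd f x (0, k))"
    by (rule linearI) (use linear_add[OF l, of "(0, _)" "(0, _)"] linear_cmul[OF l, of _ "(0, _)"] in simp_all)
  have l2: "linear (\<lambda>k. fd f x (k, 0))"
    by (rule linearI) (use linear_add[OF l, of "(_, 0)" "(_, 0)"] linear_cmul[OF l, of _ "(_, 0)"] in simp_all)
  show "fst (ham_vec f x) \<bullet> k = fd f x (0, k)" "snd (ham_vec f x) \<bullet> k = - fd f x (k, 0)"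
    using linear_functional_inner[OF l1, of k] linear_functional_inner[OF l2, of k] by (simp_all add: ham_vec_def)
qed

text \<open>Nondegeneracy of dq \<and> dp: the test vectors (0, k) and (k, 0) read off the two
  components of u.\<close>

lemma ham_vec_unique:
  assumes "f differentiable (at x)"
  shows "(\<forall>w. fst u \<bullet> snd w - snd u \<bullet> fst w = fd f x w) \<longleftrightarrow> u = ham_vec f x"
proof
  assume *: "\<forall>w. fst u \<bullet> snd w - snd u \<bullet> fst w = fd f x w"
  have "fst u \<bullet> k = fst (ham_vec f x) \<bullet> k" "snd u \<bullet> k = snd (ham_vec f x) \<bullet> k" for k
    using *[rule_format, of "(0, k)"] *[rule_format, of "(k, 0)"] ham_vec_inner[OF assms, of k] by simp_all
  then show "u = ham_vec f x" by (metis prod_eqI vector_eq_rdot)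
next
  assume u: "u = ham_vec f x"
  show "\<forall>w. fst u \<bullet> snd w - snd u \<bullet> fst w = fd f x w"
  proof
    fix w show "fst u \<bullet> snd w - snd u \<bullet> fst w = fd f x w"
      unfolding u ham_vec_inner[OF assms] using linear_add[OF linear_fd[OF assms], of "(0, snd w)" "(fst w, 0)"]
      by simp
  qed
qed

lemma smooth_on_ham_vec:
  assumes "open N" "smooth_on N f"
  shows "smooth_on N (ham_vec f)"
  unfolding ham_vec_def[abs_def] using assms
  by (intro smooth_on_Pair smooth_on_minus smooth_on_sum smooth_on_scaleR smooth_on_const smooth_on_fd_dir)

text \<open>Every tangent vector is a \<open>dvec\<close>, so existence and uniqueness reduce to the
  linear algebra of \<open>ham_vec_unique\<close>.\<close>

lemma is_hamiltonian_vector_iff: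
  assumes A: "smooth_atlas A" "c \<in> A" "a \<in> fst (cotangent_chart A c)"
    and H: "smooth_at (cotangent_atlas A) euclidean_atlas H a"
  shows "is_hamiltonian_vector A H a X \<longleftrightarrow> X = dvec (cotangent_atlas A) (cotangent_chart A c) a
    (ham_vec (\<lambda>x. H (chart_inv (cotangent_chart A c) x)) (snd (cotangent_chart A c) a))"
proof -
  let ?C = "cotangent_atlas A" and ?K = "cotangent_chart A c"
  note C = smooth_cotangent_atlas[OF A(1)] cotangent_chart_in[OF A(2)] A(3)
  note dH = smooth_at_real_differentiable[OF H C]
  have wH: "dvec ?C ?K a w H = fd (\<lambda>x. H (chart_inv ?K x)) (snd ?K a) w" for w
    using H by (simp add: dvec_def)
  have "is_hamiltonian_vector A H a (dvec ?C ?K a u) \<longleftrightarrow> u = ham_vec (\<lambda>x. H (chart_inv ?K x)) (snd ?K a)" for u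
    unfolding ham_vec_unique[OF dH, symmetric] is_hamiltonian_vector_def tangent_space_eq[OF C]
    by (simp add: canonical_symplectic_dvec[OF A] wH)
  moreover have "is_hamiltonian_vector A H a X \<Longrightarrow> X \<in> range (dvec ?C ?K a)"
    unfolding is_hamiltonian_vector_def tangent_space_eq[OF C] by blast
  ultimately show ?thesis by (metis (no_types, lifting) rangeE)
qed

lemma hamiltonian_field_eq:
  assumes "smooth_atlas A" "c \<in> A" "a \<in> fst (cotangent_chart A c)"
    "smooth_at (cotangent_atlas A) euclidean_atlas H a"
  shows "hamiltonian_field A H a = dvec (cotangent_atlas A) (cotangent_chart A c) a
    (ham_vec (\<lambda>x. H (chart_inv (cotangent_chart A c) x)) (snd (cotangent_chart A c) a))"
  unfolding hamiltonian_field_def is_hamiltonian_vector_iff[OF assms] by (rule the_equality) auto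

lemma hamiltonian_vector_ex1:
  assumes "smooth_atlas A" "a \<in> points (cotangent_atlas A)"
    "smooth_at (cotangent_atlas A) euclidean_atlas H a"
  shows "\<exists>!X. is_hamiltonian_vector A H a X"
proof -
  obtain K where K: "K \<in> cotangent_atlas A" "a \<in> fst K" using assms(2) by (rule pointsE)
  obtain c where c: "c \<in> A" "K = cotangent_chart A c" using K(1) by (rule cotangent_atlasE)
  show ?thesis
    unfolding is_hamiltonian_vector_iff[OF assms(1) c(1) K(2)[unfolded c(2)] assms(3)] by blast
qed

lemma smooth_on_chart_rep:
  assumes "smooth_atlas A" "c \<in> A" "openin (atlas_topology A) W"
    "\<And>p. p \<in> W \<Longrightarrow> p \<in> fst c \<Longrightarrow> smooth_at A euclidean_atlas f p"
  shows "smooth_on (snd c ` (W \<inter> fst c)) (\<lambda>x. f (chart_inv c x))"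
proof (rule smooth_on_local)
  fix x assume "x \<in> snd c ` (W \<inter> fst c)"
  then obtain p where p: "p \<in> W" "p \<in> fst c" "x = snd c p" by auto
  obtain N where "open N" "snd c p \<in> N" "N \<subseteq> snd c ` fst c" "smooth_on N (\<lambda>x. f (chart_inv c x))"
    using smooth_at_realE[OF assms(4)[OF p(1,2)] assms(1,2) p(2)] by metis
  with p(3) show "\<exists>T. open T \<and> x \<in> T \<and> smooth_on T (\<lambda>x. f (chart_inv c x))" by blast
qed

text \<open>\<open>integral_curve\<close> demands smoothness, whereas the coordinate equation
  supplies just one derivative; \<open>smooth_on_ode\<close> closes the gap.\<close>

lemma integral_curve_iff:
  assumes A: "smooth_atlas A" "c \<in> A" and U: "openin (atlas_topology (cotangent_atlas A)) U"
    and H: "\<And>a. a \<in> U \<Longrightarrow> smooth_at (cotangent_atlas A) euclidean_atlas H a"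
    and I: "open I" "is_interval I" and x: "\<And>t. t \<in> I \<Longrightarrow> x t \<in> U" "\<And>t. t \<in> I \<Longrightarrow> x t \<in> fst (cotangent_chart A c)"
  shows "integral_curve (cotangent_atlas A) (hamiltonian_field A H) I x \<longleftrightarrow>
    (\<forall>t\<in>I. ((\<lambda>s. snd (cotangent_chart A c) (x s)) has_vector_derivative
       ham_vec (\<lambda>z. H (chart_inv (cotangent_chart A c) z)) (snd (cotangent_chart A c) (x t))) (at t))"
    (is "_ \<longleftrightarrow> ?R")
proof -
  let ?C = "cotangent_atlas A" and ?K = "cotangent_chart A c"
  let ?h = "\<lambda>z. H (chart_inv ?K z)" and ?S = "snd ?K ` (U \<inter> fst ?K)"
  note C = smooth_cotangent_atlas[OF A(1)] cotangent_chart_in[OF A(2)]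
  have field: "hamiltonian_field A H (x t) = dvec ?C ?K (x t) (ham_vec ?h (snd ?K (x t)))" if "t \<in> I" for t
    by (rule hamiltonian_field_eq[OF A x(2)[OF that] H[OF x(1)[OF that]]])
  have vel: "velocity ?C x t = dvec ?C ?K (x t) v"
    if "t \<in> I" "((\<lambda>s. snd ?K (x s)) has_vector_derivative v) (at t)" for t v
    by (rule velocity_eq_dvec[OF C I(1) that(1) x(2) that(2)])
  show ?thesis
  proof
    assume int: "integral_curve ?C (hamiltonian_field A H) I x"
    show ?R
    proof
      fix t assume t: "t \<in> I"
      have sm: "smooth_at euclidean_atlas ?C x t" and v: "velocity ?C x t = hamiltonian_field A H (x t)"
        using int t unfolding integral_curve_def by auto
      obtain N where N: "t \<in> N" "smooth_on N (\<lambda>s. snd ?K (x s))"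
        using smooth_at_curveE[OF sm C x(2)[OF t]] by metis
      have d: "((\<lambda>s. snd ?K (x s)) has_vector_derivative vector_derivative (\<lambda>s. snd ?K (x s)) (at t)) (at t)"
        using smooth_on_imp_differentiable[OF N(2,1)] by (simp add: vector_derivative_works)
      have "dvec ?C ?K (x t) (vector_derivative (\<lambda>s. snd ?K (x s)) (at t))
          = dvec ?C ?K (x t) (ham_vec ?h (snd ?K (x t)))"
        using vel[OF t d] v field[OF t] by simp
      with d show "((\<lambda>s. snd ?K (x s)) has_vector_derivative ham_vec ?h (snd ?K (x t))) (at t)"
        by (simp add: dvec_inject[OF C x(2)[OF t]])
    qed
  next
    assume R: ?R
    have op: "open ?S" by (rule openin_atlasD[OF C(1) U C(2)])
    have "smooth_on ?S (ham_vec ?h)"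
      by (rule smooth_on_ham_vec[OF op smooth_on_chart_rep[OF C U H]])
    then have sm: "smooth_on I (\<lambda>s. snd ?K (x s))"
      by (rule smooth_on_ode[OF I(1) op]) (use x R in auto)
    show "integral_curve ?C (hamiltonian_field A H) I x"
      unfolding integral_curve_def
    proof (intro conjI ballI I)
      fix t assume t: "t \<in> I"
      show "smooth_at euclidean_atlas ?C x t" by (rule smooth_at_curveI[OF C(2) I(1) t x(2) sm])
      show "velocity ?C x t = hamiltonian_field A H (x t)"
        using vel[OF t] R t field[OF t] by simp
    qed
  qed
qed

text \<open>The linearised flow \<open>P\<close> satisfies \<open>P' = J Hess(h) P\<close>, and \<open>J Hess(h)\<close> is infinitesimally
  symplectic because the Hessian is symmetric.\<close>

lemma ham_vec_fd_skew:
  assumes "open N" "smooth_on N f" "x \<in> N"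
  shows "fst (fd (ham_vec f) x u) \<bullet> snd w - snd (fd (ham_vec f) x u) \<bullet> fst w
    + (fst u \<bullet> snd (fd (ham_vec f) x w) - snd u \<bullet> fst (fd (ham_vec f) x w)) = 0"
proof -
  \<comment> \<open>The Hessian of f as a bilinear form; the two halves of the claim become B u w
    and - B w u.\<close>
  define B where "B = (\<lambda>v k. fd (\<lambda>y. fd f y k) x v)"
  note dh = smooth_on_imp_differentiable[OF smooth_on_ham_vec[OF assms(1,2)] assms(3)]
  note df = smooth_on_imp_differentiable[OF smooth_on_fd_dir[OF assms(2)] assms(3)]
  have sym: "B v k = B k v" for v k unfolding B_def by (rule fd_symmetric[OF assms])
  have addB: "B v (k + l) = B v k + B v l" for v k l
    unfolding sym[of v] unfolding B_def by (rule linear_add[OF linear_fd[OF df]])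
  have comp: "fst (fd (ham_vec f) x v) \<bullet> k = B v (0, k)" "snd (fd (ham_vec f) x v) \<bullet> k = - B v (k, 0)" for v k
  proof -
    have bl1: "bounded_linear (\<lambda>z :: 'a \<times> 'a. fst z \<bullet> k)"
      by (rule bounded_linear_compose[OF bounded_linear_inner_left bounded_linear_fst])
    have bl2: "bounded_linear (\<lambda>z :: 'a \<times> 'a. - (snd z \<bullet> k))"
      by (rule bounded_linear_minus[OF bounded_linear_compose[OF bounded_linear_inner_left bounded_linear_snd]])
    have "fd (\<lambda>y. fst (ham_vec f y) \<bullet> k) x v = B v (0, k)" "fd (\<lambda>y. - (snd (ham_vec f y) \<bullet> k)) x v = B v (k, 0)"
      unfolding B_def
      by (subst fd_cong_open[OF assms(1,3) _ df]; simp add: ham_vec_inner[OF smooth_on_imp_differentiable[OF assms(2)]])+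
    then show "fst (fd (ham_vec f) x v) \<bullet> k = B v (0, k)" "snd (fd (ham_vec f) x v) \<bullet> k = - B v (k, 0)"
      unfolding fd_linear_compose[OF bl1 dh] fd_linear_compose[OF bl2 dh] by simp_all
  qed
  have split: "B v (0, snd k) + B v (fst k, 0) = B v k" for v k
    unfolding addB[symmetric] by simp
  have "fst (fd (ham_vec f) x u) \<bullet> snd w - snd (fd (ham_vec f) x u) \<bullet> fst w = B u w"
    "fst (fd (ham_vec f) x w) \<bullet> snd u - snd (fd (ham_vec f) x w) \<bullet> fst u = B w u"
    using split[of u w] split[of w u] unfolding comp by simp_all
  then show ?thesis using sym[of u w] by (simp add: inner_commute)
qed

lemma has_real_derivative_symplectic:
  fixes P R :: "real \<Rightarrow> 'e::euclidean_space \<times> 'e"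
  assumes "(P has_vector_derivative P') (at t)" "(R has_vector_derivative R') (at t)"
  shows "((\<lambda>t. fst (P t) \<bullet> snd (R t) - snd (P t) \<bullet> fst (R t)) has_real_derivative
    (fst P' \<bullet> snd (R t) - snd P' \<bullet> fst (R t) + (fst (P t) \<bullet> snd R' - snd (P t) \<bullet> fst R'))) (at t)"
proof -
  note p = bounded_linear.has_vector_derivative[OF bounded_linear_fst assms(1), unfolded has_vector_derivative_def]
    bounded_linear.has_vector_derivative[OF bounded_linear_snd assms(1), unfolded has_vector_derivative_def]
    bounded_linear.has_vector_derivative[OF bounded_linear_fst assms(2), unfolded has_vector_derivative_def]
    bounded_linear.has_vector_derivative[OF bounded_linear_snd assms(2), unfolded has_vector_derivative_def]
  show ?thesis
    by (rule has_derivative_imp_has_field_derivative[OF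
        has_derivative_diff[OF has_derivative_inner[OF p(1,4)] has_derivative_inner[OF p(2,3)]]])
       (simp add: algebra_simps)
qed

section \<open>Charts of R x M, slices, and the linearised flow\<close>

lemma prod_chart:
  assumes "is_chart c"
  defines "c' \<equiv> ((UNIV :: real set) \<times> fst c, map_prod (id :: real \<Rightarrow> real) (snd c))"
  shows "is_chart c'" "snd c' ` fst c' = UNIV \<times> (snd c ` fst c)"
    "x \<in> snd c ` fst c \<Longrightarrow> chart_inv c' (t, x) = (t, chart_inv c x)"
proof -
  show im: "snd c' ` fst c' = UNIV \<times> (snd c ` fst c)"
    unfolding c'_def by (auto simp: image_iff)
  have "inj_on (snd c') (fst c')"
    using assms(1) unfolding c'_def is_chart_def by (auto simp: inj_on_def)
  moreover have "open (snd c' ` fst c')"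
    unfolding im by (intro open_Times open_UNIV open_chart_image assms)
  ultimately show ch: "is_chart c'" by (simp add: is_chart_def)
  show "chart_inv c' (t, x) = (t, chart_inv c x)" if "x \<in> snd c ` fst c"
    by (rule chart_inv_eqI[OF ch]) (simp_all add: c'_def chart_inv_in[OF that] chart_inv_right[OF that])
qed

lemma prod_atlas_chart:
  assumes "smooth_atlas A" "k \<in> prod_atlas (euclidean_atlas :: (real, real) atlas) A"
  shows "is_chart k"
proof -
  obtain c where "c \<in> A" "k = (UNIV \<times> fst c, map_prod id (snd c))"
    using assms(2) by (auto simp: prod_atlas_def euclidean_atlas_def)
  then show ?thesis using prod_chart(1)[OF atlas_chart[OF assms(1)]] by simp
qed

lemma open_slice:
  assumes "open (M :: (real \<times> 'e::euclidean_space) set)"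
  shows "open {s. (s, y) \<in> M}" "open {y. (s, y) \<in> M}"
proof -
  have "continuous_on UNIV (\<lambda>s :: real. (s, y))" "continuous_on UNIV (\<lambda>y :: 'e. (s, y))"
    by (intro continuous_intros)+
  from this[THEN open_vimage[OF assms]] show "open {s. (s, y) \<in> M}" "open {y. (s, y) \<in> M}"
    by (simp_all add: vimage_def)
qed

lemma fd_slice:
  fixes \<phi> :: "real \<times> 'e::euclidean_space \<Rightarrow> 'f::euclidean_space"
  assumes "\<phi> differentiable (at (t, x))"
  shows "fd (\<lambda>x. \<phi> (t, x)) x u = fd \<phi> (t, x) (0, u)"
    "((\<lambda>s. \<phi> (s, x)) has_vector_derivative fd \<phi> (t, x) (1, 0)) (at t)"
proof -
  have "((\<lambda>x. (t, x)) has_derivative (\<lambda>h. (0, h))) (at x)" "((\<lambda>s. (s, x)) has_derivative (\<lambda>h. (h, 0))) (at t)"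
    by (auto intro!: derivative_eq_intros)
  note c = this[THEN has_derivative_compose, OF fd_works[OF assms]]
  show "fd (\<lambda>x. \<phi> (t, x)) x u = fd \<phi> (t, x) (0, u)" using fd_eq[OF c(1)] by simp
  have "(\<lambda>h. fd \<phi> (t, x) (h, 0)) = (\<lambda>h. h *\<^sub>R fd \<phi> (t, x) (1, 0))"
  proof
    fix h :: real
    have "(h, 0) = h *\<^sub>R (1, 0 :: 'e)" by simp
    then show "fd \<phi> (t, x) (h, 0) = h *\<^sub>R fd \<phi> (t, x) (1, 0)"
      by (simp only: linear_cmul[OF linear_fd[OF assms]])
  qed
  from has_derivative_eq_rhs[OF c(2) this]
  show "((\<lambda>s. \<phi> (s, x)) has_vector_derivative fd \<phi> (t, x) (1, 0)) (at t)"
    unfolding has_vector_derivative_def .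
qed

text \<open>Differentiating the flow equation in the initial point gives the linearised equation;
  smoothness in (t, a) jointly allows the exchange of derivatives. The claim is needed at every time
  and not only at 0, hence two charts, c around a and d around F t a.\<close>

lemma flow_pullback_derivative:
  assumes A: "smooth_atlas A" and U: "openin (atlas_topology (cotangent_atlas A)) U"
    and H: "\<And>a. a \<in> U \<Longrightarrow> smooth_at (cotangent_atlas A) euclidean_atlas H a"
    and flow: "is_flow (cotangent_atlas A) (hamiltonian_field A H) U \<Omega> F"
    and ta: "(t, a) \<in> \<Omega>"
    and u: "u \<in> tangent_space (cotangent_atlas A) a" "w \<in> tangent_space (cotangent_atlas A) a"
  shows "((\<lambda>t. canonical_symplectic A (F t a) (pushforward (cotangent_atlas A) (cotangent_atlas A) (F t) a u)
      (pushforward (cotangent_atlas A) (cotangent_atlas A) (F t) a w)) has_real_derivative 0) (at t)"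
proof -
  let ?C = "cotangent_atlas A"
  note C = smooth_cotangent_atlas[OF A]
  have open\<Omega>: "openin (atlas_topology (prod_atlas euclidean_atlas ?C)) \<Omega>"
    and F: "\<And>t a. (t, a) \<in> \<Omega> \<Longrightarrow> F t a \<in> U"
      "\<And>t a. (t, a) \<in> \<Omega> \<Longrightarrow> smooth_at (prod_atlas euclidean_atlas ?C) ?C (\<lambda>(t, a). F t a) (t, a)"
    and int: "\<And>a. integral_curve ?C (hamiltonian_field A H) {t. (t, a) \<in> \<Omega>} (\<lambda>t. F t a)"
    using flow unfolding is_flow_def by blast+
  obtain c' d N where c': "c' \<in> prod_atlas euclidean_atlas ?C" and d: "d \<in> ?C"
    and N: "(t, a) \<in> fst c'" "open N" "snd c' (t, a) \<in> N" "N \<subseteq> snd c' ` fst c'"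
      "(\<lambda>(t, a). F t a) ` (chart_inv c' ` N) \<subseteq> fst d" "smooth_on N (snd d \<circ> (\<lambda>(t, a). F t a) \<circ> chart_inv c')"
    using F(2)[OF ta] unfolding smooth_at_def by blast
  obtain c where c: "c \<in> ?C" and c'_eq: "c' = (UNIV \<times> fst c, map_prod (id :: real \<Rightarrow> real) (snd c))"
    using c' by (auto simp: prod_atlas_def euclidean_atlas_def)
  note pc = prod_chart[OF atlas_chart[OF C c], folded c'_eq]
  obtain c0 where c0: "c0 \<in> A" "c = cotangent_chart A c0" using c by (rule cotangent_atlasE)
  obtain d0 where d0: "d0 \<in> A" "d = cotangent_chart A d0" using d by (rule cotangent_atlasE)
  have ac: "a \<in> fst c" using N(1) by (simp add: c'_eq)
  define x where "x = snd c a"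
  define \<phi> where "\<phi> = (\<lambda>z. snd d (F (fst z) (chart_inv c (snd z))))"
  \<comment> \<open>The neighbourhood supplied by \<open>smooth_at\<close> may leave \<Omega>,
    outside of which no flow equation is known; on M it holds at every point.\<close>
  define M where "M = N \<inter> snd c' ` (\<Omega> \<inter> fst c')"
  have "open (snd c' ` (\<Omega> \<inter> fst c'))"
    using open\<Omega> c' by (simp add: openin_atlas_topology[OF prod_atlas_chart[OF C]])
  then have M: "open M" unfolding M_def using N(2) by (intro open_Int)
  have M_mem: "(s, chart_inv c y) \<in> \<Omega> \<and> y \<in> snd c ` fst c \<and> F s (chart_inv c y) \<in> fst d
      \<and> chart_inv c' (s, y) = (s, chart_inv c y)" if sy: "(s, y) \<in> M" for s y
  proof -
    obtain b where b: "(s, b) \<in> \<Omega>" "b \<in> fst c" "y = snd c b"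
      using sy by (auto simp: M_def c'_eq)
    then have y: "y \<in> snd c ` fst c" "chart_inv c y = b" by (auto simp: chart_inv_left[OF atlas_chart[OF C c]])
    have "F s (chart_inv c y) \<in> fst d"
      using N(5) sy pc(3)[OF y(1), of s] by (force simp: M_def)
    with b y pc(3)[OF y(1), of s] show ?thesis by simp
  qed
  have "snd c' (t, a) \<in> M" unfolding M_def using N(1,3) ta by blast
  then have x_mem: "(t, x) \<in> M" by (simp add: c'_eq x_def)
  have \<phi>: "smooth_on M \<phi>"
  proof (rule smooth_on_cong[OF smooth_on_subset[OF N(6)] M])
    fix z assume "z \<in> M"
    then show "(snd d \<circ> (\<lambda>(t, a). F t a) \<circ> chart_inv c') z = \<phi> z"
      using M_mem[of "fst z" "snd z"] by (cases z) (simp add: \<phi>_def)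
  qed (auto simp: M_def)
  note d\<phi> = smooth_on_imp_differentiable[OF \<phi>]
  let ?h = "\<lambda>z. H (chart_inv d z)" and ?S = "snd d ` (U \<inter> fst d)"
  have S: "open ?S" "smooth_on ?S ?h"
    by (rule openin_atlasD[OF C U d]) (rule smooth_on_chart_rep[OF C d U H])
  have \<phi>S: "\<phi> z \<in> ?S" if "z \<in> M" for z
    using M_mem[of "fst z" "snd z"] that F(1) by (auto simp: \<phi>_def)
  note slice = open_slice[OF M]
  have ode: "fd \<phi> z (1, 0) = ham_vec ?h (\<phi> z)" if zM: "z \<in> M" for z
  proof -
    obtain s y where z: "z = (s, y)" by (cases z)
    define b where "b = chart_inv c y"
    note sy = zM[unfolded z]
    have b: "(s, b) \<in> \<Omega>" "F s b \<in> fst d" using M_mem[OF sy] by (simp_all add: b_def)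
    have "F r b \<in> fst d" if "r \<in> {r. (r, y) \<in> M}" for r
      using M_mem[of r y] that by (simp add: b_def)
    then have "velocity ?C (\<lambda>r. F r b) s = dvec ?C d (F s b) (fd \<phi> z (1, 0))"
    proof (rule velocity_eq_dvec[OF C d slice(1), rotated])
      show "((\<lambda>r. snd d (F r b)) has_vector_derivative fd \<phi> z (1, 0)) (at s)"
        using fd_slice(2)[OF d\<phi>[OF sy]] by (simp add: \<phi>_def b_def z)
    qed (use sy in auto)
    moreover have "velocity ?C (\<lambda>r. F r b) s = hamiltonian_field A H (F s b)"
      using int[of b] b(1) unfolding integral_curve_def by blast
    moreover have "hamiltonian_field A H (F s b) = dvec ?C d (F s b) (ham_vec ?h (\<phi> z))"
      using hamiltonian_field_eq[OF A d0(1) _ H, of "F s b"] b F(1)[OF b(1)]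
      by (simp add: d0(2) \<phi>_def z b_def)
    ultimately show ?thesis using dvec_inject[OF C d b(2)] by metis
  qed
  obtain u' w' where u': "u = dvec ?C c a u'" "w = dvec ?C c a w'"
    using u unfolding tangent_space_eq[OF C c ac] by blast
  define P where "P = (\<lambda>v s. fd \<phi> (s, x) (0, v))"
  have aa: "chart_inv c x = a" by (simp add: x_def chart_inv_left[OF atlas_chart[OF C c] ac])
  have push: "pushforward ?C ?C (F s) a (dvec ?C c a v) = dvec ?C d (F s a) (P v s)"
    and Fd: "F s a \<in> fst d" if s: "(s, x) \<in> M" for s v
  proof -
    show Fd: "F s a \<in> fst d" using M_mem[OF s] by (simp add: aa)
    have sm: "smooth_at ?C ?C (F s) a"
    proof (rule smooth_atI[OF c d ac slice(2)[of s]])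
      show "smooth_on {y. (s, y) \<in> M} (\<lambda>y. snd d (F s (chart_inv c y)))"
        using smooth_on_compose[OF \<phi> smooth_on_Pair[OF slice(2) smooth_on_const smooth_on_ident] slice(2)]
        by (auto simp: \<phi>_def)
    qed (use s M_mem in \<open>auto simp: x_def\<close>)
    show "pushforward ?C ?C (F s) a (dvec ?C c a v) = dvec ?C d (F s a) (P v s)"
      using pushforward_dvec[OF C C sm c ac d Fd, of v] fd_slice(1)[OF d\<phi>[OF s], of v]
      by (simp add: P_def x_def \<phi>_def)
  qed
  have P': "(P v has_vector_derivative fd (ham_vec ?h) (\<phi> (t, x)) (P v t)) (at t)" for v
  proof -
    note dP = smooth_on_imp_differentiable[OF smooth_on_fd_dir[OF \<phi>] x_mem]
    have "(P v has_vector_derivative fd (\<lambda>z. fd \<phi> z (0, v)) (t, x) (1, 0)) (at t)"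
      unfolding P_def by (rule fd_slice(2)[OF dP])
    \<comment> \<open>Symmetry of second derivatives turns the time derivative of the linearisation
      into the space derivative of the right-hand side of the flow equation.\<close>
    also have "fd (\<lambda>z. fd \<phi> z (0, v)) (t, x) (1, 0) = fd (\<lambda>z. fd \<phi> z (1, 0)) (t, x) (0, v)"
      by (rule fd_symmetric[OF M \<phi> x_mem])
    also have "\<dots> = fd (\<lambda>z. ham_vec ?h (\<phi> z)) (t, x) (0, v)"
      using frechet_derivative_transform_within_open[OF dP M x_mem ode] by simp
    also have "\<dots> = fd (ham_vec ?h) (\<phi> (t, x)) (P v t)"
      unfolding P_def
      by (rule fd_comp[OF d\<phi>[OF x_mem] smooth_on_imp_differentiable[OF smooth_on_ham_vec[OF S] \<phi>S[OF x_mem]]])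
    finally show ?thesis .
  qed
  have tm: "t \<in> {s. (s, x) \<in> M}" using x_mem by simp
  have "((\<lambda>s. fst (P u' s) \<bullet> snd (P w' s) - snd (P u' s) \<bullet> fst (P w' s)) has_real_derivative 0) (at t)"
    using has_real_derivative_symplectic[OF P'[of u'] P'[of w']] ham_vec_fd_skew[OF S \<phi>S[OF x_mem]] by simp
  moreover have "fst (P u' s) \<bullet> snd (P w' s) - snd (P u' s) \<bullet> fst (P w' s) =
      canonical_symplectic A (F s a) (pushforward ?C ?C (F s) a u) (pushforward ?C ?C (F s) a w)"
    if s: "s \<in> {s. (s, x) \<in> M}" for s
    using canonical_symplectic_dvec[OF A d0(1), of "F s a"] s
    by (simp add: u' push Fd d0(2)[symmetric])
  ultimately show ?thesis
    by (rule has_field_derivative_transform_within_open[OF _ slice(1)[of x] tm])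
qed

text \<open>The times attached to a form an interval containing 0, so the pulled-back form is
  constant on it and keeps its value at time 0.\<close>

lemma hamiltonian_flow_preserves:
  assumes A: "smooth_atlas A" and U: "openin (atlas_topology (cotangent_atlas A)) U"
    and H: "\<And>a. a \<in> U \<Longrightarrow> smooth_at (cotangent_atlas A) euclidean_atlas H a"
    and flow: "is_flow (cotangent_atlas A) (hamiltonian_field A H) U \<Omega> F"
  shows "flow_preserves (cotangent_atlas A) \<Omega> F (canonical_symplectic A)"
  unfolding flow_preserves_def
proof (clarify)
  fix t a u w
  let ?C = "cotangent_atlas A"
  assume ta: "(t, a) \<in> \<Omega>" and u: "u \<in> tangent_space ?C a" "w \<in> tangent_space ?C a"
  note C = smooth_cotangent_atlas[OF A]
  define g where "g = (\<lambda>t. canonical_symplectic A (F t a) (pushforward ?C ?C (F t) a u) (pushforward ?C ?C (F t) a w))"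
  define I where "I = {t. (t, a) \<in> \<Omega>}"
  have open\<Omega>: "openin (atlas_topology (prod_atlas euclidean_atlas ?C)) \<Omega>"
    and F0: "\<And>t a. (t, a) \<in> \<Omega> \<Longrightarrow> (0, a) \<in> \<Omega> \<and> F 0 a = a"
    and int: "integral_curve ?C (hamiltonian_field A H) I (\<lambda>t. F t a)"
    using flow unfolding is_flow_def I_def by blast+
  have I: "is_interval I" "t \<in> I" "0 \<in> I" using int ta F0[OF ta] by (auto simp: integral_curve_def I_def)
  have "(g has_real_derivative 0) (at s within I)" if "s \<in> I" for s
    unfolding g_def
    by (rule DERIV_subset[OF flow_pullback_derivative[OF A U H flow _ u]]) (use that in \<open>auto simp: I_def\<close>)
  from has_field_derivative_zero_constant[OF is_interval_convex[OF I(1)] this] I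
  have "g t = g 0" by metis
  \<comment> \<open>F 0 is known to be the identity only where (0, b) \<in> \<Omega>. These b form
    an open set around a, which is enough for the derivative at a to be the identity.\<close>
  moreover have "pushforward ?C ?C (F 0) a v = v" if v: "v \<in> tangent_space ?C a" for v
  proof -
    have aU: "a \<in> U" using flow F0[OF ta] unfolding is_flow_def by force
    obtain c where c: "c \<in> ?C" "a \<in> fst c"
      using smooth_at_points(1)[OF H[OF aU] C] by (rule pointsE)
    define c' where "c' = ((UNIV :: real set) \<times> fst c, map_prod (id :: real \<Rightarrow> real) (snd c))"
    have c': "c' \<in> prod_atlas euclidean_atlas ?C"
      using c(1) by (force simp: prod_atlas_def euclidean_atlas_def c'_def)
    have op: "open (snd c' ` (\<Omega> \<inter> fst c'))"
      using open\<Omega> c' by (simp add: openin_atlas_topology[OF prod_atlas_chart[OF C]])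
    define N where "N = {y. (0, y) \<in> snd c' ` (\<Omega> \<inter> fst c')}"
    have N: "open N"
      unfolding N_def by (rule open_slice(2)[OF op])
    have Nm: "y \<in> snd c ` fst c \<and> chart_inv c y \<in> fst c \<and> F 0 (chart_inv c y) = chart_inv c y" if yN: "y \<in> N" for y
    proof -
      obtain b where "(0, b) \<in> \<Omega>" "b \<in> fst c" "y = snd c b"
        using yN by (auto simp: N_def c'_def)
      then show ?thesis using F0 by (auto simp: chart_inv_left[OF atlas_chart[OF C c(1)]])
    qed
    have "snd c' (0, a) \<in> snd c' ` (\<Omega> \<inter> fst c')" using F0[OF ta] c(2) by (intro imageI) (simp add: c'_def)
    then have aN: "snd c a \<in> N" by (simp add: N_def c'_def)
    have sm: "smooth_at ?C ?C (F 0) a"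
      by (rule smooth_atI[OF c(1) c(1) c(2) N aN _ _ smooth_on_cong[OF smooth_on_ident N]])
         (use Nm in \<open>auto simp: chart_inv_right\<close>)
    have Fa: "F 0 a = a" using F0[OF ta] by simp
    obtain h where h: "v = dvec ?C c a h" using v unfolding tangent_space_eq[OF C c] by blast
    have "fd (\<lambda>x. snd c (F 0 (chart_inv c x))) (snd c a) = fd (\<lambda>x. x) (snd c a)"
      by (rule fd_cong_open[OF N aN]) (use Nm in \<open>auto simp: chart_inv_right\<close>)
    then show ?thesis
      using pushforward_dvec[OF C C sm c c(1), of h] Fa c(2) unfolding h by simp
  qed
  ultimately show "canonical_symplectic A (F t a) (pushforward ?C ?C (F t) a u) (pushforward ?C ?C (F t) a w)
      = canonical_symplectic A a u w"
    using u F0[OF ta] by (simp add: g_def)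
qed

section \<open>The total space of a distribution\<close>

text \<open>There may be more equations than unknowns, so Cramer's rule is applied to the normal
  equations; linear independence of the vectors r x A makes their Gram matrix invertible.\<close>

lemma smooth_on_injective_system:
  fixes r :: "'e::euclidean_space \<Rightarrow> 'k::finite \<Rightarrow> 'v::euclidean_space" and y :: "'e \<Rightarrow> real^'k"
  assumes S: "open S" and r: "\<And>A. smooth_on S (\<lambda>x. r x A)" and w: "smooth_on S w"
    and inj: "\<And>x v. x \<in> S \<Longrightarrow> (\<Sum>A\<in>UNIV. v $ A *\<^sub>R r x A) = 0 \<Longrightarrow> v = 0"
    and y: "\<And>x. x \<in> S \<Longrightarrow> (\<Sum>A\<in>UNIV. y x $ A *\<^sub>R r x A) = w x"
  shows "smooth_on S y"
proof (rule smooth_on_linear_system[OF S])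
  let ?M = "\<lambda>x. (\<chi> A B. r x A \<bullet> r x B) :: real^'k^'k"
  have M: "(?M x *v v) $ A = r x A \<bullet> (\<Sum>B\<in>UNIV. v $ B *\<^sub>R r x B)" for x v A
    by (simp add: matrix_vector_mult_def inner_sum_right mult.commute)
  show "smooth_on S (\<lambda>x. ?M x $ A $ B)" for A B using smooth_on_inner[OF S r r] by simp
  show "smooth_on S (\<lambda>x. \<chi> A. r x A \<bullet> w x)" by (intro smooth_on_vec S smooth_on_inner r w)
  show "?M x *v y x = (\<chi> A. r x A \<bullet> w x)" if "x \<in> S" for x
    using y[OF that] by (simp add: vec_eq_iff M)
  show "invertible (?M x)" if x: "x \<in> S" for x
    unfolding invertible_left_inverse matrix_left_invertible_ker
  proof (intro allI impI)
    fix v assume v: "?M x *v v = 0"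
    let ?s = "\<Sum>A\<in>UNIV. v $ A *\<^sub>R r x A"
    have "r x A \<bullet> ?s = 0" for A using v by (simp add: M[symmetric])
    then have "?s \<bullet> ?s = 0" by (subst inner_sum_left) simp
    then show "v = 0" using inj[OF x, of v] by simp
  qed
qed

section \<open>The maximal atlas\<close>

lemma max_atlas_chart: "c \<in> max_atlas A \<Longrightarrow> is_chart c"
  by (simp add: max_atlas_def)

lemma atlas_subset_max_atlas:
  assumes "smooth_atlas A"
  shows "A \<subseteq> max_atlas A"
proof
  fix c assume "c \<in> A"
  then show "c \<in> max_atlas A"
    using assms pointsI[of c A] unfolding max_atlas_def smooth_atlas_def by simp blast
qed

lemma points_max_atlas:
  assumes "smooth_atlas A"
  shows "points (max_atlas A) = points A"
proof
  show "points A \<subseteq> points (max_atlas A)"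
    using atlas_subset_max_atlas[OF assms] by (auto simp: points_def)
  show "points (max_atlas A) \<subseteq> points A"
  proof
    fix p assume "p \<in> points (max_atlas A)"
    then obtain c where "c \<in> max_atlas A" "p \<in> fst c" by (rule pointsE)
    then show "p \<in> points A" unfolding max_atlas_def by blast
  qed
qed

text \<open>By definition charts of the maximal atlas are compatible with those of A, not with each
  other; near each point a transition between two of them factors through a chart of A.\<close>

lemma smooth_max_atlas:
  assumes "smooth_atlas A"
  shows "smooth_atlas (max_atlas A)"
  unfolding smooth_atlas_def
proof (intro conjI ballI)
  show "is_chart c" if "c \<in> max_atlas A" for c using that by (rule max_atlas_chart)
  fix c d assume cd: "c \<in> max_atlas A" "d \<in> max_atlas A"
  note ch = cd[THEN max_atlas_chart]
  have local: "\<exists>T. open T \<and> x \<in> T \<and> T \<subseteq> snd c ` (fst c \<inter> fst d) \<and> smooth_on T (snd d \<circ> chart_inv c)"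
    if "x \<in> snd c ` (fst c \<inter> fst d)" for x
  proof -
    from that obtain p where p: "p \<in> fst c" "p \<in> fst d" "x = snd c p" by blast
    have "p \<in> points A" using cd(1) p(1) by (auto simp: max_atlas_def)
    then obtain b where b: "b \<in> A" "p \<in> fst b" by (rule pointsE)
    note chb = atlas_chart[OF assms b(1)]
    let ?\<tau> = "snd b \<circ> chart_inv c" and ?\<sigma> = "snd d \<circ> chart_inv b"
    have t1: "open (snd c ` (fst c \<inter> fst b))" "smooth_on (snd c ` (fst c \<inter> fst b)) ?\<tau>"
      using cd(1) b(1) by (auto simp: max_atlas_def smooth_transition_def)
    have t2: "open (snd b ` (fst b \<inter> fst d))" "smooth_on (snd b ` (fst b \<inter> fst d)) ?\<sigma>"
      using cd(2) b(1) by (auto simp: max_atlas_def smooth_transition_def)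
    define T where "T = {x \<in> snd c ` (fst c \<inter> fst b). ?\<tau> x \<in> snd b ` (fst b \<inter> fst d)}"
    have T: "open T" unfolding T_def by (rule open_preimage[OF t1 t2(1)])
    have Tm: "\<exists>r. r \<in> fst c \<and> r \<in> fst b \<and> r \<in> fst d \<and> y = snd c r" if yT: "y \<in> T" for y
    proof -
      obtain r r' where r: "r \<in> fst c" "r \<in> fst b" "y = snd c r" "r' \<in> fst b" "r' \<in> fst d" "?\<tau> y = snd b r'"
        using yT unfolding T_def by blast
      then have "r = r'"
        using chart_eqI[OF chb, of r r'] by (simp add: chart_inv_left[OF ch(1)])
      with r show ?thesis by blast
    qed
    have "smooth_on T (snd d \<circ> chart_inv c)"
    proof (rule smooth_on_cong[OF _ T])
      show "smooth_on T (\<lambda>x. ?\<sigma> (?\<tau> x))"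
        by (rule smooth_on_compose[OF t2(2) smooth_on_subset[OF t1(2)] T]) (auto simp: T_def)
      show "?\<sigma> (?\<tau> y) = (snd d \<circ> chart_inv c) y" if "y \<in> T" for y
        using Tm[OF that] by (auto simp: chart_inv_left[OF ch(1)] chart_inv_left[OF chb])
    qed
    moreover have "x \<in> T" using p b(2) by (auto simp: T_def chart_inv_left[OF ch(1)])
    moreover have "T \<subseteq> snd c ` (fst c \<inter> fst d)" using Tm by blast
    ultimately show ?thesis using T by blast
  qed
  show "smooth_transition c d"
    unfolding smooth_transition_def
  proof
    show "open (snd c ` (fst c \<inter> fst d))" unfolding open_subopen[of "snd c ` (fst c \<inter> fst d)"] using local by blast
    show "smooth_on (snd c ` (fst c \<inter> fst d)) (snd d \<circ> chart_inv c)"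
      by (rule smooth_on_local) (use local in blast)
  qed
qed

lemma smooth_at_max_atlas_left:
  assumes "smooth_atlas A" "smooth_atlas B"
  shows "smooth_at (max_atlas A) B F p \<longleftrightarrow> smooth_at A B F p"
proof
  assume s: "smooth_at (max_atlas A) B F p"
  note sm = smooth_max_atlas[OF assms(1)]
  have "p \<in> points A" using smooth_at_points(1)[OF s sm] points_max_atlas[OF assms(1)] by simp
  then obtain c where c: "c \<in> A" "p \<in> fst c" by (rule pointsE)
  obtain d where d: "d \<in> B" "F p \<in> fst d" using smooth_at_points(2)[OF s sm] by (rule pointsE)
  have c': "c \<in> max_atlas A" using c(1) atlas_subset_max_atlas[OF assms(1)] by blast
  show "smooth_at A B F p"
    by (rule smooth_atE[OF s sm assms(2) c' d(1) c(2) d(2)]) (rule smooth_atI[OF c(1) d(1) c(2)])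
qed (rule smooth_at_mono[OF _ atlas_subset_max_atlas[OF assms(1)] order_refl])

lemma smooth_at_max_atlas_right:
  assumes "smooth_atlas A" "smooth_atlas B"
  shows "smooth_at A (max_atlas B) F p \<longleftrightarrow> smooth_at A B F p"
proof
  assume s: "smooth_at A (max_atlas B) F p"
  note sm = smooth_max_atlas[OF assms(2)]
  obtain c where c: "c \<in> A" "p \<in> fst c" using smooth_at_points(1)[OF s assms(1)] by (rule pointsE)
  have "F p \<in> points B" using smooth_at_points(2)[OF s assms(1)] points_max_atlas[OF assms(2)] by simp
  then obtain d where d: "d \<in> B" "F p \<in> fst d" by (rule pointsE)
  have d': "d \<in> max_atlas B" using d(1) atlas_subset_max_atlas[OF assms(2)] by blast
  show "smooth_at A B F p"
    by (rule smooth_atE[OF s assms(1) sm c(1) d' c(2) d(2)]) (rule smooth_atI[OF c(1) d(1) c(2)])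
qed (rule smooth_at_mono[OF _ order_refl atlas_subset_max_atlas[OF assms(2)]])

lemma velocity_max_atlas: "smooth_atlas A \<Longrightarrow> velocity (max_atlas A) = velocity A"
  by (intro ext) (simp add: velocity_def smooth_at_max_atlas_left smooth_euclidean_atlas)

lemma tangent_space_max_atlas: "smooth_atlas A \<Longrightarrow> tangent_space (max_atlas A) = tangent_space A"
  by (intro ext) (simp add: tangent_space_def velocity_max_atlas smooth_at_max_atlas_right smooth_euclidean_atlas)

lemma tangent_atlas_subset_max_atlas:
  assumes "smooth_atlas A"
  shows "tangent_atlas A \<subseteq> tangent_atlas (max_atlas A)"
proof -
  have "tangent_chart (max_atlas A) = tangent_chart A"
    by (intro ext) (simp add: tangent_chart_def tangent_space_max_atlas[OF assms])
  then show ?thesis using atlas_subset_max_atlas[OF assms] by (auto simp: tangent_atlas_def)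
qed

section \<open>The anchor map, adapted charts and the atlas of D\<close>

abbreviation anchor :: "('a, real^'n::finite) chart \<Rightarrow> ('k::finite \<Rightarrow> 'a \<Rightarrow> 'a tvec)
    \<Rightarrow> real^'n \<Rightarrow> real^'k \<Rightarrow> real^'n" where
  "anchor c e q y \<equiv> \<chi> i. \<Sum>A\<in>UNIV. rho c e A i q * y $ A"

lemma anchor_sum: "anchor c e q y = (\<Sum>A\<in>UNIV. y $ A *\<^sub>R (\<chi> i. rho c e A i q))"
  by (simp add: vec_eq_iff mult.commute)

locale distribution_atlas =
  fixes Q :: "('a, real^'n::finite) atlas"
    and D :: "'a tpoint set"
    and E :: "('a tpoint, (real^'n) \<times> (real^'k::finite)) atlas"
  assumes Q: "smooth_atlas Q"
    and dist: "distribution TYPE('k) Q D"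
    and E_eq: "E = dist_atlas Q D"
begin

text \<open>Adapted charts lie in the maximal atlas; passing from \<open>Q\<close> to it changes neither smoothness nor
  tangent vectors.\<close>

abbreviation "R \<equiv> max_atlas Q"

lemma smooth_R: "smooth_atlas R"
  by (rule smooth_max_atlas[OF Q])

context
  fixes c and e :: "'k \<Rightarrow> 'a \<Rightarrow> 'a tvec"
  assumes ad: "adapted_chart Q D c e"
begin

abbreviation "dch \<equiv> dist_chart D c e"

lemma c_in_R: "c \<in> R"
  using ad by (simp add: adapted_chart_def)

lemma is_chart_c: "is_chart c"
  by (rule atlas_chart[OF smooth_R c_in_R])

lemma D_fibre: "x \<in> fst c \<Longrightarrow> (x, u) \<in> D \<longleftrightarrow> (\<exists>y. u = frame_comb e x y)"
  using ad unfolding adapted_chart_def local_frame_def by blast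

lemma inj_frame: "x \<in> fst c \<Longrightarrow> inj (frame_comb e x)"
  using ad unfolding adapted_chart_def local_frame_def by blast

text \<open>\<open>rho\<close> records the values of e A on coordinate functions. As D lies in the
  tangent bundle, e A x is a tangent vector, and such a vector is recovered from these
  values.\<close>

lemma frame_coords:
  assumes "x \<in> fst c"
  shows "e A x \<in> tangent_space Q x" "e A x = dvec R c x (\<chi> i. rho c e A i (snd c x))"
proof -
  have "frame_comb e x (axis A 1) = e A x"
    by (rule ext) (simp add: frame_comb_def axis_def if_distrib[of "\<lambda>a. a * _"] cong: if_cong)
  then have "(x, e A x) \<in> D" using D_fibre[OF assms] by metis
  then have "(x, e A x) \<in> points (tangent_atlas Q)" using dist by (auto simp: distribution_def)
  then show t: "e A x \<in> tangent_space Q x"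
    by (auto simp: points_def tangent_atlas_def fst_tangent_chart)
  then obtain h where h: "e A x = dvec R c x h"
    using tangent_space_eq[OF smooth_R c_in_R assms] unfolding tangent_space_max_atlas[OF Q] by blast
  have "rho c e A i (snd c x) = h $ i" for i
    by (simp add: rho_def chart_inv_left[OF is_chart_c assms] h dvec_coordinate[OF smooth_R c_in_R assms bounded_linear_vec_nth])
  then show "e A x = dvec R c x (\<chi> i. rho c e A i (snd c x))" by (simp add: h)
qed

lemma frame_comb_eq:
  assumes "x \<in> fst c"
  shows "frame_comb e x y = dvec R c x (anchor c e (snd c x) y)"
  unfolding anchor_sum dvec_sum[OF smooth_R c_in_R assms] frame_comb_def using frame_coords(2)[OF assms] by simp

lemma anchor_inj:
  assumes "q \<in> snd c ` fst c" "anchor c e q y = anchor c e q y'"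
  shows "y = y'"
proof -
  from assms(1) obtain x where x: "x \<in> fst c" "q = snd c x" by blast
  have "frame_comb e x y = frame_comb e x y'"
    using assms(2) by (simp add: frame_comb_eq[OF x(1)] x(2))
  with inj_frame[OF x(1)] show ?thesis by (rule injD)
qed

lemma smooth_on_rho: "smooth_on (snd c ` fst c) (rho c e A i)"
proof (rule smooth_on_local)
  fix q assume "q \<in> snd c ` fst c"
  then obtain x where x: "x \<in> fst c" "q = snd c x" by blast
  have "smooth_at Q (tangent_atlas Q) (\<lambda>x'. (x', e A x')) x"
    using ad x(1) unfolding adapted_chart_def local_frame_def by blast
  then have sm: "smooth_at R (tangent_atlas R) (\<lambda>x'. (x', e A x')) x"
    by (rule smooth_at_mono[OF _ atlas_subset_max_atlas[OF Q] tangent_atlas_subset_max_atlas[OF Q]])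
  have "(x, e A x) \<in> fst (tangent_chart R c)"
    using frame_coords(1)[OF x(1)] x(1) by (simp add: fst_tangent_chart tangent_space_max_atlas[OF Q])
  note smE = smooth_atE[OF sm smooth_R smooth_tangent_atlas[OF smooth_R] c_in_R tangent_chart_in[OF c_in_R] x(1) this]
  obtain N where N: "open N" "snd c x \<in> N" "N \<subseteq> snd c ` fst c"
    and "\<And>q. q \<in> N \<Longrightarrow> (chart_inv c q, e A (chart_inv c q)) \<in> fst (tangent_chart R c)"
    and s: "smooth_on N (\<lambda>q. snd (tangent_chart R c) (chart_inv c q, e A (chart_inv c q)))"
    by (rule smE) (rule that)
  have "smooth_on N (\<lambda>q. snd (snd (tangent_chart R c) (chart_inv c q, e A (chart_inv c q))) $ i)"
    by (intro smooth_on_vec_nth smooth_on_snd N s)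
  then have "smooth_on N (rho c e A i)"
  proof (rule smooth_on_cong[OF _ N(1)])
    fix q assume "q \<in> N"
    then have q: "q \<in> snd c ` fst c" using N(3) by (rule subsetD[rotated])
    note ci = chart_inv_in[OF q]
    show "snd (snd (tangent_chart R c) (chart_inv c q, e A (chart_inv c q))) $ i = rho c e A i q"
      using frame_coords(2)[OF ci, of A] tvec_coords_dvec[OF smooth_R c_in_R ci]
      by (simp add: snd_tangent_chart chart_inv_right[OF q])
  qed
  with N x(2) show "\<exists>T. open T \<and> q \<in> T \<and> smooth_on T (rho c e A i)" by blast
qed

lemma open_c: "open (snd c ` fst c)"
  by (rule open_chart_image[OF is_chart_c])

lemma smooth_on_rho_compose:
  assumes "open S" "smooth_on S f" "f ` S \<subseteq> snd c ` fst c"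
  shows "smooth_on S (\<lambda>x. rho c e A i (f x))"
  by (rule smooth_on_compose[OF smooth_on_rho assms(2,1,3)])

lemma smooth_on_anchor:
  assumes "open S" "smooth_on S f" "f ` S \<subseteq> snd c ` fst c" "smooth_on S g"
  shows "smooth_on S (\<lambda>x. anchor c e (f x) (g x))"
  by (intro smooth_on_vec smooth_on_sum smooth_on_mult smooth_on_vec_nth smooth_on_rho_compose assms)

lemma mem_dist_chart: "v \<in> fst dch \<longleftrightarrow> (\<exists>x\<in>fst c. \<exists>y. v = (x, frame_comb e x y))"
  using D_fibre by (cases v) (auto simp: dist_chart_def)

lemma dist_chart_frame:
  assumes "x \<in> fst c"
  shows "(x, frame_comb e x y) \<in> fst dch" "snd dch (x, frame_comb e x y) = (snd c x, y)"
proof -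
  show "(x, frame_comb e x y) \<in> fst dch" using assms mem_dist_chart by blast
  have "(THE y'. frame_comb e x y = frame_comb e x y') = y"
  proof (rule the_equality)
    show "y' = y" if "frame_comb e x y = frame_comb e x y'" for y'
      using injD[OF inj_frame[OF assms] that] by simp
  qed simp
  then show "snd dch (x, frame_comb e x y) = (snd c x, y)" by (simp add: dist_chart_def)
qed

lemma dist_chart_image: "snd dch ` fst dch = (snd c ` fst c) \<times> UNIV"
proof (intro equalityI subsetI)
  fix z assume "z \<in> snd dch ` fst dch"
  then obtain v where v: "v \<in> fst dch" "z = snd dch v" by blast
  then obtain x y where "x \<in> fst c" "v = (x, frame_comb e x y)" unfolding mem_dist_chart by blast
  with v(2) show "z \<in> (snd c ` fst c) \<times> UNIV" by (simp add: dist_chart_frame)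
next
  fix z assume "z \<in> (snd c ` fst c) \<times> (UNIV :: (real^'k) set)"
  then obtain x y where "x \<in> fst c" "z = (snd c x, y)" by auto
  with dist_chart_frame show "z \<in> snd dch ` fst dch" by (metis image_eqI)
qed

lemma is_chart_dist: "is_chart dch"
  unfolding is_chart_def
proof
  show "open (snd dch ` fst dch)" unfolding dist_chart_image by (intro open_Times open_c open_UNIV)
  show "inj_on (snd dch) (fst dch)"
  proof (rule inj_onI)
    fix v w assume *: "v \<in> fst dch" "w \<in> fst dch" "snd dch v = snd dch w"
    then obtain x y x' y' where "x \<in> fst c" "x' \<in> fst c" "v = (x, frame_comb e x y)" "w = (x', frame_comb e x' y')"
      unfolding mem_dist_chart by blast
    with *(3) show "v = w" using chart_eqI[OF is_chart_c] by (auto simp: dist_chart_frame)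
  qed
qed

lemma dist_chart_inv:
  assumes "q \<in> snd c ` fst c"
  shows "chart_inv dch (q, y) = (chart_inv c q, frame_comb e (chart_inv c q) y)"
  by (rule chart_inv_eqI[OF is_chart_dist])
     (simp_all add: dist_chart_frame[OF chart_inv_in[OF assms]] chart_inv_right[OF assms])

lemma dist_chart_in_E: "dch \<in> E"
  unfolding E_eq dist_atlas_def using ad by blast

end

lemma dist_atlasE:
  assumes "b \<in> E"
  obtains c e where "adapted_chart Q D c e" "b = dist_chart D c e"
  using assms unfolding E_eq dist_atlas_def by blast

text \<open>The new fibre coordinate y' is given only implicitly, by \<rho>'(\<phi>(q)) y' =
  d\<phi>(q) \<rho>(q) y. This system is injective in y' and has smooth data, whence y' is smooth in
  (q, y).\<close>

lemma smooth_dist_transition: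
  assumes ad: "adapted_chart Q D c e" and ad': "adapted_chart Q D c' e'"
  shows "smooth_transition (dist_chart D c e :: (_, _ \<times> (real^'k)) chart) (dist_chart D c' e')"
proof -
  let ?d = "dist_chart D c e :: (_, _ \<times> (real^'k)) chart" and ?d' = "dist_chart D c' e'"
  let ?O = "snd c ` (fst c \<inter> fst c')" and ?\<phi> = "\<lambda>x. snd c' (chart_inv c x)"
  let ?S = "?O \<times> (UNIV :: (real^'k) set)"
  note tr = atlas_transition[OF smooth_R c_in_R[OF ad] c_in_R[OF ad']]
  have op: "open ?S" using tr(1) by (intro open_Times open_UNIV)
  have dom: "snd ?d ` (fst ?d \<inter> fst ?d') = ?S"
  proof (intro equalityI subsetI)
    fix z assume "z \<in> snd ?d ` (fst ?d \<inter> fst ?d')"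
    then obtain v where v: "v \<in> fst ?d" "v \<in> fst ?d'" "z = snd ?d v" by blast
    then obtain x y where "x \<in> fst c" "v = (x, frame_comb e x y)" unfolding mem_dist_chart[OF ad] by blast
    moreover then have "x \<in> fst c'" using v(2) unfolding mem_dist_chart[OF ad'] by blast
    ultimately show "z \<in> ?S" using v(3) by (simp add: dist_chart_frame[OF ad])
  next
    fix z assume "z \<in> ?S"
    then obtain x y where x: "x \<in> fst c" "x \<in> fst c'" "z = (snd c x, y)" by auto
    then have "(x, frame_comb e x y) \<in> fst ?d \<inter> fst ?d'"
      using dist_chart_frame(1)[OF ad x(1)] D_fibre[OF ad x(1)] by (simp add: dist_chart_def)
    with x dist_chart_frame(2)[OF ad x(1)] show "z \<in> snd ?d ` (fst ?d \<inter> fst ?d')" by (metis image_eqI)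
  qed
  define y' where "y' = (\<lambda>z. snd (snd ?d' (chart_inv ?d z)))"
  have y': "snd ?d' (chart_inv ?d z) = (?\<phi> (fst z), y' z) \<and>
      anchor c' e' (?\<phi> (fst z)) (y' z) = fd ?\<phi> (fst z) (anchor c e (fst z) (snd z))" if z: "z \<in> ?S" for z
  proof -
    obtain x y where x: "x \<in> fst c" "x \<in> fst c'" "z = (snd c x, y)" using z by auto
    have inv: "chart_inv ?d z = (x, frame_comb e x y)"
      using dist_chart_inv[OF ad, of "snd c x" y] x by (simp add: chart_inv_left[OF is_chart_c[OF ad]])
    obtain w where w: "frame_comb e x y = frame_comb e' x w"
      using D_fibre[OF ad x(1)] D_fibre[OF ad' x(2)] by blast
    have y'z: "y' z = w" by (simp add: y'_def inv w dist_chart_frame[OF ad' x(2)])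
    have "dvec R c' x (anchor c' e' (snd c' x) w) = dvec R c' x (fd ?\<phi> (snd c x) (anchor c e (snd c x) y))"
      using w dvec_change[OF smooth_R c_in_R[OF ad] c_in_R[OF ad'] x(1,2)]
      unfolding frame_comb_eq[OF ad x(1)] frame_comb_eq[OF ad' x(2)] by simp
    then have "anchor c' e' (snd c' x) w = fd ?\<phi> (snd c x) (anchor c e (snd c x) y)"
      by (simp only: dvec_inject[OF smooth_R c_in_R[OF ad'] x(2)])
    then show ?thesis
      using y'z by (simp add: inv[unfolded x(3)] w dist_chart_frame[OF ad' x(2)] x(3) chart_inv_left[OF is_chart_c[OF ad] x(1)])
  qed
  have f1: "smooth_on ?S fst" and f2: "smooth_on ?S snd"
    by (intro smooth_on_linear bounded_linear_fst bounded_linear_snd)+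
  have \<phi>: "smooth_on ?S (\<lambda>z. ?\<phi> (fst z))"
    by (rule smooth_on_compose[OF tr(2) f1 op]) auto
  have \<phi>im: "(\<lambda>z. ?\<phi> (fst z)) ` ?S \<subseteq> snd c' ` fst c'"
    by (auto simp: chart_inv_left[OF is_chart_c[OF ad]])
  have sub: "fst ` ?S \<subseteq> snd c ` fst c" "fst ` ?S \<subseteq> ?O" by auto
  have w: "smooth_on ?S (\<lambda>z. fd ?\<phi> (fst z) (anchor c e (fst z) (snd z)))"
    by (rule smooth_on_fd[OF op tr f1 smooth_on_anchor[OF ad op f1 sub(1) f2] sub(2)])
  have "smooth_on ?S y'"
  proof (rule smooth_on_injective_system[OF op _ w])
    show "smooth_on ?S (\<lambda>z. \<chi> i. rho c' e' A i (?\<phi> (fst z)))" for A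
      by (intro smooth_on_vec op smooth_on_rho_compose[OF ad' op \<phi> \<phi>im])
    show "v = 0" if "z \<in> ?S" "(\<Sum>A\<in>UNIV. v $ A *\<^sub>R (\<chi> i. rho c' e' A i (?\<phi> (fst z)))) = 0" for z v
    proof (rule anchor_inj[OF ad', of "?\<phi> (fst z)"])
      show "?\<phi> (fst z) \<in> snd c' ` fst c'" using \<phi>im that(1) by blast
      show "anchor c' e' (?\<phi> (fst z)) v = anchor c' e' (?\<phi> (fst z)) 0"
        using that(2) unfolding anchor_sum by simp
    qed
    show "(\<Sum>A\<in>UNIV. y' z $ A *\<^sub>R (\<chi> i. rho c' e' A i (?\<phi> (fst z)))) = fd ?\<phi> (fst z) (anchor c e (fst z) (snd z))"
      if "z \<in> ?S" for z
      using y'[OF that] unfolding anchor_sum by simp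
  qed
  then have "smooth_on ?S (snd ?d' \<circ> chart_inv ?d)"
    by (rule smooth_on_cong[OF smooth_on_Pair[OF op \<phi>] op]) (use y' in simp)
  with op show ?thesis unfolding smooth_transition_def dom by simp
qed

lemma smooth_E: "smooth_atlas E"
  unfolding smooth_atlas_def
proof (intro conjI ballI)
  show "is_chart b" if b: "b \<in> E" for b
    using dist_atlasE[OF b] is_chart_dist by metis
  show "smooth_transition b b'" if b: "b \<in> E" "b' \<in> E" for b b'
    using dist_atlasE[OF b(1)] dist_atlasE[OF b(2)] smooth_dist_transition by metis
qed

end

section \<open>Second-order nonholonomic systems in coordinates\<close>

lemma vertical_lift_dvec:
  assumes "smooth_atlas A" "c \<in> A" "p \<in> fst c"
  shows "vertical_lift A (p, dvec A c p h) (dvec A c p k) =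
    dvec (tangent_atlas A) (tangent_chart A c) (p, dvec A c p h) (0, k)"
proof -
  note T = smooth_tangent_atlas[OF assms(1)] tangent_chart_in[OF assms(2)]
  have eq: "(\<lambda>f. dvec A c p h f + t * dvec A c p k f) = dvec A c p (h + t *\<^sub>R k)" for t
    using dvec_lincomb[OF assms, of 1 h t k] by simp
  have "((\<lambda>t. (snd c p, h + t *\<^sub>R k)) has_vector_derivative (0, k)) (at 0)"
    by (auto intro!: derivative_eq_intros)
  then have d: "((\<lambda>t. snd (tangent_chart A c) (p, dvec A c p (h + t *\<^sub>R k))) has_vector_derivative (0, k)) (at 0)"
    by (simp add: tangent_chart_dvec(2)[OF assms])
  from velocity_eq_dvec[OF T open_UNIV UNIV_I tangent_chart_dvec(1)[OF assms] d] show ?thesis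
    unfolding vertical_lift_def by (simp add: eq)
qed

text \<open>The vertical lift of k has components (0, k), so pairing with it retains exactly the
  half of the covector that is dual to velocities.\<close>

lemma Psi_map_covec:
  assumes "smooth_atlas A" "c \<in> A" "p \<in> fst c"
  shows "Psi_map A ((p, dvec A c p h), covec (tangent_atlas A) (tangent_chart A c) (p, dvec A c p h) \<mu>) =
    (p, covec A c p (snd \<mu>))"
proof -
  let ?v = "(p, dvec A c p h)"
  note T = smooth_tangent_atlas[OF assms(1)] tangent_chart_in[OF assms(2)] tangent_chart_dvec(1)[OF assms]
  have "covec (tangent_atlas A) (tangent_chart A c) ?v \<mu> (vertical_lift A ?v X) = snd \<mu> \<bullet> tvec_coords c X"
    if X: "X \<in> tangent_space A p" for X
  proof -
    obtain k where k: "X = dvec A c p k" using X unfolding tangent_space_eq[OF assms] by blast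
    show ?thesis
      unfolding k vertical_lift_dvec[OF assms] covec_dvec[OF T] tvec_coords_dvec[OF assms]
      by (simp add: inner_prod_def)
  qed
  then show ?thesis unfolding Psi_map_def by (auto simp: covec_def[of A])
qed

section \<open>The admissible velocities in coordinates\<close>

context distribution_atlas
begin

abbreviation "TE \<equiv> tangent_atlas E"
abbreviation "D2 \<equiv> admissible_velocities Q E"

lemma smooth_TE: "smooth_atlas TE"
  by (rule smooth_tangent_atlas[OF smooth_E])

lemma D2_tangent:
  assumes "v \<in> D2"
  shows "fst v \<in> points E" "snd v \<in> tangent_space E (fst v)"
proof -
  obtain \<gamma> I where g: "v = (\<gamma> 0, velocity E \<gamma> 0)" "admissible Q E \<gamma> I" "0 \<in> I"
    using assms unfolding admissible_velocities_def by blast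
  then have s: "smooth_at euclidean_atlas E \<gamma> 0" by (simp add: admissible_def)
  show "fst v \<in> points E" using smooth_at_points(2)[OF s smooth_euclidean_atlas] g(1) by simp
  show "snd v \<in> tangent_space E (fst v)" using s g(1) by (auto simp: tangent_space_def)
qed

context
  fixes c and e :: "'k \<Rightarrow> 'a \<Rightarrow> 'a tvec"
  assumes ad: "adapted_chart Q D c e"
begin

abbreviation "dc \<equiv> dist_chart D c e"
abbreviation "T \<equiv> tangent_chart E (dist_chart D c e)"
abbreviation "K \<equiv> cotangent_chart E (dist_chart D c e)"
abbreviation "M \<equiv> cotangent_chart (tangent_atlas E) (tangent_chart E (dist_chart D c e))"

text \<open>The result lists the coordinates of TD as ((q, y), (qdot, ydot)), where qdot = \<rho>(q)
  y and ydot = z.\<close>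

definition emb :: "((real^'n) \<times> (real^'k)) \<times> (real^'k) \<Rightarrow> ((real^'n) \<times> (real^'k)) \<times> (real^'n) \<times> (real^'k)" where
  "emb z = (fst z, (anchor c e (fst (fst z)) (snd (fst z)), snd z))"

abbreviation "Z \<equiv> ((snd c ` fst c) \<times> (UNIV :: (real^'k) set)) \<times> (UNIV :: (real^'k) set)"

lemma dc_in_E: "dc \<in> E"
  by (rule dist_chart_in_E[OF ad])

lemma T_in_TE: "T \<in> TE"
  by (rule tangent_chart_in[OF dc_in_E])

lemma ch_T: "is_chart T"
  by (rule is_chart_tangent[OF smooth_E dc_in_E])

lemma T_image: "snd T ` fst T = ((snd c ` fst c) \<times> UNIV) \<times> UNIV"
  by (simp only: tangent_chart_image[OF smooth_E dc_in_E] dist_chart_image[OF ad])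

text \<open>Admissibility equates the point \<gamma>(0) of D with the velocity of the base curve; in
  the same chart the first has components \<rho>(q) y and the second dq/dt.\<close>

lemma admissible_velocity_coords:
  assumes "v \<in> fst T" "v \<in> D2"
  shows "fst (snd (snd T v)) = anchor c e (fst (fst (snd T v))) (snd (fst (snd T v)))"
proof -
  obtain \<gamma> I where g: "v = (\<gamma> 0, velocity E \<gamma> 0)" "admissible Q E \<gamma> I" "0 \<in> I"
    using assms(2) unfolding admissible_velocities_def by blast
  have g0: "\<gamma> 0 \<in> fst dc" using assms(1) g(1) by (simp add: fst_tangent_chart)
  have s: "smooth_at euclidean_atlas E \<gamma> 0" and adm: "\<gamma> 0 = (fst (\<gamma> 0), velocity Q (\<lambda>s. fst (\<gamma> s)) 0)"
    using g(2,3) unfolding admissible_def by blast+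
  obtain N where N: "open N" "0 \<in> N" "\<And>s. s \<in> N \<Longrightarrow> \<gamma> s \<in> fst dc" "smooth_on N (\<lambda>s. snd dc (\<gamma> s))"
    using smooth_at_curveE[OF s smooth_E dc_in_E g0] by metis
  define w where "w = vector_derivative (\<lambda>s. snd dc (\<gamma> s)) (at 0)"
  have d: "((\<lambda>s. snd dc (\<gamma> s)) has_vector_derivative w) (at 0)"
    unfolding w_def using smooth_on_imp_differentiable[OF N(4,2)] by (simp add: vector_derivative_works)
  have xs: "fst (\<gamma> s) \<in> fst c" "snd c (fst (\<gamma> s)) = fst (snd dc (\<gamma> s))"
    "\<gamma> s = (fst (\<gamma> s), frame_comb e (fst (\<gamma> s)) (snd (snd dc (\<gamma> s))))" if s: "s \<in> N" for s
  proof -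
    obtain x y where "x \<in> fst c" "\<gamma> s = (x, frame_comb e x y)"
      using N(3)[OF s] unfolding mem_dist_chart[OF ad] by blast
    then show "fst (\<gamma> s) \<in> fst c" "snd c (fst (\<gamma> s)) = fst (snd dc (\<gamma> s))"
      "\<gamma> s = (fst (\<gamma> s), frame_comb e (fst (\<gamma> s)) (snd (snd dc (\<gamma> s))))"
      by (simp_all add: dist_chart_frame[OF ad])
  qed
  have "((\<lambda>s. fst (snd dc (\<gamma> s))) has_vector_derivative fst w) (at 0)"
    by (rule bounded_linear.has_vector_derivative[OF bounded_linear_fst d])
  then have "((\<lambda>s. snd c (fst (\<gamma> s))) has_vector_derivative fst w) (at 0)"
    by (rule has_vector_derivative_transform_within_open[OF _ N(1,2)]) (simp add: xs(2))
  from velocity_eq_dvec[OF smooth_R c_in_R[OF ad] N(1,2) xs(1) this]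
  have "velocity Q (\<lambda>s. fst (\<gamma> s)) 0 = dvec R c (fst (\<gamma> 0)) (fst w)"
    by (simp add: velocity_max_atlas[OF Q])
  then have "dvec R c (fst (\<gamma> 0)) (fst w) = frame_comb e (fst (\<gamma> 0)) (snd (snd dc (\<gamma> 0)))"
    using adm xs(3)[OF N(2)] by (metis snd_conv)
  then have "fst w = anchor c e (fst (snd dc (\<gamma> 0))) (snd (snd dc (\<gamma> 0)))"
    unfolding frame_comb_eq[OF ad xs(1)[OF N(2)]] dvec_inject[OF smooth_R c_in_R[OF ad] xs(1)[OF N(2)]] xs(2)[OF N(2)] .
  moreover have "snd T v = (snd dc (\<gamma> 0), w)"
    using velocity_eq_dvec[OF smooth_E dc_in_E N(1,2,3) d] tangent_chart_dvec(2)[OF smooth_E dc_in_E g0] by (simp add: g(1))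
  ultimately show ?thesis by simp
qed

text \<open>The admissible curve through a given point with a given \<open>dy/dt\<close> is obtained by solving
  \<open>dq/dt = \<rho>(q) y\<close>, \<open>dy/dt = const\<close>.\<close>

lemma admissible_velocityI:
  assumes "q \<in> snd c ` fst c"
  shows "chart_inv T ((q, y), (anchor c e q y, z)) \<in> D2"
proof -
  define G where "G = (\<lambda>w :: (real^'n) \<times> (real^'k). (anchor c e (fst w) (snd w), z))"
  let ?S = "(snd c ` fst c) \<times> (UNIV :: (real^'k) set)"
  have S: "open ?S" by (intro open_Times open_c[OF ad] open_UNIV)
  have f1: "smooth_on ?S fst" and f2: "smooth_on ?S snd"
    by (intro smooth_on_linear bounded_linear_fst bounded_linear_snd)+
  have sub: "fst ` ?S \<subseteq> snd c ` fst c" by auto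
  have G: "smooth_on ?S G"
    unfolding G_def by (intro smooth_on_Pair S smooth_on_const smooth_on_anchor[OF ad S f1 sub f2])
  obtain \<epsilon> w where w: "\<epsilon> > 0" "w 0 = (q, y)" "\<And>t. \<bar>t\<bar> < \<epsilon> \<Longrightarrow> w t \<in> ?S"
    "\<And>t. \<bar>t\<bar> < \<epsilon> \<Longrightarrow> (w has_vector_derivative G (w t)) (at t)"
    using ode_local_solution[OF S G, of "(q, y)"] assms by auto
  define I where "I = {-\<epsilon><..<\<epsilon>}"
  have I: "open I" "0 \<in> I" "is_interval I" using w(1) by (auto simp: I_def is_interval_oo)
  have wI: "w t \<in> ?S" "(w has_vector_derivative G (w t)) (at t)" "fst (w t) \<in> snd c ` fst c" if "t \<in> I" for t
    using w(3,4)[of t] that by (auto simp: I_def mem_Times_iff)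
  have sw: "smooth_on I w" by (rule smooth_on_ode[OF I(1) S G wI(1,2)])
  define \<gamma> where "\<gamma> = (\<lambda>t. chart_inv dc (w t))"
  have dom: "w t \<in> snd dc ` fst dc" if "t \<in> I" for t
    using wI(1)[OF that] unfolding dist_chart_image[OF ad] .
  have g: "\<gamma> t \<in> fst dc" "snd dc (\<gamma> t) = w t" if "t \<in> I" for t
    unfolding \<gamma>_def by (rule chart_inv_in[OF dom[OF that]]) (rule chart_inv_right[OF dom[OF that]])
  have g_eq: "\<gamma> t = (chart_inv c (fst (w t)), frame_comb e (chart_inv c (fst (w t))) (snd (w t)))" if "t \<in> I" for t
    unfolding \<gamma>_def using dist_chart_inv[OF ad wI(3)[OF that], of "snd (w t)"] by simp
  have x: "fst (\<gamma> t) \<in> fst c" "snd c (fst (\<gamma> t)) = fst (w t)" if "t \<in> I" for t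
    using g_eq[OF that] chart_inv_in[OF wI(3)[OF that]] chart_inv_right[OF wI(3)[OF that]] by simp_all
  have "admissible Q E \<gamma> I"
    unfolding admissible_def
  proof (intro conjI ballI I)
    fix t assume t: "t \<in> I"
    show "smooth_at euclidean_atlas E \<gamma> t"
      by (rule smooth_at_curveI[OF dc_in_E I(1) t g(1) smooth_on_cong[OF sw I(1)]]) (simp_all add: g(2))
    have "((\<lambda>s. fst (w s)) has_vector_derivative anchor c e (fst (w t)) (snd (w t))) (at t)"
      using bounded_linear.has_vector_derivative[OF bounded_linear_fst wI(2)[OF t]] by (simp add: G_def)
    then have "((\<lambda>s. snd c (fst (\<gamma> s))) has_vector_derivative anchor c e (fst (w t)) (snd (w t))) (at t)"
      by (rule has_vector_derivative_transform_within_open[OF _ I(1) t]) (simp add: x(2))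
    from velocity_eq_dvec[OF smooth_R c_in_R[OF ad] I(1) t x(1) this]
    have "velocity Q (\<lambda>s. fst (\<gamma> s)) t = frame_comb e (fst (\<gamma> t)) (snd (w t))"
      unfolding frame_comb_eq[OF ad x(1)[OF t]] x(2)[OF t] by (simp add: velocity_max_atlas[OF Q])
    then show "\<gamma> t = (fst (\<gamma> t), velocity Q (\<lambda>s. fst (\<gamma> s)) t)" using g_eq[OF t] by simp
  qed
  then have "(\<gamma> 0, velocity E \<gamma> 0) \<in> D2" unfolding admissible_velocities_def using I(2) by blast
  moreover have "velocity E \<gamma> 0 = dvec E dc (\<gamma> 0) (anchor c e q y, z)"
  proof (rule velocity_eq_dvec[OF smooth_E dc_in_E I(1,2) g(1)])
    show "((\<lambda>s. snd dc (\<gamma> s)) has_vector_derivative (anchor c e q y, z)) (at 0)"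
      by (rule has_vector_derivative_transform_within_open[OF _ I(1,2)])
         (use wI(2)[OF I(2)] w(2) in \<open>simp_all add: g(2) G_def\<close>)
  qed
  moreover have "chart_inv T ((q, y), (anchor c e q y, z)) = (\<gamma> 0, dvec E dc (\<gamma> 0) (anchor c e q y, z))"
    using tangent_chart_inv[OF smooth_E dc_in_E dom[OF I(2)]] by (simp add: w(2) \<gamma>_def)
  ultimately show ?thesis by simp
qed

lemma open_Z: "open Z"
  by (intro open_Times open_c[OF ad] open_UNIV)

lemma emb_image: "z \<in> Z \<Longrightarrow> emb z \<in> snd T ` fst T"
  unfolding T_image emb_def by auto

lemma emb_admissible:
  assumes "z \<in> Z"
  shows "chart_inv T (emb z) \<in> D2" "chart_inv T (emb z) \<in> fst T" "snd T (chart_inv T (emb z)) = emb z"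
proof -
  have "fst (fst z) \<in> snd c ` fst c" using assms by auto
  from admissible_velocityI[OF this, of "snd (fst z)" "snd z"] show "chart_inv T (emb z) \<in> D2"
    by (simp add: emb_def)
  show "chart_inv T (emb z) \<in> fst T" "snd T (chart_inv T (emb z)) = emb z"
    by (rule chart_inv_in[OF emb_image[OF assms]], rule chart_inv_right[OF emb_image[OF assms]])
qed

text \<open>A left inverse of \<open>emb\<close>, defined on the whole chart by forgetting qdot.
  Being built from projections, it turns smooth curves into smooth parameter curves.\<close>

definition zc :: "'a tpoint tpoint \<Rightarrow> ((real^'n) \<times> (real^'k)) \<times> (real^'k)" where
  "zc v = (fst (snd T v), snd (snd (snd T v)))"

lemma zc_Z: "v \<in> fst T \<Longrightarrow> zc v \<in> Z"
  using imageI[of v "fst T" "snd T"] unfolding T_image by (simp add: zc_def mem_Times_iff)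

lemma emb_zc:
  assumes "v \<in> fst T" "v \<in> D2"
  shows "snd T v = emb (zc v)"
  using admissible_velocity_coords[OF assms] by (auto simp: emb_def zc_def prod_eq_iff)

lemma zc_emb: "z \<in> Z \<Longrightarrow> zc (chart_inv T (emb z)) = z"
  using emb_admissible(3)[of z] by (simp add: zc_def emb_def)

lemma smooth_on_emb: "smooth_on Z emb"
proof -
  have f: "smooth_on Z fst" "smooth_on Z snd"
    by (intro smooth_on_linear bounded_linear_fst bounded_linear_snd)+
  have sub: "(\<lambda>z. fst (fst z)) ` Z \<subseteq> snd c ` fst c" by auto
  show ?thesis
    unfolding emb_def[abs_def]
    by (intro smooth_on_Pair open_Z f smooth_on_anchor[OF ad open_Z _ sub] smooth_on_fst[OF open_Z] smooth_on_snd[OF open_Z])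
qed

lemma fd_emb:
  assumes "z \<in> Z"
  shows "fst (fd emb z \<delta>) = fst \<delta>" "snd (snd (fd emb z \<delta>)) = snd \<delta>"
proof -
  note d = smooth_on_imp_differentiable[OF smooth_on_emb assms]
  have "fd (\<lambda>z. fst (emb z)) z \<delta> = fst \<delta>"
    using fd_linear_eq[OF bounded_linear_fst] by (simp add: emb_def)
  then show "fst (fd emb z \<delta>) = fst \<delta>" by (simp only: fd_fst[OF d])
  have "fd (\<lambda>z. snd (snd (emb z))) z \<delta> = snd \<delta>"
    using fd_linear_eq[OF bounded_linear_snd] by (simp add: emb_def)
  moreover have "(\<lambda>z. snd (emb z)) differentiable (at z)"
    by (rule smooth_on_imp_differentiable[OF smooth_on_snd[OF open_Z smooth_on_emb] assms])
  ultimately show "snd (snd (fd emb z \<delta>)) = snd \<delta>" by (simp only: fd_snd[OF d] fd_snd)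
qed

lemma inj_fd_emb: "z \<in> Z \<Longrightarrow> fd emb z \<delta> = fd emb z \<delta>' \<Longrightarrow> \<delta> = \<delta>'"
  using fd_emb[of z \<delta>] fd_emb[of z \<delta>'] by (simp add: prod_eq_iff)

end

end

section \<open>The differential of the Lagrangian along the admissible velocities\<close>

locale lagrangian_system = distribution_atlas Q D E
  for Q :: "('a, real^'n::finite) atlas" and D :: "'a tpoint set"
    and E :: "('a tpoint, (real^'n) \<times> (real^'k::finite)) atlas" +
  fixes L :: "'a tpoint tpoint \<Rightarrow> real"
  assumes L: "smooth_map_on (tangent_atlas E) (admissible_velocities Q E) euclidean_atlas L"
begin

context
  fixes c and e :: "'k \<Rightarrow> 'a \<Rightarrow> 'a tvec"
  assumes ad: "adapted_chart Q D c e"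
begin

definition lp :: "((real^'n) \<times> (real^'k)) \<times> (real^'k) \<Rightarrow> real" where
  "lp z = L (chart_inv (T c e) (emb c e z))"

lemma local_lagrangian_lp: "local_lagrangian E D L c e q y z = lp ((q, y), z)"
  by (simp add: local_lagrangian_def lp_def emb_def[OF ad])

lemma lp_zc:
  assumes "v \<in> fst (T c e)" "v \<in> D2"
  shows "lp (zc c e v) = L v"
  unfolding lp_def emb_zc[OF ad assms, symmetric] by (simp add: chart_inv_left[OF ch_T[OF ad] assms(1)])

text \<open>\<open>L\<close> is only locally the restriction of smooth functions on TD. As
  \<open>emb\<close> takes values in the admissible velocities, \<open>lp\<close> agrees locally
  with such a function composed with \<open>emb\<close>.\<close>

lemma smooth_on_lp: "smooth_on (Z c) lp"
proof (rule smooth_on_local)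
  fix z assume z: "z \<in> Z c"
  let ?v = "chart_inv (T c e) (emb c e z)"
  note v = emb_admissible[OF ad z]
  obtain G W where W: "openin (atlas_topology TE) W" "?v \<in> W" and G: "smooth_at TE euclidean_atlas G ?v"
    and LG: "\<And>x. x \<in> D2 \<inter> W \<Longrightarrow> L x = G x"
    using bspec[OF L[unfolded smooth_map_on_def] v(1)] by (elim exE conjE) (rule that, assumption+, rule bspec)
  obtain N where N: "open N" "snd (T c e) ?v \<in> N" "N \<subseteq> snd (T c e) ` fst (T c e)"
    "smooth_on N (\<lambda>x. G (chart_inv (T c e) x))"
    by (rule smooth_at_realE[OF G smooth_TE T_in_TE[OF ad] v(2)]) (rule that)
  define N' where "N' = {z \<in> Z c. emb c e z \<in> N \<inter> snd (T c e) ` (W \<inter> fst (T c e))}"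
  have N': "open N'"
    unfolding N'_def
    by (intro open_preimage open_Z[OF ad] smooth_on_emb[OF ad] open_Int N openin_atlasD[OF smooth_TE W(1) T_in_TE[OF ad]])
  have "smooth_on N' lp"
  proof (rule smooth_on_cong[OF _ N'])
    show "smooth_on N' (\<lambda>z. G (chart_inv (T c e) (emb c e z)))"
      by (rule smooth_on_compose[OF N(4) smooth_on_subset[OF smooth_on_emb[OF ad]] N']) (auto simp: N'_def)
    show "G (chart_inv (T c e) (emb c e x)) = lp x" if x: "x \<in> N'" for x
    proof -
      obtain w where w: "w \<in> W" "w \<in> fst (T c e)" "emb c e x = snd (T c e) w"
        using x by (auto simp: N'_def)
      have "chart_inv (T c e) (emb c e x) = w" by (simp add: w(3) chart_inv_left[OF ch_T[OF ad] w(2)])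
      moreover have "chart_inv (T c e) (emb c e x) \<in> D2"
        by (rule emb_admissible(1)[OF ad]) (use x in \<open>simp add: N'_def\<close>)
      ultimately show ?thesis using LG[of w] w(1) by (simp add: lp_def)
    qed
  qed
  moreover have "z \<in> N'"
    using imageI[of ?v "W \<inter> fst (T c e)" "snd (T c e)"] N(2) z v W(2) by (simp add: N'_def)
  ultimately show "\<exists>T. open T \<and> z \<in> T \<and> smooth_on T lp" using N' by blast
qed

text \<open>Common core of the next two lemmas: along a curve with parameter \<zeta>, both the
  velocity and the rate of change of \<open>L\<close> depend on \<zeta>(0) and its derivative
  \<delta> alone.\<close>

lemma curve_derivatives:
  assumes N: "open N" "0 \<in> N" and \<gamma>: "\<And>s. s \<in> N \<Longrightarrow> \<gamma> s \<in> fst (T c e)"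
    and \<zeta>: "\<And>s. s \<in> N \<Longrightarrow> snd (T c e) (\<gamma> s) = emb c e (\<zeta> s)"
      "(\<zeta> has_vector_derivative \<delta>) (at 0)" "\<zeta> 0 \<in> Z c"
  shows "velocity TE \<gamma> 0 = dvec TE (T c e) (\<gamma> 0) (fd (emb c e) (\<zeta> 0) \<delta>)"
    and "deriv (\<lambda>t. L (\<gamma> t)) 0 = fd lp (\<zeta> 0) \<delta>"
proof -
  have chain: "((\<lambda>s. f (\<zeta> s)) has_vector_derivative fd f (\<zeta> 0) \<delta>) (at 0)"
    if f: "smooth_on (Z c) f" for f :: "_ \<Rightarrow> 'f::euclidean_space"
  proof -
    note d = smooth_on_imp_differentiable[OF f \<zeta>(3)]
    from has_derivative_compose[OF \<zeta>(2)[unfolded has_vector_derivative_def] fd_works[OF d]]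
    show ?thesis unfolding has_vector_derivative_def by (simp add: linear_cmul[OF linear_fd[OF d]])
  qed
  have d: "((\<lambda>s. snd (T c e) (\<gamma> s)) has_vector_derivative fd (emb c e) (\<zeta> 0) \<delta>) (at 0)"
    by (rule has_vector_derivative_transform_within_open[OF chain[OF smooth_on_emb[OF ad]] N]) (simp add: \<zeta>(1))
  show "velocity TE \<gamma> 0 = dvec TE (T c e) (\<gamma> 0) (fd (emb c e) (\<zeta> 0) \<delta>)"
    by (rule velocity_eq_dvec[OF smooth_TE T_in_TE[OF ad] N \<gamma> d])
  have "((\<lambda>s. L (\<gamma> s)) has_vector_derivative fd lp (\<zeta> 0) \<delta>) (at 0)"
  proof (rule has_vector_derivative_transform_within_open[OF chain[OF smooth_on_lp] N])
    show "lp (\<zeta> s) = L (\<gamma> s)" if "s \<in> N" for s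
      unfolding lp_def \<zeta>(1)[OF that, symmetric] by (simp add: chart_inv_left[OF ch_T[OF ad] \<gamma>[OF that]])
  qed
  then show "deriv (\<lambda>t. L (\<gamma> t)) 0 = fd lp (\<zeta> 0) \<delta>"
    by (simp add: DERIV_imp_deriv has_real_derivative_iff_has_vector_derivative)
qed

lemma curve_in_D2:
  assumes "curve_in TE D2 v \<gamma>" "v \<in> fst (T c e)"
  obtains \<delta> where "velocity TE \<gamma> 0 = dvec TE (T c e) v (fd (emb c e) (zc c e v) \<delta>)"
    "deriv (\<lambda>t. L (\<gamma> t)) 0 = fd lp (zc c e v) \<delta>"
proof -
  have s: "smooth_at euclidean_atlas TE \<gamma> 0" and g0: "\<gamma> 0 = v" and ev: "\<forall>\<^sub>F t in nhds 0. \<gamma> t \<in> D2"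
    using assms(1) by (auto simp: curve_in_def)
  obtain N where N: "open N" "0 \<in> N" "\<And>s. s \<in> N \<Longrightarrow> \<gamma> s \<in> fst (T c e)" "smooth_on N (\<lambda>s. snd (T c e) (\<gamma> s))"
    using smooth_at_curveE[OF s smooth_TE T_in_TE[OF ad]] assms(2) g0 by metis
  obtain N1 where N1: "open N1" "0 \<in> N1" "\<And>s. s \<in> N1 \<Longrightarrow> \<gamma> s \<in> D2"
    using ev unfolding eventually_nhds by blast
  define \<zeta> where "\<zeta> = (\<lambda>s. zc c e (\<gamma> s))"
  have "smooth_on N \<zeta>"
    unfolding \<zeta>_def zc_def[OF ad] by (intro smooth_on_Pair N smooth_on_fst smooth_on_snd)
  then have d: "(\<zeta> has_vector_derivative vector_derivative \<zeta> (at 0)) (at 0)"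
    using smooth_on_imp_differentiable[OF _ N(2)] by (simp add: vector_derivative_works[symmetric])
  have *: "velocity TE \<gamma> 0 = dvec TE (T c e) (\<gamma> 0) (fd (emb c e) (\<zeta> 0) (vector_derivative \<zeta> (at 0)))"
    "deriv (\<lambda>t. L (\<gamma> t)) 0 = fd lp (\<zeta> 0) (vector_derivative \<zeta> (at 0))"
    by (rule curve_derivatives[OF open_Int[OF N(1) N1(1)] IntI[OF N(2) N1(2)] _ _ d];
        use N(3) N1(3) emb_zc[OF ad] zc_Z[OF ad] assms(2) g0 in \<open>simp add: \<zeta>_def\<close>)+
  show ?thesis by (rule that) (use * g0 in \<open>simp_all add: \<zeta>_def\<close>)
qed

lemma straight_curve_in_D2:
  assumes "v \<in> fst (T c e)" "v \<in> D2"
  obtains \<gamma> where "curve_in TE D2 v \<gamma>"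
    "velocity TE \<gamma> 0 = dvec TE (T c e) v (fd (emb c e) (zc c e v) \<delta>)"
    "deriv (\<lambda>t. L (\<gamma> t)) 0 = fd lp (zc c e v) \<delta>"
proof -
  define \<zeta> where "\<zeta> = (\<lambda>t. zc c e v + t *\<^sub>R \<delta>)"
  define \<gamma> where "\<gamma> = (\<lambda>t. chart_inv (T c e) (emb c e (\<zeta> t)))"
  define N where "N = \<zeta> -` Z c"
  have \<zeta>0: "\<zeta> 0 = zc c e v" by (simp add: \<zeta>_def)
  have N: "open N" "0 \<in> N"
    unfolding N_def
    by (rule open_vimage[OF open_Z[OF ad]]) (use zc_Z[OF ad assms(1)] \<zeta>0 in \<open>auto simp: \<zeta>_def intro!: continuous_intros\<close>)
  have NZ: "\<zeta> s \<in> Z c" if "s \<in> N" for s using that by (simp add: N_def)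
  have s\<zeta>: "smooth_on N \<zeta>"
    unfolding \<zeta>_def by (intro smooth_on_add smooth_on_scaleR smooth_on_const smooth_on_ident N)
  have d: "(\<zeta> has_vector_derivative \<delta>) (at 0)" unfolding \<zeta>_def by (auto intro!: derivative_eq_intros)
  note g = emb_admissible[OF ad NZ, folded \<gamma>_def]
  have g0: "\<gamma> 0 = v"
    by (simp add: \<gamma>_def \<zeta>0 emb_zc[OF ad assms, symmetric] chart_inv_left[OF ch_T[OF ad] assms(1)])
  have sT: "snd (T c e) (\<gamma> s) = emb c e (\<zeta> s)" if "s \<in> N" for s unfolding \<gamma>_def by (rule emb_admissible(3)[OF ad NZ[OF that]])
  have gT: "\<gamma> s \<in> fst (T c e)" "\<gamma> s \<in> D2" if "s \<in> N" for s
    unfolding \<gamma>_def using emb_admissible(1,2)[OF ad NZ[OF that]] by simp_all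
  have "smooth_on N (\<lambda>s. emb c e (\<zeta> s))"
    by (rule smooth_on_compose[OF smooth_on_emb[OF ad] s\<zeta> N(1)]) (use NZ in blast)
  then have sg: "smooth_on N (\<lambda>s. snd (T c e) (\<gamma> s))"
    by (rule smooth_on_cong[OF _ N(1)]) (simp add: sT)
  have "smooth_at euclidean_atlas TE \<gamma> 0"
    by (rule smooth_at_curveI[OF T_in_TE[OF ad] N gT(1) sg])
  moreover have "\<forall>\<^sub>F t in nhds 0. \<gamma> t \<in> D2" unfolding eventually_nhds using N gT(2) by blast
  ultimately have "curve_in TE D2 v \<gamma>" using g0 by (simp add: curve_in_def)
  with curve_derivatives[OF N gT(1) sT d NZ[OF N(2)]] that show ?thesis by (simp add: g0 \<zeta>0)
qed

lemma sub_tangent_space_D2: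
  assumes "v \<in> fst (T c e)" "v \<in> D2"
  shows "sub_tangent_space TE D2 v = range (\<lambda>\<delta>. dvec TE (T c e) v (fd (emb c e) (zc c e v) \<delta>))"
proof (intro equalityI subsetI)
  fix w assume "w \<in> sub_tangent_space TE D2 v"
  then obtain \<gamma> where "curve_in TE D2 v \<gamma>" "w = velocity TE \<gamma> 0" unfolding sub_tangent_space_def by blast
  moreover from this(1) obtain \<delta> where
    "velocity TE \<gamma> 0 = dvec TE (T c e) v (fd (emb c e) (zc c e v) \<delta>)"
    by (rule curve_in_D2[OF _ assms(1)])
  ultimately show "w \<in> range (\<lambda>\<delta>. dvec TE (T c e) v (fd (emb c e) (zc c e v) \<delta>))" by simp
next
  fix w assume "w \<in> range (\<lambda>\<delta>. dvec TE (T c e) v (fd (emb c e) (zc c e v) \<delta>))"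
  then obtain \<delta> where "w = dvec TE (T c e) v (fd (emb c e) (zc c e v) \<delta>)" by blast
  moreover obtain \<gamma> where "curve_in TE D2 v \<gamma>"
    "velocity TE \<gamma> 0 = dvec TE (T c e) v (fd (emb c e) (zc c e v) \<delta>)"
    by (rule straight_curve_in_D2[OF assms, of \<delta>])
  ultimately show "w \<in> sub_tangent_space TE D2 v"
    unfolding sub_tangent_space_def by (intro CollectI exI[of _ \<gamma>]) simp
qed

text \<open>This justifies the definite description in \<open>sub_differential\<close>: a velocity
  determines its \<delta> because the derivative of \<open>emb\<close> is injective, so all curves
  with that velocity give the same derivative of \<open>L\<close>.\<close>

lemma sub_differential_D2:
  assumes "v \<in> fst (T c e)" "v \<in> D2"
  shows "sub_differential TE D2 L v (dvec TE (T c e) v (fd (emb c e) (zc c e v) \<delta>)) = fd lp (zc c e v) \<delta>"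
  unfolding sub_differential_def
proof (rule the_equality)
  let ?w = "dvec TE (T c e) v (fd (emb c e) (zc c e v) \<delta>)"
  obtain \<gamma> where "curve_in TE D2 v \<gamma>" "velocity TE \<gamma> 0 = ?w" "deriv (\<lambda>t. L (\<gamma> t)) 0 = fd lp (zc c e v) \<delta>"
    by (rule straight_curve_in_D2[OF assms])
  then show "\<exists>k. curve_in TE D2 v k \<and> velocity TE k 0 = ?w \<and> fd lp (zc c e v) \<delta> = deriv (\<lambda>t. L (k t)) 0"
    by (intro exI[of _ \<gamma>]) simp
  fix r assume "\<exists>k. curve_in TE D2 v k \<and> velocity TE k 0 = ?w \<and> r = deriv (\<lambda>t. L (k t)) 0"
  then obtain \<gamma> where g: "curve_in TE D2 v \<gamma>" "velocity TE \<gamma> 0 = ?w" "r = deriv (\<lambda>t. L (\<gamma> t)) 0" by blast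
  obtain \<delta>' where d': "velocity TE \<gamma> 0 = dvec TE (T c e) v (fd (emb c e) (zc c e v) \<delta>')"
    "deriv (\<lambda>t. L (\<gamma> t)) 0 = fd lp (zc c e v) \<delta>'"
    by (rule curve_in_D2[OF g(1) assms(1)])
  have "fd (emb c e) (zc c e v) \<delta>' = fd (emb c e) (zc c e v) \<delta>"
    using d'(1) g(2) dvec_inject[OF smooth_TE T_in_TE[OF ad] assms(1)] by metis
  then have "\<delta>' = \<delta>" by (rule inj_fd_emb[OF ad zc_Z[OF ad assms(1)]])
  with d'(2) g(3) show "r = fd lp (zc c e v) \<delta>" by simp
qed

lemma Sigma_L_iff:
  assumes "v \<in> fst (T c e)"
  shows "(v, covec TE (T c e) v \<mu>) \<in> Sigma_L Q E L \<longleftrightarrow>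
    v \<in> D2 \<and> (\<forall>\<delta>. \<mu> \<bullet> fd (emb c e) (zc c e v) \<delta> = fd lp (zc c e v) \<delta>)"
proof (cases "v \<in> D2")
  case True
  show ?thesis
    unfolding Sigma_L_def Let_def
    by (simp add: True sub_tangent_space_D2[OF assms True] covec_in_cotangent_space[OF smooth_TE T_in_TE[OF ad] assms]
        covec_dvec[OF smooth_TE T_in_TE[OF ad] assms] sub_differential_D2[OF assms True])
qed (simp add: Sigma_L_def Let_def)

lemma Sigma_L_in_M:
  assumes "m \<in> Sigma_L Q E L" "fst (fst m) \<in> fst (dc c e)"
  shows "m \<in> fst (M c e)" "fst m \<in> fst (T c e)" "fst m \<in> D2"
proof -
  obtain v \<mu> where m: "m = (v, \<mu>)" "v \<in> D2" "\<mu> \<in> cotangent_space TE v"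
    using assms(1) by (auto simp: Sigma_L_def Let_def)
  then have "v \<in> fst (T c e)"
    using D2_tangent(2)[OF m(2)] assms(2) by (cases v) (simp add: fst_tangent_chart)
  with m show "m \<in> fst (M c e)" "fst m \<in> fst (T c e)" "fst m \<in> D2" by (simp_all add: fst_cotangent_chart)
qed

lemma Psi_map_coords:
  assumes "m \<in> fst (M c e)"
  shows "Psi_map E m \<in> fst (K c e)"
    "snd (K c e) (Psi_map E m) = (fst (fst (snd (M c e) m)), snd (snd (snd (M c e) m)))"
    "fst (snd (M c e) m) = snd (T c e) (fst m)"
proof -
  obtain v \<mu> where v: "v \<in> fst (T c e)" "m = (v, covec TE (T c e) v \<mu>)"
    using assms unfolding mem_cotangent_chart[OF smooth_TE T_in_TE[OF ad]] by blast
  obtain p h where p: "p \<in> fst (dc c e)" "v = (p, dvec E (dc c e) p h)"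
    using v(1) unfolding mem_tangent_chart[OF smooth_E dc_in_E[OF ad]] by blast
  have Psi: "Psi_map E m = (p, covec E (dc c e) p (snd \<mu>))"
    unfolding v(2) p(2) by (rule Psi_map_covec[OF smooth_E dc_in_E[OF ad] p(1)])
  have M: "snd (M c e) m = (snd (T c e) v, \<mu>)"
    unfolding v(2) by (rule cotangent_chart_covec(2)[OF smooth_TE T_in_TE[OF ad] v(1)])
  show "Psi_map E m \<in> fst (K c e)"
    unfolding Psi by (rule cotangent_chart_covec(1)[OF smooth_E dc_in_E[OF ad] p(1)])
  show "snd (K c e) (Psi_map E m) = (fst (fst (snd (M c e) m)), snd (snd (snd (M c e) m)))"
    unfolding Psi M cotangent_chart_covec(2)[OF smooth_E dc_in_E[OF ad] p(1)]
    by (simp add: p(2) tangent_chart_dvec(2)[OF smooth_E dc_in_E[OF ad] p(1)])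
  show "fst (snd (M c e) m) = snd (T c e) (fst m)" unfolding M by (simp add: v(2))
qed

end

end

section \<open>Hamilton's equations in coordinates\<close>

lemma deriv_line: "f differentiable (at x) \<Longrightarrow> deriv (\<lambda>s. f (x + s *\<^sub>R v)) 0 = fd f x v"
proof -
  assume d: "f differentiable (at x)"
  have g: "((\<lambda>s. x + s *\<^sub>R v) has_derivative (\<lambda>s. s *\<^sub>R v)) (at 0)"
    by (auto intro!: derivative_eq_intros)
  have "(f has_derivative fd f x) (at (x + 0 *\<^sub>R v))" using fd_works[OF d] by simp
  from has_derivative_compose[OF g this]
  have "((\<lambda>s. f (x + s *\<^sub>R v)) has_field_derivative fd f x v) (at 0)"
    by (rule has_derivative_imp_has_field_derivative) (simp add: linear_cmul[OF linear_fd[OF d]])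
  then show ?thesis by (rule DERIV_imp_deriv)
qed

lemma partial_deriv_eq_fd: "f differentiable (at x) \<Longrightarrow> partial_deriv f x b = fd f x b"
  unfolding partial_deriv_def by (rule deriv_line)

text \<open>A line in one argument with the others frozen is a line in the product space, so a
  partial derivative in one slot is a value of the total derivative.\<close>

lemma partial_deriv_compose:
  assumes "f differentiable (at (g x))" "\<And>s. g (x + s *\<^sub>R b) = g x + s *\<^sub>R v"
  shows "partial_deriv (\<lambda>y. f (g y)) x b = fd f (g x) v"
  unfolding partial_deriv_def assms(2) by (rule deriv_line[OF assms(1)])

lemma has_vector_derivative_prod_iff:
  "(f has_vector_derivative v) (at t) \<longleftrightarrow>
    ((\<lambda>s. fst (f s)) has_vector_derivative fst v) (at t) \<and> ((\<lambda>s. snd (f s)) has_vector_derivative snd v) (at t)"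
proof
  assume "(f has_vector_derivative v) (at t)"
  then show "((\<lambda>s. fst (f s)) has_vector_derivative fst v) (at t) \<and> ((\<lambda>s. snd (f s)) has_vector_derivative snd v) (at t)"
    by (intro conjI bounded_linear.has_vector_derivative[OF bounded_linear_fst]
        bounded_linear.has_vector_derivative[OF bounded_linear_snd])
next
  assume "((\<lambda>s. fst (f s)) has_vector_derivative fst v) (at t) \<and> ((\<lambda>s. snd (f s)) has_vector_derivative snd v) (at t)"
  then have "((\<lambda>s. (fst (f s), snd (f s))) has_vector_derivative (fst v, snd v)) (at t)"
    by (intro has_vector_derivative_Pair) auto
  then show "(f has_vector_derivative v) (at t)" by simp
qed

lemma has_vector_derivative_vec_iff:
  fixes f :: "real \<Rightarrow> real^'n::finite"
  shows "(f has_vector_derivative v) (at t) \<longleftrightarrow> (\<forall>i. ((\<lambda>s. f s $ i) has_real_derivative v $ i) (at t))"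
proof -
  have "(f has_vector_derivative v) (at t) \<longleftrightarrow> (\<forall>i. ((\<lambda>s. f s \<bullet> axis i 1) has_derivative (\<lambda>h. (h *\<^sub>R v) \<bullet> axis i 1)) (at t))"
    unfolding has_vector_derivative_def
    by (subst has_derivative_componentwise_within) (auto simp: Basis_vec_def)
  also have "\<dots> \<longleftrightarrow> (\<forall>i. ((\<lambda>s. f s $ i) has_real_derivative v $ i) (at t))"
    by (simp add: has_real_derivative_iff_has_vector_derivative has_vector_derivative_def inner_axis)
  finally show ?thesis .
qed

lemma inner_axis_Pair:
  "u \<bullet> (axis i 1 :: real^'n::finite, 0 :: 'b::euclidean_space) = fst u $ i"
  "v \<bullet> (0 :: 'b, axis i 1 :: real^'n) = snd v $ i"
  by (simp_all add: inner_prod_def inner_axis)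

text \<open>The fibre derivative \<open>P = \<partial>l/\<partial>z\<close> has no \<open>p\<close>-dependence, so \<open>\<partial>\<^sup>2l/\<partial>z\<^sup>2\<close> annihilates
  \<open>\<partial>\<zeta>/\<partial>p\<close>; it is invertible because \<open>\<partial>\<^sup>2l/\<partial>z\<^sup>2 \<circ> \<partial>\<zeta>/\<partial>P = id\<close>.\<close>

lemma fibre_inverse_independent:
  fixes l :: "'w::euclidean_space \<times> 'z::euclidean_space \<Rightarrow> real" and \<zeta> :: "'w \<times> ('p::euclidean_space \<times> 'z) \<Rightarrow> 'z"
  assumes Z: "open Z" "smooth_on Z l" and S: "open S" "smooth_on S \<zeta>"
    and SZ: "\<And>x. x \<in> S \<Longrightarrow> (fst x, \<zeta> x) \<in> Z"
    and P: "\<And>x \<delta>. x \<in> S \<Longrightarrow> snd (snd x) \<bullet> \<delta> = fd l (fst x, \<zeta> x) (0, \<delta>)"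
    and x: "x \<in> S"
  shows "fd \<zeta> x (0, (\<delta>p, 0)) = 0"
proof -
  \<comment> \<open>The fibre derivative \<partial>l/\<partial>z as a vector-valued map; the linear
    map \<open>A\<close> below is the Hessian of l in z.\<close>
  define F where "F = (\<lambda>z. \<Sum>b\<in>Basis. fd l z (0, b) *\<^sub>R b)"
  have F: "smooth_on Z F"
    unfolding F_def using Z by (intro smooth_on_sum smooth_on_scaleR smooth_on_const smooth_on_fd_dir)
  have FP: "F (fst y, \<zeta> y) = snd (snd y)" if "y \<in> S" for y
    unfolding F_def P[OF that, symmetric] by (rule euclidean_representation)
  define z where "z = (fst x, \<zeta> x)"
  note dF = smooth_on_imp_differentiable[OF F SZ[OF x], folded z_def]
  note d\<zeta> = smooth_on_imp_differentiable[OF S(2) x]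
  have g: "smooth_on S (\<lambda>y. (fst y, \<zeta> y))"
    by (intro smooth_on_Pair S smooth_on_linear bounded_linear_fst)
  have dg: "fd (\<lambda>y. (fst y, \<zeta> y)) x h = (fst h, fd \<zeta> x h)" for h
    using fd_eq[OF has_derivative_Pair[OF bounded_linear_imp_has_derivative[OF bounded_linear_fst] fd_works[OF d\<zeta>]]]
    by simp
  have chain: "fd F z (fst h, fd \<zeta> x h) = snd (snd h)" for h
  proof -
    have bl: "bounded_linear (\<lambda>y :: 'w \<times> 'p \<times> 'z. snd (snd y))"
      by (intro bounded_linear_compose[OF bounded_linear_snd bounded_linear_snd])
    have "fd (\<lambda>y. F (fst y, \<zeta> y)) x h = fd (\<lambda>y. snd (snd y)) x h"
      using fd_cong_open[OF S(1) x FP bounded_linear_imp_differentiable[OF bl]] by simp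
    then show ?thesis
      using fd_comp[OF smooth_on_imp_differentiable[OF g x], of F h] dF
      by (simp add: dg fd_linear_eq[OF bl] z_def)
  qed
  define A where "A = (\<lambda>v. fd F z (0, v))"
  have linA: "linear A"
    unfolding A_def
    by (rule linearI) (use linear_add[OF linear_fd[OF dF], of "(0, _)" "(0, _)"]
        linear_cmul[OF linear_fd[OF dF], of _ "(0, _)"] in simp_all)
  have "A (fd \<zeta> x (0, (0, v))) = v" for v using chain[of "(0, (0, v))"] by (simp add: A_def)
  then have "surj A" by (rule surjI[of A])
  then have "inj A" by (rule linear_surj_imp_inj[OF linA])
  moreover have "A (fd \<zeta> x (0, (\<delta>p, 0))) = A 0"
    using chain[of "(0, (\<delta>p, 0))"] by (simp add: A_def linear_0[OF linA[unfolded A_def]])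
  ultimately show ?thesis by (rule injD)
qed

text \<open>In the derivative of \<open>P \<zeta> + p \<rho>(w) - l(w, \<zeta>)\<close> the terms containing \<open>d\<zeta>\<close> cancel.\<close>

lemma fd_legendre_transform:
  fixes l :: "'w::euclidean_space \<times> 'z::euclidean_space \<Rightarrow> real" and \<zeta> :: "'w \<times> ('p::euclidean_space \<times> 'z) \<Rightarrow> 'z"
    and r :: "'w \<Rightarrow> 'p"
  assumes l: "l differentiable (at (fst x, \<zeta> x))" and \<zeta>: "\<zeta> differentiable (at x)" and r: "r differentiable (at (fst x))"
    and P: "\<And>\<delta>. snd (snd x) \<bullet> \<delta> = fd l (fst x, \<zeta> x) (0, \<delta>)"
  shows "(\<lambda>x. snd (snd x) \<bullet> \<zeta> x + fst (snd x) \<bullet> r (fst x) - l (fst x, \<zeta> x)) differentiable (at x)"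
    and "fd (\<lambda>x. snd (snd x) \<bullet> \<zeta> x + fst (snd x) \<bullet> r (fst x) - l (fst x, \<zeta> x)) x h =
      snd (snd h) \<bullet> \<zeta> x + fst (snd h) \<bullet> r (fst x) + fst (snd x) \<bullet> fd r (fst x) (fst h) - fd l (fst x, \<zeta> x) (fst h, 0)"
proof -
  have f: "(fst has_derivative fst) (at x)" "((\<lambda>x. fst (snd x)) has_derivative (\<lambda>h. fst (snd h))) (at x)"
    "((\<lambda>x. snd (snd x)) has_derivative (\<lambda>h. snd (snd h))) (at x)"
    by (auto intro!: derivative_eq_intros)
  have l': "((\<lambda>x. l (fst x, \<zeta> x)) has_derivative (\<lambda>h. fd l (fst x, \<zeta> x) (fst h, fd \<zeta> x h))) (at x)"
    using has_derivative_compose[OF has_derivative_Pair[OF f(1) fd_works[OF \<zeta>]] fd_works[OF l]] .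
  have r': "((\<lambda>x. r (fst x)) has_derivative (\<lambda>h. fd r (fst x) (fst h))) (at x)"
    using has_derivative_compose[OF f(1) fd_works[OF r]] .
  note D = has_derivative_diff[OF has_derivative_add[OF has_derivative_inner[OF f(3) fd_works[OF \<zeta>]]
      has_derivative_inner[OF f(2) r']] l']
  show "(\<lambda>x. snd (snd x) \<bullet> \<zeta> x + fst (snd x) \<bullet> r (fst x) - l (fst x, \<zeta> x)) differentiable (at x)"
    using D by (rule differentiableI)
  have "fd l (fst x, \<zeta> x) (fst h, fd \<zeta> x h) = fd l (fst x, \<zeta> x) (fst h, 0) + snd (snd x) \<bullet> fd \<zeta> x h"
    using linear_add[OF linear_fd[OF l], of "(fst h, 0)" "(0, fd \<zeta> x h)"] by (simp add: P)
  then show "fd (\<lambda>x. snd (snd x) \<bullet> \<zeta> x + fst (snd x) \<bullet> r (fst x) - l (fst x, \<zeta> x)) x h =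
      snd (snd h) \<bullet> \<zeta> x + fst (snd h) \<bullet> r (fst x) + fst (snd x) \<bullet> fd r (fst x) (fst h) - fd l (fst x, \<zeta> x) (fst h, 0)"
    unfolding fd_eq[OF D] by simp
qed

lemma hamilton_equations_iff:
  fixes h :: "((real^'n::finite) \<times> (real^'k::finite)) \<times> (real^'n) \<times> (real^'k) \<Rightarrow> real"
  assumes "\<And>t. t \<in> I \<Longrightarrow> h differentiable (at (X t))"
  shows "(\<forall>t\<in>I. (X has_vector_derivative ham_vec h (X t)) (at t)) \<longleftrightarrow>
    hamilton_equations (\<lambda>q y p P. h ((q, y), (p, P))) I
      (\<lambda>t. fst (fst (X t))) (\<lambda>t. snd (fst (X t))) (\<lambda>t. fst (snd (X t))) (\<lambda>t. snd (snd (X t)))"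
  unfolding hamilton_equations_def
proof (rule ball_cong[OF refl])
  fix t assume t: "t \<in> I"
  note d = assms[OF t]
  obtain q y p P where X: "X t = ((q, y), (p, P))" by (metis prod.collapse)
  have pd: "partial_deriv (\<lambda>p'. h ((q, y), (p', P))) p b = fd h (X t) (0, (b, 0))"
    "partial_deriv (\<lambda>P'. h ((q, y), (p, P'))) P b' = fd h (X t) (0, (0, b'))"
    "partial_deriv (\<lambda>q'. h ((q', y), (p, P))) q b = fd h (X t) ((b, 0), 0)"
    "partial_deriv (\<lambda>y'. h ((q, y'), (p, P))) y b' = fd h (X t) ((0, b'), 0)" for b b'
    using partial_deriv_compose[of h "\<lambda>p'. ((q, y), (p', P))" p b "(0, (b, 0))"]
      partial_deriv_compose[of h "\<lambda>P'. ((q, y), (p, P'))" P b' "(0, (0, b'))"]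
      partial_deriv_compose[of h "\<lambda>q'. ((q', y), (p, P))" q b "((b, 0), 0)"]
      partial_deriv_compose[of h "\<lambda>y'. ((q, y'), (p, P))" y b' "((0, b'), 0)"] d
    by (simp_all add: X zero_prod_def)
  have hv: "fst (fst (ham_vec h (X t))) $ i = fd h (X t) (0, (axis i 1, 0))"
    "snd (fst (ham_vec h (X t))) $ A = fd h (X t) (0, (0, axis A 1))"
    "fst (snd (ham_vec h (X t))) $ i = - fd h (X t) ((axis i 1, 0), 0)"
    "snd (snd (ham_vec h (X t))) $ A = - fd h (X t) ((0, axis A 1), 0)" for i A
    using ham_vec_inner[OF d, of "(axis i 1, 0)"] ham_vec_inner[OF d, of "(0, axis A 1)"]
    by (simp_all add: inner_axis_Pair)
  show "(X has_vector_derivative ham_vec h (X t)) (at t) \<longleftrightarrow>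
    (\<forall>i. ((\<lambda>t. fst (fst (X t)) $ i) has_real_derivative
        partial_deriv (\<lambda>p'. h ((fst (fst (X t)), snd (fst (X t))), p', snd (snd (X t)))) (fst (snd (X t))) (axis i 1)) (at t)) \<and>
    (\<forall>A. ((\<lambda>t. snd (fst (X t)) $ A) has_real_derivative
        partial_deriv (\<lambda>P'. h ((fst (fst (X t)), snd (fst (X t))), fst (snd (X t)), P')) (snd (snd (X t))) (axis A 1)) (at t)) \<and>
    (\<forall>i. ((\<lambda>t. fst (snd (X t)) $ i) has_real_derivative
        - partial_deriv (\<lambda>q'. h ((q', snd (fst (X t))), fst (snd (X t)), snd (snd (X t)))) (fst (fst (X t))) (axis i 1)) (at t)) \<and>
    (\<forall>A. ((\<lambda>t. snd (snd (X t)) $ A) has_real_derivative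
        - partial_deriv (\<lambda>y'. h ((fst (fst (X t)), y'), fst (snd (X t)), snd (snd (X t)))) (snd (fst (X t))) (axis A 1)) (at t))"
    unfolding has_vector_derivative_prod_iff[of X] has_vector_derivative_prod_iff[of "\<lambda>s. fst (X s)"]
      has_vector_derivative_prod_iff[of "\<lambda>s. snd (X s)"] has_vector_derivative_vec_iff hv
    by (simp add: pd[unfolded X] X)
qed

text \<open>The two arguments are joined so that the anchor can be differentiated on the total space
  D, in q and y at once.\<close>

definition anchor_map :: "('a, real^'n::finite) chart \<Rightarrow> ('k::finite \<Rightarrow> 'a \<Rightarrow> 'a tvec) \<Rightarrow> (real^'n) \<times> (real^'k) \<Rightarrow> real^'n" where
  "anchor_map c e w = anchor c e (fst w) (snd w)"

lemma fd_inner_split: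
  fixes f :: "'a::euclidean_space \<times> 'b::euclidean_space \<Rightarrow> real"
  assumes "f differentiable (at x)"
  shows "fd f x (a, b) = fd f x (a, 0) + fd f x (0, b)"
  using linear_add[OF linear_fd[OF assms], of "(a, 0)" "(0, b)"] by simp

lemma linear_fd_slots:
  assumes "f differentiable (at x)"
  shows "linear (\<lambda>a. fd f x (a, 0))" "linear (\<lambda>b. fd f x (0, b))"
  by (rule linearI; use linear_add[OF linear_fd[OF assms], of "(_, 0)" "(_, 0)"] linear_cmul[OF linear_fd[OF assms], of _ "(_, 0)"]
      linear_add[OF linear_fd[OF assms], of "(0, _)" "(0, _)"] linear_cmul[OF linear_fd[OF assms], of _ "(0, _)"] in simp)+

section \<open>The local equations of the Lagrangian submanifold\<close>

context lagrangian_system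
begin

context
  fixes c and e :: "'k \<Rightarrow> 'a \<Rightarrow> 'a tvec"
  assumes ad: "adapted_chart Q D c e"
begin

abbreviation "W0 \<equiv> (snd c ` fst c) \<times> (UNIV :: (real^'k) set)"

lemma open_W0: "open W0"
  by (intro open_Times open_c[OF ad] open_UNIV)

lemma smooth_on_anchor_map: "smooth_on W0 (anchor_map c e)"
proof -
  have f: "smooth_on W0 fst" "smooth_on W0 snd"
    by (intro smooth_on_linear bounded_linear_fst bounded_linear_snd)+
  have sub: "fst ` W0 \<subseteq> snd c ` fst c" by auto
  show ?thesis unfolding anchor_map_def[abs_def] by (rule smooth_on_anchor[OF ad open_W0 f(1) sub f(2)])
qed

lemma rho_differentiable: "q \<in> snd c ` fst c \<Longrightarrow> rho c e A i differentiable (at q)"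
  by (rule smooth_on_imp_differentiable[OF smooth_on_rho[OF ad]])

lemma fd_anchor_map:
  assumes "w \<in> W0"
  shows "fd (anchor_map c e) w \<delta> $ j =
    (\<Sum>A\<in>UNIV. rho c e A j (fst w) * snd \<delta> $ A + fd (rho c e A j) (fst w) (fst \<delta>) * snd w $ A)"
proof -
  note d = smooth_on_imp_differentiable[OF smooth_on_anchor_map assms]
  have q: "fst w \<in> snd c ` fst c" using assms by auto
  have r: "((\<lambda>w. rho c e A j (fst w)) has_derivative (\<lambda>\<delta>. fd (rho c e A j) (fst w) (fst \<delta>))) (at w)" for A
    using has_derivative_compose[OF bounded_linear_imp_has_derivative[OF bounded_linear_fst] fd_works[OF rho_differentiable[OF q]]] .
  have y: "((\<lambda>w. snd w $ A) has_derivative (\<lambda>\<delta>. snd \<delta> $ A)) (at w)" for A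
    by (rule bounded_linear_imp_has_derivative[OF bounded_linear_compose[OF bounded_linear_vec_nth bounded_linear_snd]])
  have "((\<lambda>w. \<Sum>A\<in>UNIV. rho c e A j (fst w) * snd w $ A) has_derivative
     (\<lambda>\<delta>. \<Sum>A\<in>UNIV. rho c e A j (fst w) * snd \<delta> $ A + fd (rho c e A j) (fst w) (fst \<delta>) * snd w $ A)) (at w)"
    by (rule has_derivative_sum[OF has_derivative_mult[OF r y]])
  then have "fd (\<lambda>w. anchor_map c e w $ j) w \<delta> =
     (\<Sum>A\<in>UNIV. rho c e A j (fst w) * snd \<delta> $ A + fd (rho c e A j) (fst w) (fst \<delta>) * snd w $ A)"
    by (simp add: anchor_map_def fd_eq)
  then show ?thesis unfolding fd_linear_compose[OF bounded_linear_vec_nth d] .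
qed

lemma fd_emb_eq:
  assumes "z \<in> Z c"
  shows "fd (emb c e) z \<delta> = (fst \<delta>, (fd (anchor_map c e) (fst z) (fst \<delta>), snd \<delta>))"
proof -
  have w: "fst z \<in> W0" using assms by auto
  have a: "((\<lambda>z. anchor_map c e (fst z)) has_derivative (\<lambda>\<delta>. fd (anchor_map c e) (fst z) (fst \<delta>))) (at z)"
    using has_derivative_compose[OF bounded_linear_imp_has_derivative[OF bounded_linear_fst]
        smooth_on_has_derivative[OF smooth_on_anchor_map w]] .
  have "((\<lambda>z. (fst z, (anchor_map c e (fst z), snd z))) has_derivative
      (\<lambda>\<delta>. (fst \<delta>, (fd (anchor_map c e) (fst z) (fst \<delta>), snd \<delta>)))) (at z)"
    by (intro has_derivative_Pair a bounded_linear_imp_has_derivative bounded_linear_fst bounded_linear_snd)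
  moreover have "emb c e = (\<lambda>z. (fst z, (anchor_map c e (fst z), snd z)))"
    by (rule ext) (simp add: emb_def[OF ad] anchor_map_def)
  ultimately have "(emb c e has_derivative (\<lambda>\<delta>. (fst \<delta>, (fd (anchor_map c e) (fst z) (fst \<delta>), snd \<delta>)))) (at z)"
    by (simp only:)
  then show ?thesis by (simp only: fd_eq)
qed

lemma emb_eq: "emb c e z = (fst z, (anchor_map c e (fst z), snd z))"
  by (simp add: emb_def[OF ad] anchor_map_def)

lemma lp_differentiable: "z \<in> Z c \<Longrightarrow> lp c e differentiable (at z)"
  by (rule smooth_on_imp_differentiable[OF smooth_on_lp[OF ad]])

text \<open>All local equations of \<open>Sigma_L\<close> at once: taking \<delta> along q, y and z
  yields those for \<mu>_i, \<mu>_A and \<gamma>_A, and the derivative of the anchor supplies the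
  terms with \<gamma>_j.\<close>

lemma Sigma_L_coords:
  assumes "m \<in> fst (M c e)"
  shows "m \<in> Sigma_L Q E L \<longleftrightarrow> fst m \<in> D2 \<and>
    (\<forall>\<delta>. fst (snd (snd (M c e) m)) \<bullet> fst \<delta>
        + fst (snd (snd (snd (M c e) m))) \<bullet> fd (anchor_map c e) (fst (zc c e (fst m))) (fst \<delta>)
        + snd (snd (snd (snd (M c e) m))) \<bullet> snd \<delta> = fd (lp c e) (zc c e (fst m)) \<delta>)"
proof -
  obtain v \<mu> where v: "v \<in> fst (T c e)" "m = (v, covec TE (T c e) v \<mu>)"
    using assms unfolding mem_cotangent_chart[OF smooth_TE T_in_TE[OF ad]] by blast
  have "snd (M c e) m = (snd (T c e) v, \<mu>)"
    unfolding v(2) by (rule cotangent_chart_covec(2)[OF smooth_TE T_in_TE[OF ad] v(1)])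
  then show ?thesis
    using Sigma_L_iff[OF ad v(1), of \<mu>]
    by (simp add: v(2) fd_emb_eq[OF zc_Z[OF ad v(1)]] inner_prod_def add.assoc)
qed

text \<open>The function ydot belonging to the inverse \<open>s\<close>. A priori it depends on all
  of (q, y, p, P).\<close>

definition zeta :: "('a tpoint ctpoint \<Rightarrow> 'a tpoint tpoint ctpoint) \<Rightarrow>
    ((real^'n) \<times> (real^'k)) \<times> (real^'n) \<times> (real^'k) \<Rightarrow> real^'k" where
  "zeta s x = snd (zc c e (fst (s (chart_inv (K c e) x))))"

lemma K_in_CE: "K c e \<in> cotangent_atlas E"
  by (rule cotangent_chart_in[OF dc_in_E[OF ad]])

lemma M_in_CTE: "M c e \<in> cotangent_atlas TE"
  by (rule cotangent_chart_in[OF T_in_TE[OF ad]])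

lemma smooth_CE: "smooth_atlas (cotangent_atlas E)"
  by (rule smooth_cotangent_atlas[OF smooth_E])

lemma smooth_CTE: "smooth_atlas (cotangent_atlas TE)"
  by (rule smooth_cotangent_atlas[OF smooth_TE])

lemma ch_K: "is_chart (K c e)"
  by (rule is_chart_cotangent[OF smooth_E dc_in_E[OF ad]])

section \<open>A local inverse of the Legendre transform and its Hamiltonian\<close>

context
  fixes U and s :: "'a tpoint ctpoint \<Rightarrow> 'a tpoint tpoint ctpoint"
  assumes leg: "legendre_inverse Q E L U s"
begin

abbreviation "S \<equiv> snd (cotangent_chart E (dist_chart D c e)) ` (U \<inter> fst (cotangent_chart E (dist_chart D c e)))"

lemma open_U: "openin (atlas_topology (cotangent_atlas E)) U"
  using leg by (simp add: legendre_inverse_def)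

lemma open_S: "open S"
  by (rule openin_atlasD[OF smooth_CE open_U K_in_CE])

text \<open>The Legendre transform keeps the base point in D, so the chart around a also contains
  the base of \<open>s a\<close>. The coordinates (q, y) of both agree, and the covector a consists
  of the components of \<open>s a\<close> dual to velocities.\<close>

lemma legendre_inverse_coords:
  assumes a: "a \<in> U" "a \<in> fst (K c e)"
  shows "s a \<in> fst (M c e)" "fst (s a) \<in> fst (T c e)" "fst (s a) \<in> D2" "s a \<in> Sigma_L Q E L"
    "snd (K c e) a = (fst (zc c e (fst (s a))), snd (snd (snd (M c e) (s a))))"
    "snd (T c e) (fst (s a)) = emb c e (zc c e (fst (s a)))"
    "zeta s (snd (K c e) a) = snd (zc c e (fst (s a)))"
    "zc c e (fst (s a)) = (fst (snd (K c e) a), zeta s (snd (K c e) a))"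
proof -
  show Sig: "s a \<in> Sigma_L Q E L" using leg a(1) by (simp add: legendre_inverse_def)
  have Psi: "Psi_map E (s a) = a" using leg a(1) by (simp add: legendre_inverse_def)
  have "fst (fst (s a)) = fst (Psi_map E (s a))" by (simp add: Psi_map_def)
  moreover have "fst a \<in> fst (dc c e)" using a(2) by (cases a) (simp add: fst_cotangent_chart)
  ultimately have "fst (fst (s a)) \<in> fst (dc c e)" by (simp add: Psi)
  note m = Sigma_L_in_M[OF ad Sig this]
  show "s a \<in> fst (M c e)" "fst (s a) \<in> fst (T c e)" "fst (s a) \<in> D2" by (fact m)+
  show Ka: "snd (K c e) a = (fst (zc c e (fst (s a))), snd (snd (snd (M c e) (s a))))"
    using Psi_map_coords(2,3)[OF ad m(1)] by (simp add: Psi zc_def[OF ad])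
  show "zc c e (fst (s a)) = (fst (snd (K c e) a), zeta s (snd (K c e) a))"
    unfolding zeta_def chart_inv_left[OF ch_K a(2)] by (simp add: Ka)
  show "snd (T c e) (fst (s a)) = emb c e (zc c e (fst (s a)))" by (rule emb_zc[OF ad m(2,3)])
  show "zeta s (snd (K c e) a) = snd (zc c e (fst (s a)))"
    by (simp add: zeta_def chart_inv_left[OF ch_K a(2)])
qed

lemma S_E: assumes "x \<in> S" obtains a where "a \<in> U" "a \<in> fst (K c e)" "x = snd (K c e) a" "chart_inv (K c e) x = a"
  using assms chart_inv_left[OF ch_K] by blast

lemma S_Z: assumes x: "x \<in> S" shows "(fst x, zeta s x) \<in> Z c"
proof -
  obtain a where a: "a \<in> U" "a \<in> fst (K c e)" "x = snd (K c e) a" using x by blast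
  show ?thesis
    unfolding a(3) legendre_inverse_coords(8)[OF a(1,2), symmetric]
    by (rule zc_Z[OF ad legendre_inverse_coords(2)[OF a(1,2)]])
qed

text \<open>Varying z alone in the equations of \<open>Sigma_L\<close> removes the \<mu> term and
  the anchor term and leaves P = \<partial>l/\<partial>z.\<close>

lemma fibre_derivative:
  assumes x: "x \<in> S"
  shows "snd (snd x) \<bullet> \<delta> = fd (lp c e) (fst x, zeta s x) (0, \<delta>)"
proof -
  obtain a where a: "a \<in> U" "a \<in> fst (K c e)" "x = snd (K c e) a" using x by blast
  note lc = legendre_inverse_coords[OF a(1,2)]
  have w: "fst (zc c e (fst (s a))) \<in> W0" using zc_Z[OF ad lc(2)] by auto
  have "fd (anchor_map c e) (fst (zc c e (fst (s a)))) 0 = 0"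
    by (rule linear_0[OF linear_fd[OF smooth_on_imp_differentiable[OF smooth_on_anchor_map w]]])
  with iffD1[OF Sigma_L_coords[OF lc(1)] lc(4), THEN conjunct2, THEN spec, of "(0, \<delta>)"]
  have "snd (snd (snd (snd (M c e) (s a)))) \<bullet> \<delta> = fd (lp c e) (zc c e (fst (s a))) (0, \<delta>)"
    by simp
  moreover have "snd (snd x) = snd (snd (snd (snd (M c e) (s a))))" using lc(5) a(3) by simp
  ultimately show ?thesis using lc(8) a(3) by simp
qed

lemma smooth_on_zeta: "smooth_on S (zeta s)"
proof (rule smooth_on_local)
  fix x assume "x \<in> S"
  then obtain a where a: "a \<in> U" "a \<in> fst (K c e)" "x = snd (K c e) a" by blast
  have sm: "smooth_at (cotangent_atlas E) (cotangent_atlas TE) s a"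
    using leg a(1) by (simp add: legendre_inverse_def)
  obtain N where N: "open N" "snd (K c e) a \<in> N" "N \<subseteq> snd (K c e) ` fst (K c e)"
    "\<And>x. x \<in> N \<Longrightarrow> s (chart_inv (K c e) x) \<in> fst (M c e)" "smooth_on N (\<lambda>x. snd (M c e) (s (chart_inv (K c e) x)))"
    by (rule smooth_atE[OF sm smooth_CE smooth_CTE K_in_CE M_in_CTE a(2) legendre_inverse_coords(1)[OF a(1,2)]]) (rule that)
  have "smooth_on N (\<lambda>x. snd (snd (fst (snd (M c e) (s (chart_inv (K c e) x))))))"
    by (intro smooth_on_snd smooth_on_fst N)
  then have "smooth_on N (zeta s)"
    by (rule smooth_on_cong[OF _ N(1)]) (simp add: zeta_def zc_def[OF ad] Psi_map_coords(3)[OF ad N(4)])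
  with N(1,2) a(3) show "\<exists>T. open T \<and> x \<in> T \<and> smooth_on T (zeta s)" by blast
qed

text \<open>Admissibility fixes the qdot component of the velocity under \<open>s a\<close> to be
  \<rho>(q) y, so the pairing splits into p \<rho>(q) y + P \<zeta>.\<close>

lemma hamiltonian_coords:
  assumes a: "a \<in> U" "a \<in> fst (K c e)" and x: "x = snd (K c e) a"
  shows "hamiltonian L s a = snd (snd x) \<bullet> zeta s x + fst (snd x) \<bullet> anchor_map c e (fst x) - lp c e (fst x, zeta s x)"
proof -
  note lc = legendre_inverse_coords[OF a]
  obtain p \<eta> where p: "p \<in> fst (dc c e)" "a = (p, covec E (dc c e) p \<eta>)"
    using a(2) unfolding mem_cotangent_chart[OF smooth_E dc_in_E[OF ad]] by blast
  have K: "snd (K c e) a = (snd (dc c e) p, \<eta>)"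
    unfolding p(2) by (rule cotangent_chart_covec(2)[OF smooth_E dc_in_E[OF ad] p(1)])
  obtain p' h where p': "p' \<in> fst (dc c e)" "fst (s a) = (p', dvec E (dc c e) p' h)"
    using lc(2) unfolding mem_tangent_chart[OF smooth_E dc_in_E[OF ad]] by blast
  have Psi: "Psi_map E (s a) = a" using leg a(1) by (simp add: legendre_inverse_def)
  have "fst (fst (s a)) = fst (Psi_map E (s a))" by (simp add: Psi_map_def)
  then have "fst (fst (s a)) = fst a" unfolding Psi .
  moreover have "fst (fst (s a)) = p'" by (simp only: p'(2) fst_conv)
  moreover have "fst a = p" by (simp only: p(2) fst_conv)
  ultimately have [simp]: "p' = p" by simp
  have "(snd (dc c e) p, h) = emb c e (zc c e (fst (s a)))"
    using lc(6) tangent_chart_dvec(2)[OF smooth_E dc_in_E[OF ad] p(1), of h] p'(2) by simp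
  then have h: "h = (anchor_map c e (fst x), zeta s x)"
    using lc(8) by (simp add: emb_eq x)
  have "snd a (snd (fst (s a))) = \<eta> \<bullet> h"
    unfolding p'(2) by (simp add: p(2) covec_dvec[OF smooth_E dc_in_E[OF ad] p(1)])
  moreover have "L (fst (s a)) = lp c e (fst x, zeta s x)"
    using lp_zc[OF ad lc(2,3)] lc(8) x by simp
  moreover have "\<eta> = snd x" using K x by simp
  ultimately show ?thesis unfolding hamiltonian_def by (simp add: h inner_prod_def)
qed

abbreviation "h0 \<equiv> (\<lambda>x. hamiltonian L s (chart_inv (cotangent_chart E (dist_chart D c e)) x))"

lemma h0_eq:
  assumes "x \<in> S"
  shows "h0 x = snd (snd x) \<bullet> zeta s x + fst (snd x) \<bullet> anchor_map c e (fst x) - lp c e (fst x, zeta s x)"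
proof -
  obtain a where a: "a \<in> U" "a \<in> fst (K c e)" "x = snd (K c e) a" "chart_inv (K c e) x = a"
    using assms by (rule S_E)
  show ?thesis unfolding a(4) by (rule hamiltonian_coords[OF a(1-3)])
qed

lemma smooth_on_h0: "smooth_on S h0"
proof (rule smooth_on_cong[OF _ open_S h0_eq[symmetric]])
  have id: "smooth_on S (\<lambda>x. x)" by (rule smooth_on_ident)
  have fW: "fst ` S \<subseteq> W0"
  proof (rule image_subsetI)
    show "fst x \<in> W0" if "x \<in> S" for x using S_Z[OF that] by (simp add: mem_Times_iff)
  qed
  note i = smooth_on_fst[OF open_S id] smooth_on_snd[OF open_S id]
  show "smooth_on S (\<lambda>x. snd (snd x) \<bullet> zeta s x + fst (snd x) \<bullet> anchor_map c e (fst x) - lp c e (fst x, zeta s x))"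
    by (intro smooth_on_diff smooth_on_add smooth_on_inner open_S smooth_on_zeta smooth_on_fst[OF open_S i(2)]
        smooth_on_snd[OF open_S i(2)] smooth_on_compose[OF smooth_on_anchor_map i(1) open_S fW]
        smooth_on_compose[OF smooth_on_lp[OF ad] smooth_on_Pair[OF open_S i(1) smooth_on_zeta] open_S])
       (use S_Z in blast)
qed

lemma fd_h0:
  assumes x: "x \<in> S"
  shows "fd h0 x h = snd (snd h) \<bullet> zeta s x + fst (snd h) \<bullet> anchor_map c e (fst x)
    + fst (snd x) \<bullet> fd (anchor_map c e) (fst x) (fst h) - fd (lp c e) (fst x, zeta s x) (fst h, 0)"
proof -
  have w: "fst x \<in> W0" using S_Z[OF x] by auto
  note lt = fd_legendre_transform[OF lp_differentiable[OF S_Z[OF x]] smooth_on_imp_differentiable[OF smooth_on_zeta x]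
      smooth_on_imp_differentiable[OF smooth_on_anchor_map w] fibre_derivative[OF x]]
  show ?thesis
    unfolding lt(2)[symmetric] by (subst fd_cong_open[OF open_S x h0_eq lt(1)]) simp_all
qed

lemma partial_deriv_l:
  assumes "((q, y), z) \<in> Z c"
  shows "partial_deriv (\<lambda>q'. local_lagrangian E D L c e q' y z) q b = fd (lp c e) ((q, y), z) ((b, 0), 0)"
    "partial_deriv (\<lambda>y'. local_lagrangian E D L c e q y' z) y b' = fd (lp c e) ((q, y), z) ((0, b'), 0)"
    "partial_deriv (local_lagrangian E D L c e q y) z b' = fd (lp c e) ((q, y), z) (0, b')"
  unfolding local_lagrangian_lp[OF ad, abs_def]
  using partial_deriv_compose[of "lp c e" "\<lambda>q'. ((q', y), z)" q b "((b, 0), 0)"]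
    partial_deriv_compose[of "lp c e" "\<lambda>y'. ((q, y'), z)" y b' "((0, b'), 0)"]
    partial_deriv_compose[of "lp c e" "\<lambda>z'. ((q, y), z')" z b' "(0, b')"] lp_differentiable[OF assms]
  by (simp_all add: zero_prod_def)

text \<open>\<open>fd_h0\<close> evaluated along the coordinate directions. Since it contains no
  derivative of \<zeta>, the partial derivatives of the Lagrangian are those with ydot held fixed at
  z, although ydot varies with q and y.\<close>

lemma ham_vec_h0:
  assumes x: "((q, y), (p, P)) \<in> S" and z: "z = zeta s ((q, y), (p, P))"
  shows "fst (fst (ham_vec h0 ((q, y), (p, P)))) $ i = (\<Sum>A\<in>UNIV. rho c e A i q * y $ A)"
    "snd (fst (ham_vec h0 ((q, y), (p, P)))) $ A = z $ A"
    "fst (snd (ham_vec h0 ((q, y), (p, P)))) $ i = partial_deriv (\<lambda>q'. local_lagrangian E D L c e q' y z) q (axis i 1)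
      - (\<Sum>j\<in>UNIV. \<Sum>A\<in>UNIV. p $ j * partial_deriv (rho c e A j) q (axis i 1) * y $ A)"
    "snd (snd (ham_vec h0 ((q, y), (p, P)))) $ A = partial_deriv (\<lambda>y'. local_lagrangian E D L c e q y' z) y (axis A 1)
      - (\<Sum>j\<in>UNIV. p $ j * rho c e A j q)"
proof -
  let ?x = "((q, y), (p, P))"
  note d = smooth_on_imp_differentiable[OF smooth_on_h0 x]
  have Z: "((q, y), z) \<in> Z c" using S_Z[OF x] z by simp
  then have q: "q \<in> snd c ` fst c" and w: "(q, y) \<in> W0" by auto
  have lin0: "fd (lp c e) ((q, y), z) 0 = 0" "fd (anchor_map c e) (q, y) 0 = 0"
    by (rule linear_0[OF linear_fd[OF lp_differentiable[OF Z]]],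
        rule linear_0[OF linear_fd[OF smooth_on_imp_differentiable[OF smooth_on_anchor_map w]]])
  have f: "fd h0 ?x h = snd (snd h) \<bullet> z + fst (snd h) \<bullet> anchor_map c e (q, y)
    + p \<bullet> fd (anchor_map c e) (q, y) (fst h) - fd (lp c e) ((q, y), z) (fst h, 0)" for h
    using fd_h0[OF x] z by simp
  have hv: "fst (fst (ham_vec h0 ?x)) $ i = fd h0 ?x (0, (axis i 1, 0))"
    "snd (fst (ham_vec h0 ?x)) $ A = fd h0 ?x (0, (0, axis A 1))"
    "fst (snd (ham_vec h0 ?x)) $ i = - fd h0 ?x ((axis i 1, 0), 0)"
    "snd (snd (ham_vec h0 ?x)) $ A = - fd h0 ?x ((0, axis A 1), 0)"
    using ham_vec_inner[OF d, of "(axis i 1, 0)"] ham_vec_inner[OF d, of "(0, axis A 1)"]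
    by (simp_all add: inner_axis_Pair)
  have ax: "axis k 1 \<bullet> v = v $ k" for k and v :: "real^'m::finite"
    by (simp add: inner_commute[of "axis k 1"] inner_axis)
  show "fst (fst (ham_vec h0 ?x)) $ i = (\<Sum>A\<in>UNIV. rho c e A i q * y $ A)"
    unfolding hv f by (simp add: lin0 ax anchor_map_def flip: zero_prod_def)
  show "snd (fst (ham_vec h0 ?x)) $ A = z $ A"
    unfolding hv f by (simp add: lin0 ax flip: zero_prod_def)
  have "p \<bullet> fd (anchor_map c e) (q, y) (axis i 1, 0) =
      (\<Sum>j\<in>UNIV. \<Sum>A\<in>UNIV. p $ j * partial_deriv (rho c e A j) q (axis i 1) * y $ A)"
    by (simp add: inner_vec_def fd_anchor_map[OF w] partial_deriv_eq_fd[OF rho_differentiable[OF q]]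
        sum_distrib_left mult.assoc)
  then show "fst (snd (ham_vec h0 ?x)) $ i = partial_deriv (\<lambda>q'. local_lagrangian E D L c e q' y z) q (axis i 1)
      - (\<Sum>j\<in>UNIV. \<Sum>A\<in>UNIV. p $ j * partial_deriv (rho c e A j) q (axis i 1) * y $ A)"
    unfolding hv f partial_deriv_l[OF Z] by simp
  have "fd (rho c e B j) q 0 = 0" for B j by (rule linear_0[OF linear_fd[OF rho_differentiable[OF q]]])
  then have "p \<bullet> fd (anchor_map c e) (q, y) (0, axis A 1) = (\<Sum>j\<in>UNIV. p $ j * rho c e A j q)"
    by (simp add: inner_vec_def fd_anchor_map[OF w] axis_def if_distrib[of "\<lambda>x. _ * x"] cong: if_cong)
  then show "snd (snd (ham_vec h0 ?x)) $ A = partial_deriv (\<lambda>y'. local_lagrangian E D L c e q y' z) y (axis A 1)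
      - (\<Sum>j\<in>UNIV. p $ j * rho c e A j q)"
    unfolding hv f partial_deriv_l[OF Z] by simp
qed

lemma ham_vec_iff_explicit:
  assumes X: "\<And>t. t \<in> I \<Longrightarrow> X t \<in> S"
  shows "(\<forall>t\<in>I. (X has_vector_derivative ham_vec h0 (X t)) (at t)) \<longleftrightarrow>
    explicit_equations (rho c e) (local_lagrangian E D L c e) I
      (\<lambda>t. fst (fst (X t))) (\<lambda>t. snd (fst (X t))) (\<lambda>t. fst (snd (X t))) (\<lambda>t. snd (snd (X t))) (\<lambda>t. zeta s (X t))"
  unfolding explicit_equations_def
proof (rule ball_cong[OF refl])
  fix t assume t: "t \<in> I"
  have x: "((fst (fst (X t)), snd (fst (X t))), (fst (snd (X t)), snd (snd (X t)))) \<in> S" using X[OF t] by simp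
  note hv = ham_vec_h0[OF x refl, unfolded prod.collapse]
  show "(X has_vector_derivative ham_vec h0 (X t)) (at t) \<longleftrightarrow>
    (\<forall>i. ((\<lambda>t. fst (fst (X t)) $ i) has_real_derivative (\<Sum>A\<in>UNIV. rho c e A i (fst (fst (X t))) * snd (fst (X t)) $ A)) (at t)) \<and>
    (\<forall>A. ((\<lambda>t. snd (fst (X t)) $ A) has_real_derivative zeta s (X t) $ A) (at t)) \<and>
    (\<forall>i. ((\<lambda>t. fst (snd (X t)) $ i) has_real_derivative
        partial_deriv (\<lambda>q'. local_lagrangian E D L c e q' (snd (fst (X t))) (zeta s (X t))) (fst (fst (X t))) (axis i 1)
        - (\<Sum>j\<in>UNIV. \<Sum>A\<in>UNIV. fst (snd (X t)) $ j * partial_deriv (rho c e A j) (fst (fst (X t))) (axis i 1) * snd (fst (X t)) $ A)) (at t)) \<and>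
    (\<forall>A. ((\<lambda>t. snd (snd (X t)) $ A) has_real_derivative
        partial_deriv (\<lambda>y'. local_lagrangian E D L c e (fst (fst (X t))) y' (zeta s (X t))) (snd (fst (X t))) (axis A 1)
        - (\<Sum>j\<in>UNIV. fst (snd (X t)) $ j * rho c e A j (fst (fst (X t))))) (at t))"
    unfolding has_vector_derivative_prod_iff[of X] has_vector_derivative_prod_iff[of "\<lambda>s. fst (X s)"]
      has_vector_derivative_prod_iff[of "\<lambda>s. snd (X s)"] has_vector_derivative_vec_iff hv
    by blast
qed

end

end

end

section \<open>Explicit equations and constrained Euler-Lagrange equations\<close>

lemma explicit_equations_cong:
  assumes "open I" "\<And>t. t \<in> I \<Longrightarrow> q t = q' t \<and> y t = y' t \<and> p t = p' t \<and> P t = P' t \<and> z t = z' t"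
    and "explicit_equations r l I q y p P z"
  shows "explicit_equations r l I q' y' p' P' z'"
  unfolding explicit_equations_def
proof (intro ballI conjI allI)
  fix t assume t: "t \<in> I"
  note eq = assms(2)[OF t, THEN conjunct1] assms(2)[OF t, THEN conjunct2, THEN conjunct1]
    assms(2)[OF t, THEN conjunct2, THEN conjunct2, THEN conjunct1]
    assms(2)[OF t, THEN conjunct2, THEN conjunct2, THEN conjunct2, THEN conjunct1]
    assms(2)[OF t, THEN conjunct2, THEN conjunct2, THEN conjunct2, THEN conjunct2]
  note e = assms(3)[unfolded explicit_equations_def, rule_format, OF t]
  note tr = has_field_derivative_transform_within_open[OF _ assms(1) t]
  show "((\<lambda>t. q' t $ i) has_real_derivative (\<Sum>A\<in>UNIV. r A i (q' t) * y' t $ A)) (at t)" for i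
    by (rule tr[of "\<lambda>t. q t $ i"]) (use e[THEN conjunct1] assms(2) in \<open>simp_all add: eq\<close>)
  show "((\<lambda>t. y' t $ A) has_real_derivative z' t $ A) (at t)" for A
    by (rule tr[of "\<lambda>t. y t $ A"]) (use e[THEN conjunct2, THEN conjunct1] assms(2) in \<open>simp_all add: eq\<close>)
  show "((\<lambda>t. p' t $ i) has_real_derivative
        partial_deriv (\<lambda>q'. l q' (y' t) (z' t)) (q' t) (axis i 1)
        - (\<Sum>j\<in>UNIV. \<Sum>A\<in>UNIV. p' t $ j * partial_deriv (r A j) (q' t) (axis i 1) * y' t $ A)) (at t)" for i
    by (rule tr[of "\<lambda>t. p t $ i"])
       (use e[THEN conjunct2, THEN conjunct2, THEN conjunct1] assms(2) in \<open>simp_all add: eq\<close>)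
  show "((\<lambda>t. P' t $ A) has_real_derivative
        partial_deriv (\<lambda>y'. l (q' t) y' (z' t)) (y' t) (axis A 1)
        - (\<Sum>j\<in>UNIV. p' t $ j * r A j (q' t))) (at t)" for A
    by (rule tr[of "\<lambda>t. P t $ A"])
       (use e[THEN conjunct2, THEN conjunct2, THEN conjunct2] assms(2) in \<open>simp_all add: eq\<close>)
qed

text \<open>The Euler-Lagrange momentum is \<partial>l/\<partial>z at the velocity of y, whereas P
  is taken at z. Once that velocity equals z throughout the open I, the two functions of time
  coincide there and have equal derivatives. The right-hand side has to record this equality,
  because the value of P need not determine z.\<close>

lemma explicit_equations_iff_euler_lagrange:
  assumes I: "open I" and P: "\<And>t A. t \<in> I \<Longrightarrow> P t $ A = partial_deriv (l (q t) (y t)) (z t) (axis A 1)"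
  shows "explicit_equations r l I q y p P z \<longleftrightarrow> constrained_euler_lagrange r l I q y p \<and>
    (\<forall>t\<in>I. vector_derivative y (at t) = z t \<and>
       (\<forall>A. P t $ A = partial_deriv (l (q t) (y t)) (vector_derivative y (at t)) (axis A 1)))"
    (is "?L \<longleftrightarrow> ?C \<and> ?R")
proof -
  let ?yd = "\<lambda>t. vector_derivative y (at t)"
  have l_yd: "((\<lambda>t. partial_deriv (\<lambda>z'. l (q t) (y t) z') (?yd t) (axis A 1)) has_real_derivative d) (at t) \<longleftrightarrow>
      ((\<lambda>t. P t $ A) has_real_derivative d) (at t)"
    if yd: "\<And>t. t \<in> I \<Longrightarrow> ?yd t = z t" and t: "t \<in> I" for t d A
  proof -
    have "partial_deriv (\<lambda>z'. l (q s) (y s) z') (?yd s) (axis A 1) = P s $ A" if "s \<in> I" for s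
      using P[OF that] yd[OF that] by simp
    then show ?thesis
      using has_field_derivative_transform_within_open[OF _ I t, of "\<lambda>t. partial_deriv (\<lambda>z'. l (q t) (y t) z') (?yd t) (axis A 1)" d "\<lambda>t. P t $ A"]
        has_field_derivative_transform_within_open[OF _ I t, of "\<lambda>t. P t $ A" d "\<lambda>t. partial_deriv (\<lambda>z'. l (q t) (y t) z') (?yd t) (axis A 1)"]
      by (intro iffI) simp_all
  qed
  show ?thesis
  proof
    assume e: ?L
    have yz: "(y has_vector_derivative z t) (at t)" if "t \<in> I" for t
      using e that unfolding has_vector_derivative_vec_iff explicit_equations_def by blast
    have yd: "?yd t = z t" if "t \<in> I" for t by (rule vector_derivative_at[OF yz[OF that]])
    have ?C
      unfolding constrained_euler_lagrange_def Let_def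
    proof (intro ballI conjI allI)
      fix t assume t: "t \<in> I"
      note et = e[unfolded explicit_equations_def, rule_format, OF t]
      show "y differentiable at t" using yz[OF t] by (rule differentiableI_vector)
      show "((\<lambda>t. q t $ i) has_real_derivative (\<Sum>A\<in>UNIV. r A i (q t) * y t $ A)) (at t)" for i
        using et by blast
      have p: "((\<lambda>t. p t $ i) has_real_derivative
        partial_deriv (\<lambda>q'. l q' (y t) (z t)) (q t) (axis i 1)
        - (\<Sum>j\<in>UNIV. \<Sum>A\<in>UNIV. p t $ j * partial_deriv (r A j) (q t) (axis i 1) * y t $ A)) (at t)" for i
        using et by blast
      show "(\<lambda>t. p t $ i) differentiable (at t)" for i
        using p[of i] real_differentiable_def by blast
      show "deriv (\<lambda>t. p t $ i) t - partial_deriv (\<lambda>q'. l q' (y t) (?yd t)) (q t) (axis i 1)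
          + (\<Sum>j\<in>UNIV. \<Sum>A\<in>UNIV. p t $ j * partial_deriv (r A j) (q t) (axis i 1) * y t $ A) = 0" for i
        by (simp add: DERIV_imp_deriv[OF p] yd[OF t])
      have "((\<lambda>t. P t $ A) has_real_derivative
        partial_deriv (\<lambda>y'. l (q t) y' (z t)) (y t) (axis A 1) - (\<Sum>j\<in>UNIV. p t $ j * r A j (q t))) (at t)" for A
        using et by blast
      then have Pd: "((\<lambda>t. partial_deriv (\<lambda>z'. l (q t) (y t) z') (?yd t) (axis A 1)) has_real_derivative
        partial_deriv (\<lambda>y'. l (q t) y' (z t)) (y t) (axis A 1) - (\<Sum>j\<in>UNIV. p t $ j * r A j (q t))) (at t)" for A
        by (simp only: l_yd[OF yd t])
      show "(\<lambda>t. partial_deriv (\<lambda>z'. l (q t) (y t) z') (?yd t) (axis A 1)) differentiable (at t)" for A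
        using Pd[of A] real_differentiable_def by blast
      show "deriv (\<lambda>t. partial_deriv (\<lambda>z'. l (q t) (y t) z') (?yd t) (axis A 1)) t
          - partial_deriv (\<lambda>y'. l (q t) y' (?yd t)) (y t) (axis A 1) + (\<Sum>i\<in>UNIV. r A i (q t) * p t $ i) = 0" for A
        by (simp add: DERIV_imp_deriv[OF Pd] yd[OF t] mult.commute)
    qed
    moreover have ?R using yd P by simp
    ultimately show "?C \<and> ?R" ..
  next
    assume CR: "?C \<and> ?R"
    then have yd: "?yd t = z t" if "t \<in> I" for t using that by blast
    show ?L
      unfolding explicit_equations_def
    proof (intro ballI conjI allI)
      fix t assume t: "t \<in> I"
      note ct = CR[THEN conjunct1, unfolded constrained_euler_lagrange_def Let_def, rule_format, OF t]
      show "((\<lambda>t. q t $ i) has_real_derivative (\<Sum>A\<in>UNIV. r A i (q t) * y t $ A)) (at t)" for i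
        using ct by blast
      have "y differentiable (at t)" using ct by blast
      then have "(y has_vector_derivative z t) (at t)"
        using yd[OF t] vector_derivative_works by metis
      then show "((\<lambda>t. y t $ A) has_real_derivative z t $ A) (at t)" for A
        unfolding has_vector_derivative_vec_iff by blast
      show "((\<lambda>t. p t $ i) has_real_derivative
        partial_deriv (\<lambda>q'. l q' (y t) (z t)) (q t) (axis i 1)
        - (\<Sum>j\<in>UNIV. \<Sum>A\<in>UNIV. p t $ j * partial_deriv (r A j) (q t) (axis i 1) * y t $ A)) (at t)" for i
      proof -
        have "(\<lambda>t. p t $ i) differentiable (at t)" using ct by blast
        then have "((\<lambda>t. p t $ i) has_real_derivative deriv (\<lambda>t. p t $ i) t) (at t)"
          by (simp add: DERIV_deriv_iff_real_differentiable)
        moreover have "deriv (\<lambda>t. p t $ i) t - partial_deriv (\<lambda>q'. l q' (y t) (z t)) (q t) (axis i 1)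
          + (\<Sum>j\<in>UNIV. \<Sum>A\<in>UNIV. p t $ j * partial_deriv (r A j) (q t) (axis i 1) * y t $ A) = 0"
          using ct unfolding yd[OF t] by blast
        then have "deriv (\<lambda>t. p t $ i) t = partial_deriv (\<lambda>q'. l q' (y t) (z t)) (q t) (axis i 1)
          - (\<Sum>j\<in>UNIV. \<Sum>A\<in>UNIV. p t $ j * partial_deriv (r A j) (q t) (axis i 1) * y t $ A)"
          by linarith
        ultimately show ?thesis by simp
      qed
      show "((\<lambda>t. P t $ A) has_real_derivative
        partial_deriv (\<lambda>y'. l (q t) y' (z t)) (y t) (axis A 1) - (\<Sum>j\<in>UNIV. p t $ j * r A j (q t))) (at t)" for A
      proof -
        let ?g = "\<lambda>t. partial_deriv (\<lambda>z'. l (q t) (y t) z') (?yd t) (axis A 1)"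
        have "?g differentiable (at t)" using ct by blast
        then have g: "(?g has_real_derivative deriv ?g t) (at t)"
          by (simp add: DERIV_deriv_iff_real_differentiable)
        have "deriv ?g t - partial_deriv (\<lambda>y'. l (q t) y' (?yd t)) (y t) (axis A 1)
          + (\<Sum>i\<in>UNIV. r A i (q t) * p t $ i) = 0"
          using ct by blast
        then have "deriv ?g t = partial_deriv (\<lambda>y'. l (q t) y' (z t)) (y t) (axis A 1) - (\<Sum>j\<in>UNIV. p t $ j * r A j (q t))"
          unfolding yd[OF t] by (simp add: mult.commute algebra_simps eq_diff_eq)
        with g show ?thesis using l_yd[OF yd t] by simp
      qed
    qed
  qed
qed

text \<open>\<open>smooth_map_on\<close> describes the inverse only as locally equal, on its domain,
  to a smooth G. As that domain is open, the equality holds on a neighbourhood and the inverse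
  itself is smooth.\<close>

lemma legendre_inverse_exists:
  assumes C: "smooth_atlas C" and B: "smooth_atlas B"
    and ld: "local_diffeo_on C S B F" and x: "x \<in> S"
  obtains W s where "openin (atlas_topology C) W" "x \<in> W" "openin (atlas_topology B) (F ` (S \<inter> W))"
    "\<And>a. a \<in> F ` (S \<inter> W) \<Longrightarrow> s a \<in> S \<and> F (s a) = a \<and> smooth_at B C s a"
    "\<And>w. w \<in> S \<inter> W \<Longrightarrow> s (F w) = w"
proof -
  obtain W where W: "openin (atlas_topology C) W" "x \<in> W" "inj_on F (S \<inter> W)"
    "openin (atlas_topology B) (F ` (S \<inter> W))" "smooth_map_on B (F ` (S \<inter> W)) C (inv_into (S \<inter> W) F)"
    using bspec[OF ld[unfolded local_diffeo_on_def] x] by (elim exE conjE) (rule that)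
  let ?s = "inv_into (S \<inter> W) F"
  show ?thesis
  proof (rule that[of W ?s, OF W(1,2,4)])
    fix a assume a: "a \<in> F ` (S \<inter> W)"
    obtain G V where V: "openin (atlas_topology B) V" "a \<in> V" "smooth_at B C G a"
      "\<forall>x\<in>F ` (S \<inter> W) \<inter> V. ?s x = G x"
      using bspec[OF W(5)[unfolded smooth_map_on_def] a] by (elim exE conjE) (rule that)
    have "smooth_at B C ?s a"
      by (rule smooth_at_cong[OF V(3) B openin_Int[OF W(4) V(1)]]) (use a V(2,4) in auto)
    moreover have "?s a \<in> S" using inv_into_into[OF a] by simp
    moreover have "F (?s a) = a" by (rule f_inv_into_f[OF a])
    ultimately show "?s a \<in> S \<and> F (?s a) = a \<and> smooth_at B C ?s a" by simp
  next
    show "?s (F w) = w" if "w \<in> S \<inter> W" for w by (rule inv_into_f_f[OF W(3) that])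
  qed
qed

lemma fd_zero_imp_const:
  fixes f :: "'e::euclidean_space \<Rightarrow> 'f::euclidean_space"
  assumes "convex B" "\<And>x. x \<in> B \<Longrightarrow> (f has_derivative (\<lambda>h. 0)) (at x)" "x \<in> B" "y \<in> B"
  shows "f x = f y"
proof -
  have "\<exists>c. \<forall>x\<in>B. f x = c"
    by (rule has_derivative_zero_constant[OF assms(1)]) (rule has_derivative_at_withinI[OF assms(2)])
  then show ?thesis using assms(3,4) by metis
qed

section \<open>Properties of the Hamiltonian and of ydot as a function of (q, y, P)\<close>

context lagrangian_system
begin

context
  fixes U and s :: "'a tpoint ctpoint \<Rightarrow> 'a tpoint tpoint ctpoint"
  assumes leg: "legendre_inverse Q E L U s"
begin

lemma smooth_at_hamiltonian:
  assumes a: "a \<in> U"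
  shows "smooth_at (cotangent_atlas E) euclidean_atlas (hamiltonian L s) a"
proof -
  have "smooth_at (cotangent_atlas E) (cotangent_atlas TE) s a"
    using leg a by (simp add: legendre_inverse_def)
  note ap = smooth_at_points(1)[OF this smooth_cotangent_atlas[OF smooth_E]]
  obtain K' where K': "K' \<in> cotangent_atlas E" "a \<in> fst K'" using ap by (rule pointsE)
  obtain b where b: "b \<in> E" "K' = cotangent_chart E b" using K'(1) by (rule cotangent_atlasE)
  obtain c e where ad: "adapted_chart Q D c e" and bc: "b = dist_chart D c e" using b(1) by (rule dist_atlasE)
  have aK: "a \<in> fst (K c e)" using K'(2) b(2) bc by simp
  show ?thesis
  proof (rule smooth_at_realI[OF K_in_CE[OF ad] aK open_S[OF ad leg] _ _ smooth_on_h0[OF ad leg]])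
    show "snd (K c e) a \<in> snd (K c e) ` (U \<inter> fst (K c e))" using a aK by blast
  qed blast
qed

lemma hamiltonian_vector_ex1_U:
  assumes a: "a \<in> U"
  shows "\<exists>!Y. is_hamiltonian_vector E (hamiltonian L s) a Y"
  by (rule hamiltonian_vector_ex1[OF smooth_E smooth_at_points(1)[OF _ smooth_cotangent_atlas[OF smooth_E]]];
      rule smooth_at_hamiltonian[OF a])

lemma hamiltonian_flow_preserves_U:
  assumes "is_flow (cotangent_atlas E) (hamiltonian_field E (hamiltonian L s)) U \<Omega> F"
  shows "flow_preserves (cotangent_atlas E) \<Omega> F (canonical_symplectic E)"
  by (rule hamiltonian_flow_preserves[OF smooth_E _ smooth_at_hamiltonian assms])
     (use leg in \<open>simp_all add: legendre_inverse_def\<close>)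

context
  fixes c and e :: "'k \<Rightarrow> 'a \<Rightarrow> 'a tvec"
  assumes ad: "adapted_chart Q D c e"
begin

lemma integral_curve_iff_ham_vec:
  assumes I: "open I" "is_interval I" and x: "x ` I \<subseteq> U \<inter> fst (K c e)"
  shows "integral_curve (cotangent_atlas E) (hamiltonian_field E (hamiltonian L s)) I x \<longleftrightarrow>
    (\<forall>t\<in>I. ((\<lambda>t. snd (K c e) (x t)) has_vector_derivative ham_vec (h0 c e s) (snd (K c e) (x t))) (at t))"
proof -
  have x': "x t \<in> U" "x t \<in> fst (K c e)" if "t \<in> I" for t using x that by auto
  have "openin (atlas_topology (cotangent_atlas E)) U" using leg by (simp add: legendre_inverse_def)
  from integral_curve_iff[OF smooth_E dc_in_E[OF ad] this smooth_at_hamiltonian I x'] show ?thesis .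
qed

lemma coordinate_relations:
  assumes a: "a \<in> U \<inter> fst (K c e)"
  shows "snd (T c e) (fst (s a)) = (fst (snd (K c e) a),
      anchor c e (fst (fst (snd (K c e) a))) (snd (fst (snd (K c e) a))), snd (snd (snd (T c e) (fst (s a)))))"
    "snd (snd (snd (M c e) (s a))) = snd (snd (K c e) a)"
    "snd (snd (snd (K c e) a)) $ A = partial_deriv
      (local_lagrangian E D L c e (fst (fst (snd (K c e) a))) (snd (fst (snd (K c e) a))))
      (snd (snd (snd (T c e) (fst (s a))))) (axis A 1)"
    "snd (snd (snd (T c e) (fst (s a)))) = zeta c e s (snd (K c e) a)"
proof -
  have aU: "a \<in> U" "a \<in> fst (K c e)" using a by auto
  note lc = legendre_inverse_coords[OF ad leg aU]
  have T: "snd (T c e) (fst (s a)) = (fst (snd (K c e) a), (anchor_map c e (fst (snd (K c e) a)), zeta c e s (snd (K c e) a)))"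
    unfolding lc(6) unfolding lc(8) by (simp add: emb_eq[OF ad])
  then show z: "snd (snd (snd (T c e) (fst (s a)))) = zeta c e s (snd (K c e) a)" by simp
  show "snd (T c e) (fst (s a)) = (fst (snd (K c e) a),
      anchor c e (fst (fst (snd (K c e) a))) (snd (fst (snd (K c e) a))), snd (snd (snd (T c e) (fst (s a)))))"
    unfolding z unfolding T anchor_map_def ..
  show "snd (snd (snd (M c e) (s a))) = snd (snd (K c e) a)" by (simp add: lc(5))
  have S: "snd (K c e) a \<in> snd (K c e) ` (U \<inter> fst (K c e))" using aU by blast
  have Z: "((fst (fst (snd (K c e) a)), snd (fst (snd (K c e) a))), zeta c e s (snd (K c e) a)) \<in> Z c"
    using S_Z[OF ad leg S] by simp
  show "snd (snd (snd (K c e) a)) $ A = partial_deriv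
      (local_lagrangian E D L c e (fst (fst (snd (K c e) a))) (snd (fst (snd (K c e) a))))
      (snd (snd (snd (T c e) (fst (s a))))) (axis A 1)"
    unfolding z partial_deriv_l(3)[OF ad leg Z]
    using fibre_derivative[OF ad leg S, of "axis A 1"] by (simp add: inner_axis)
qed

text \<open>The p-derivative of \<open>zeta\<close> vanishes, but its domain may be disconnected in
  p. On a product neighbourhood whose p-factor is a ball, p can be frozen at the value p0 of the
  given point.\<close>

lemma velocity_function:
  assumes a0: "a0 \<in> U \<inter> fst (K c e)"
  obtains V N and Y :: "((real^'n) \<times> (real^'k)) \<times> (real^'k) \<Rightarrow> real^'k" where
    "openin (atlas_topology (cotangent_atlas E)) V" "a0 \<in> V" "V \<subseteq> U \<inter> fst (K c e)" "open N" "smooth_on N Y"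
    "\<And>a. a \<in> V \<Longrightarrow> (fst (snd (K c e) a), snd (snd (snd (K c e) a))) \<in> N \<and>
       zeta c e s (snd (K c e) a) = Y (fst (snd (K c e) a), snd (snd (snd (K c e) a)))"
proof -
  let ?S = "snd (K c e) ` (U \<inter> fst (K c e))"
  note op = open_S[OF ad leg]
  have \<zeta>: "smooth_on ?S (zeta c e s)" by (rule smooth_on_zeta[OF ad leg])
  obtain w0 p0 P0 where x0: "snd (K c e) a0 = (w0, (p0, P0))" by (metis prod.collapse)
  have "(w0, (p0, P0)) \<in> ?S" using a0 x0 by (metis image_eqI)
  from open_prod_elim[OF op this] obtain A1 B1 where AB: "open A1" "open B1" "w0 \<in> A1" "(p0, P0) \<in> B1" "A1 \<times> B1 \<subseteq> ?S"
    by (metis SigmaE2)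
  from open_prod_elim[OF AB(2,4)] obtain A2 A3 where A23: "open A2" "open A3" "p0 \<in> A2" "P0 \<in> A3" "A2 \<times> A3 \<subseteq> B1"
    by (metis SigmaE2)
  obtain r where r: "r > 0" "ball p0 r \<subseteq> A2" using A23(1,3) open_contains_ball by blast
  have inS: "(w, (p, P)) \<in> ?S" if "w \<in> A1" "p \<in> ball p0 r" "P \<in> A3" for w p P
  proof -
    have "(p, P) \<in> B1" using A23(5) r(2) that(2,3) by (meson SigmaI subsetD)
    then show ?thesis using AB(5) that(1) by (meson SigmaI subsetD)
  qed
  define N where "N = A1 \<times> A3"
  define Y where "Y = (\<lambda>wP. zeta c e s (fst wP, (p0, snd wP)))"
  define V' where "V' = A1 \<times> (ball p0 r \<times> A3)"
  have N: "open N" unfolding N_def by (rule open_Times[OF AB(1) A23(2)])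
  have fs: "smooth_on N fst" "smooth_on N snd"
    by (intro smooth_on_linear bounded_linear_fst bounded_linear_snd)+
  have p0: "p0 \<in> ball p0 r" using r(1) by simp
  have Y: "smooth_on N Y"
    unfolding Y_def
  proof (rule smooth_on_compose[OF \<zeta> smooth_on_Pair[OF N fs(1) smooth_on_Pair[OF N smooth_on_const fs(2)]] N])
    show "(\<lambda>x. (fst x, p0, snd x)) ` N \<subseteq> ?S"
      using inS[OF _ p0] by (auto simp: N_def)
  qed
  have indep: "zeta c e s (w, (p, P)) = zeta c e s (w, (p0, P))" if w: "w \<in> A1" and p: "p \<in> ball p0 r" and P: "P \<in> A3" for w p P
  proof (rule fd_zero_imp_const[OF convex_ball _ p p0])
    fix p' assume p': "p' \<in> ball p0 r"
    note x = inS[OF w p' P]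
    have g: "((\<lambda>p. (w, (p, P))) has_derivative (\<lambda>h. (0, (h, 0)))) (at p')"
      by (auto intro!: derivative_eq_intros)
    have "fd (zeta c e s) (w, (p', P)) (0, (h, 0)) = 0" for h
      by (rule fibre_inverse_independent[OF open_Z[OF ad] smooth_on_lp[OF ad] op \<zeta> S_Z[OF ad leg] fibre_derivative[OF ad leg] x])
    then show "((\<lambda>p. zeta c e s (w, (p, P))) has_derivative (\<lambda>h. 0)) (at p')"
      using has_derivative_compose[OF g smooth_on_has_derivative[OF \<zeta> x]] by simp
  qed
  have V'S: "V' \<subseteq> ?S" using inS by (auto simp: V'_def)
  have V': "open V'" unfolding V'_def by (intro open_Times AB(1) A23(2) open_ball)
  define V where "V = chart_inv (K c e) ` V'"
  have Vm: "a \<in> U \<and> a \<in> fst (K c e) \<and> snd (K c e) a \<in> V'" if aV: "a \<in> V" for a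
  proof -
    obtain x where x: "x \<in> V'" "a = chart_inv (K c e) x" using aV by (auto simp: V_def)
    have "x \<in> ?S" using x(1) V'S by blast
    then obtain b where "b \<in> U" "b \<in> fst (K c e)" "x = snd (K c e) b" by blast
    then show ?thesis using x by (simp add: chart_inv_left[OF ch_K[OF ad]])
  qed
  show ?thesis
  proof (rule that[of V N Y])
    show "openin (atlas_topology (cotangent_atlas E)) V"
      unfolding V_def by (rule openin_chart_inv_image[OF smooth_CE[OF ad] K_in_CE[OF ad] V']) (use V'S in blast)
    have "snd (K c e) a0 \<in> V'" using x0 AB(3) A23(4) p0 by (simp add: V'_def)
    then show "a0 \<in> V" unfolding V_def using a0 chart_inv_left[OF ch_K[OF ad], of a0] by (metis IntD2 image_eqI)
    show "V \<subseteq> U \<inter> fst (K c e)" using Vm by blast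
    show "open N" "smooth_on N Y" by (fact N Y)+
    fix a assume "a \<in> V"
    then have "snd (K c e) a \<in> V'" using Vm by blast
    then obtain w p P where x: "snd (K c e) a = (w, (p, P))" "w \<in> A1" "p \<in> ball p0 r" "P \<in> A3"
      by (auto simp: V'_def)
    then show "(fst (snd (K c e) a), snd (snd (snd (K c e) a))) \<in> N \<and>
       zeta c e s (snd (K c e) a) = Y (fst (snd (K c e) a), snd (snd (snd (K c e) a)))"
      using indep[OF x(2-4)] by (simp add: N_def Y_def)
  qed
qed

end

end

end

section \<open>From constrained Euler-Lagrange curves to Hamiltonian curves\<close>

lemma constrained_euler_lagrange_subset:
  "constrained_euler_lagrange r l I q y lam \<Longrightarrow> J \<subseteq> I \<Longrightarrow> constrained_euler_lagrange r l J q y lam"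
  unfolding constrained_euler_lagrange_def Let_def by (meson subsetD)

text \<open>The equations contain derivatives of q, y and lam, which makes these continuous;
  continuity of the derivative of y is not obtained in this way and appears as a separate
  assumption.\<close>

lemma constrained_euler_lagrange_continuous:
  assumes "constrained_euler_lagrange r l I q y lam"
  shows "continuous_on I q" "continuous_on I y" "continuous_on I lam"
proof -
  note e = assms[unfolded constrained_euler_lagrange_def Let_def, rule_format]
  have "(q has_vector_derivative (\<chi> i. \<Sum>A\<in>UNIV. r A i (q t) * y t $ A)) (at t)" if "t \<in> I" for t
    using e[OF that] unfolding has_vector_derivative_vec_iff by simp
  then show "continuous_on I q"
    by (intro continuous_at_imp_continuous_on ballI) (rule has_vector_derivative_continuous)
  have "y differentiable (at t)" if "t \<in> I" for t using e[OF that] by blast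
  then show "continuous_on I y"
    by (intro continuous_at_imp_continuous_on ballI differentiable_imp_continuous_within)
  have "(\<lambda>t. lam t $ i) differentiable (at t)" if "t \<in> I" for t i using e[OF that] by blast
  then have "(lam has_vector_derivative (\<chi> i. deriv (\<lambda>t. lam t $ i) t)) (at t)" if "t \<in> I" for t
    unfolding has_vector_derivative_vec_iff using that by (simp add: DERIV_deriv_iff_real_differentiable)
  then show "continuous_on I lam"
    by (intro continuous_at_imp_continuous_on ballI) (rule has_vector_derivative_continuous)
qed

context lagrangian_system
begin

text \<open>Besides inverting the Legendre transform from the right, s recovers the points of
  \<open>Sigma_L\<close> in W. This is what shows that s follows a curve lifted to
  \<open>Sigma_L\<close> rather than another branch.\<close>

lemma legendre_local_inverse:
  assumes reg: "regular_system Q E L" and \<sigma>: "\<sigma> \<in> Sigma_L Q E L"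
  obtains W s where "openin (atlas_topology (cotangent_atlas TE)) W" "\<sigma> \<in> W"
    "legendre_inverse Q E L (Psi_map E ` (Sigma_L Q E L \<inter> W)) s"
    "\<And>\<tau>. \<tau> \<in> Sigma_L Q E L \<inter> W \<Longrightarrow> s (Psi_map E \<tau>) = \<tau>"
proof -
  obtain W s where W: "openin (atlas_topology (cotangent_atlas TE)) W" "\<sigma> \<in> W"
      "openin (atlas_topology (cotangent_atlas E)) (Psi_map E ` (Sigma_L Q E L \<inter> W))"
    and s: "\<And>a. a \<in> Psi_map E ` (Sigma_L Q E L \<inter> W) \<Longrightarrow>
        s a \<in> Sigma_L Q E L \<and> Psi_map E (s a) = a \<and> smooth_at (cotangent_atlas E) (cotangent_atlas TE) s a"
      "\<And>\<tau>. \<tau> \<in> Sigma_L Q E L \<inter> W \<Longrightarrow> s (Psi_map E \<tau>) = \<tau>"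
    by (rule legendre_inverse_exists[OF smooth_cotangent_atlas[OF smooth_TE] smooth_cotangent_atlas[OF smooth_E]
          reg[unfolded regular_system_def] \<sigma>]) (rule that)
  have "legendre_inverse Q E L (Psi_map E ` (Sigma_L Q E L \<inter> W)) s"
    unfolding legendre_inverse_def using W(3) s(1) by blast
  from that[OF W(1,2) this s(2)] show ?thesis .
qed

context
  fixes c and e :: "'k \<Rightarrow> 'a \<Rightarrow> 'a tvec"
  assumes ad: "adapted_chart Q D c e"
begin

lemma equations_of_motion:
  assumes leg: "legendre_inverse Q E L U s"
    and I: "open I" "is_interval I" and x: "x ` I \<subseteq> U \<inter> fst (K c e)"
  defines "q \<equiv> \<lambda>t. fst (fst (snd (K c e) (x t)))" and "y \<equiv> \<lambda>t. snd (fst (snd (K c e) (x t)))"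
    and "p \<equiv> \<lambda>t. fst (snd (snd (K c e) (x t)))" and "P \<equiv> \<lambda>t. snd (snd (snd (K c e) (x t)))"
    and "z \<equiv> \<lambda>t. snd (snd (snd (T c e) (fst (s (x t)))))"
  shows "integral_curve (cotangent_atlas E) (hamiltonian_field E (hamiltonian L s)) I x \<longleftrightarrow>
      hamilton_equations (\<lambda>q y p P. hamiltonian L s (chart_inv (K c e) ((q, y), (p, P)))) I q y p P"
    "hamilton_equations (\<lambda>q y p P. hamiltonian L s (chart_inv (K c e) ((q, y), (p, P)))) I q y p P \<longleftrightarrow>
      explicit_equations (rho c e) (local_lagrangian E D L c e) I q y p P z"
    "integral_curve (cotangent_atlas E) (hamiltonian_field E (hamiltonian L s)) I x \<longleftrightarrow>
      constrained_euler_lagrange (rho c e) (local_lagrangian E D L c e) I q y p \<and>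
      (\<forall>t\<in>I. vector_derivative y (at t) = z t \<and> (\<forall>A. P t $ A =
         partial_deriv (local_lagrangian E D L c e (q t) (y t)) (vector_derivative y (at t)) (axis A 1)))"
proof -
  let ?S = "snd (K c e) ` (U \<inter> fst (K c e))" and ?X = "\<lambda>t. snd (K c e) (x t)"
  have X: "?X t \<in> ?S" if "t \<in> I" for t using x that by blast
  note int = integral_curve_iff_ham_vec[OF leg ad I x]
  have ham: "(\<forall>t\<in>I. (?X has_vector_derivative ham_vec (h0 c e s) (?X t)) (at t)) \<longleftrightarrow>
    hamilton_equations (\<lambda>q y p P. h0 c e s ((q, y), (p, P))) I q y p P"
    unfolding q_def y_def p_def P_def
    by (rule hamilton_equations_iff) (rule smooth_on_imp_differentiable[OF smooth_on_h0[OF ad leg] X])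
  have expl: "(\<forall>t\<in>I. (?X has_vector_derivative ham_vec (h0 c e s) (?X t)) (at t)) \<longleftrightarrow>
    explicit_equations (rho c e) (local_lagrangian E D L c e) I q y p P (\<lambda>t. zeta c e s (?X t))"
    unfolding q_def y_def p_def P_def by (rule ham_vec_iff_explicit[OF ad leg]) (rule X)
  show 1: "integral_curve (cotangent_atlas E) (hamiltonian_field E (hamiltonian L s)) I x \<longleftrightarrow>
      hamilton_equations (\<lambda>q y p P. hamiltonian L s (chart_inv (K c e) ((q, y), (p, P)))) I q y p P"
    unfolding int by (rule ham)
  have z: "zeta c e s (?X t) = z t" if "t \<in> I" for t
  proof -
    have "x t \<in> U \<inter> fst (K c e)" using x that by blast
    from coordinate_relations(4)[OF leg ad this] show ?thesis by (simp add: z_def)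
  qed
  have "explicit_equations (rho c e) (local_lagrangian E D L c e) I q y p P (\<lambda>t. zeta c e s (?X t)) \<longleftrightarrow>
    explicit_equations (rho c e) (local_lagrangian E D L c e) I q y p P z"
    by (rule iffI; erule explicit_equations_cong[OF I(1), rotated]) (simp_all add: z)
  then show 2: "hamilton_equations (\<lambda>q y p P. hamiltonian L s (chart_inv (K c e) ((q, y), (p, P)))) I q y p P \<longleftrightarrow>
      explicit_equations (rho c e) (local_lagrangian E D L c e) I q y p P z"
    unfolding ham[symmetric] expl .
  show "integral_curve (cotangent_atlas E) (hamiltonian_field E (hamiltonian L s)) I x \<longleftrightarrow>
      constrained_euler_lagrange (rho c e) (local_lagrangian E D L c e) I q y p \<and>
      (\<forall>t\<in>I. vector_derivative y (at t) = z t \<and> (\<forall>A. P t $ A =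
         partial_deriv (local_lagrangian E D L c e (q t) (y t)) (vector_derivative y (at t)) (axis A 1)))"
    unfolding 1 2
  proof (rule explicit_equations_iff_euler_lagrange[OF I(1)])
    fix t A assume "t \<in> I"
    then show "P t $ A = partial_deriv (local_lagrangian E D L c e (q t) (y t)) (z t) (axis A 1)"
      unfolding q_def y_def P_def z_def using coordinate_relations(3)[OF leg ad, of "x t"] x by blast
  qed
qed

lemma coordinate_relations_U:
  assumes leg: "legendre_inverse Q E L U s"
  shows "\<forall>a\<in>U \<inter> fst (K c e).
      snd (T c e) (fst (s a)) = ((fst (fst (snd (K c e) a)), snd (fst (snd (K c e) a))),
        (anchor c e (fst (fst (snd (K c e) a))) (snd (fst (snd (K c e) a))), snd (snd (snd (T c e) (fst (s a)))))) \<and>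
      snd (snd (snd (M c e) (s a))) = (fst (snd (snd (K c e) a)), snd (snd (snd (K c e) a))) \<and>
      (\<forall>A. snd (snd (snd (K c e) a)) $ A = partial_deriv
        (local_lagrangian E D L c e (fst (fst (snd (K c e) a))) (snd (fst (snd (K c e) a))))
        (snd (snd (snd (T c e) (fst (s a))))) (axis A 1))"
proof (intro ballI conjI allI)
  fix a assume a: "a \<in> U \<inter> fst (K c e)"
  note r = coordinate_relations[OF leg ad a]
  show "snd (T c e) (fst (s a)) = ((fst (fst (snd (K c e) a)), snd (fst (snd (K c e) a))),
        (anchor c e (fst (fst (snd (K c e) a))) (snd (fst (snd (K c e) a))), snd (snd (snd (T c e) (fst (s a))))))"
    unfolding prod.collapse by (rule r(1))
  show "snd (snd (snd (M c e) (s a))) = (fst (snd (snd (K c e) a)), snd (snd (snd (K c e) a)))"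
    unfolding prod.collapse by (rule r(2))
  show "snd (snd (snd (K c e) a)) $ A = partial_deriv
        (local_lagrangian E D L c e (fst (fst (snd (K c e) a))) (snd (fst (snd (K c e) a))))
        (snd (snd (snd (T c e) (fst (s a))))) (axis A 1)" for A
    by (rule r(3))
qed

lemma velocity_function_U:
  assumes leg: "legendre_inverse Q E L U s"
  shows "\<forall>a0\<in>U \<inter> fst (K c e). \<exists>V N (Y :: ((real^'n) \<times> (real^'k)) \<times> (real^'k) \<Rightarrow> real^'k).
      openin (atlas_topology (cotangent_atlas E)) V \<and> a0 \<in> V \<and> V \<subseteq> U \<inter> fst (K c e) \<and> open N \<and> smooth_on N Y \<and>
      (\<forall>a\<in>V. ((fst (fst (snd (K c e) a)), snd (fst (snd (K c e) a))), snd (snd (snd (K c e) a))) \<in> N \<and>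
        snd (snd (snd (T c e) (fst (s a)))) =
          Y ((fst (fst (snd (K c e) a)), snd (fst (snd (K c e) a))), snd (snd (snd (K c e) a))) \<and>
        hamiltonian L s a =
          (\<Sum>A\<in>UNIV. snd (snd (snd (K c e) a)) $ A *
            Y ((fst (fst (snd (K c e) a)), snd (fst (snd (K c e) a))), snd (snd (snd (K c e) a))) $ A)
          + (\<Sum>i\<in>UNIV. \<Sum>A\<in>UNIV. fst (snd (snd (K c e) a)) $ i * rho c e A i (fst (fst (snd (K c e) a)))
              * snd (fst (snd (K c e) a)) $ A)
          - local_lagrangian E D L c e (fst (fst (snd (K c e) a))) (snd (fst (snd (K c e) a)))
              (Y ((fst (fst (snd (K c e) a)), snd (fst (snd (K c e) a))), snd (snd (snd (K c e) a)))))"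
    (is "\<forall>a0\<in>_. ?P a0")
proof
  fix a0 assume a0: "a0 \<in> U \<inter> fst (K c e)"
  obtain V N and Y :: "((real^'n) \<times> (real^'k)) \<times> (real^'k) \<Rightarrow> real^'k" where
    V: "openin (atlas_topology (cotangent_atlas E)) V" "a0 \<in> V" "V \<subseteq> U \<inter> fst (K c e)" "open N" "smooth_on N Y"
    and Y: "\<And>a. a \<in> V \<Longrightarrow> (fst (snd (K c e) a), snd (snd (snd (K c e) a))) \<in> N \<and>
       zeta c e s (snd (K c e) a) = Y (fst (snd (K c e) a), snd (snd (snd (K c e) a)))"
    by (rule velocity_function[OF leg ad a0]) (rule that)
  show "?P a0"
    unfolding prod.collapse
  proof (intro exI conjI ballI)
    fix a assume a: "a \<in> V"
    then have aU: "a \<in> U" "a \<in> fst (K c e)" "a \<in> U \<inter> fst (K c e)" using V(3) by auto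
    show "(fst (snd (K c e) a), snd (snd (snd (K c e) a))) \<in> N" using Y[OF a] by blast
    show "snd (snd (snd (T c e) (fst (s a)))) = Y (fst (snd (K c e) a), snd (snd (snd (K c e) a)))"
      unfolding coordinate_relations(4)[OF leg ad aU(3)] using Y[OF a] by blast
    have "fst (snd (snd (K c e) a)) \<bullet> anchor_map c e (fst (snd (K c e) a)) =
      (\<Sum>i\<in>UNIV. \<Sum>A\<in>UNIV. fst (snd (snd (K c e) a)) $ i * rho c e A i (fst (fst (snd (K c e) a)))
              * snd (fst (snd (K c e) a)) $ A)"
      by (simp add: anchor_map_def inner_vec_def sum_distrib_left mult.assoc)
    then show "hamiltonian L s a =
          (\<Sum>A\<in>UNIV. snd (snd (snd (K c e) a)) $ A * Y (fst (snd (K c e) a), snd (snd (snd (K c e) a))) $ A)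
          + (\<Sum>i\<in>UNIV. \<Sum>A\<in>UNIV. fst (snd (snd (K c e) a)) $ i * rho c e A i (fst (fst (snd (K c e) a)))
              * snd (fst (snd (K c e) a)) $ A)
          - local_lagrangian E D L c e (fst (fst (snd (K c e) a))) (snd (fst (snd (K c e) a)))
              (Y (fst (snd (K c e) a), snd (snd (snd (K c e) a))))"
      unfolding hamiltonian_coords[OF ad leg aU(1,2) refl] local_lagrangian_lp[OF ad]
      using Y[OF a] by (simp add: inner_vec_def)
  qed (fact V)+
qed

text \<open>The solution lifts to \<open>Sigma_L\<close>: with lam for \<gamma>_i and
  \<partial>l/\<partial>z for \<gamma>_A, the remaining components \<mu> are forced. An inverse
  chosen at the lifted point m(t0) follows the lift for nearby times by continuity, so the ydot it
  assigns is the velocity of y.\<close>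

lemma euler_lagrange_imp_integral_curve:
  assumes reg: "regular_system Q E L"
    and I: "open I" and q: "\<And>t. t \<in> I \<Longrightarrow> q t \<in> snd c ` fst c"
    and cont: "continuous_on I (\<lambda>t. vector_derivative y (at t))"
    and cel: "constrained_euler_lagrange (rho c e) (local_lagrangian E D L c e) I q y lam"
    and t0: "t0 \<in> I"
  defines "P \<equiv> \<lambda>t. \<chi> A. partial_deriv (local_lagrangian E D L c e (q t) (y t)) (vector_derivative y (at t)) (axis A 1)"
  defines "x \<equiv> \<lambda>t. chart_inv (K c e) ((q t, y t), (lam t, P t))"
  shows "\<exists>U s J. legendre_inverse Q E L U s \<and> open J \<and> is_interval J \<and> t0 \<in> J \<and> J \<subseteq> I \<and> x ` J \<subseteq> U \<and>
    integral_curve (cotangent_atlas E) (hamiltonian_field E (hamiltonian L s)) J x"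
proof -
  let ?yd = "\<lambda>t. vector_derivative y (at t)"
  define \<omega> where "\<omega> = (\<lambda>t. ((q t, y t), ?yd t))"
  \<comment> \<open>The solution of the equations of \<open>Sigma_L\<close> for (\<mu>_i, \<mu>_A):
    the vector representing the linear form dl - lam d(\<rho> y) in the directions (q, y).\<close>
  define \<mu> where "\<mu> = (\<lambda>t. \<Sum>b\<in>Basis. (fd (lp c e) (\<omega> t) (b, 0) - lam t \<bullet> fd (anchor_map c e) (q t, y t) b) *\<^sub>R b)"
  define n where "n = (\<lambda>t. (emb c e (\<omega> t), (\<mu> t, (lam t, P t))))"
  define m where "m = (\<lambda>t. chart_inv (M c e) (n t))"
  have \<omega>: "\<omega> t \<in> Z c" and w: "(q t, y t) \<in> W0 c" if "t \<in> I" for t using q[OF that] by (auto simp: \<omega>_def)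
  note d\<omega> = lp_differentiable[OF ad \<omega>] and da = smooth_on_imp_differentiable[OF smooth_on_anchor_map[OF ad] w]
  have P_eq: "P t = (\<Sum>b\<in>Basis. fd (lp c e) (\<omega> t) (0, b) *\<^sub>R b)" if "t \<in> I" for t
  proof -
    have "(\<Sum>b\<in>Basis. fd (lp c e) (\<omega> t) (0, b) *\<^sub>R b) $ A = fd (lp c e) (\<omega> t) (0, axis A 1)" for A
      using linear_functional_inner[OF linear_fd_slots(2)[OF d\<omega>[OF that]], of "axis A 1"] by (simp add: inner_axis)
    moreover have "P t $ A = fd (lp c e) (\<omega> t) (0, axis A 1)" for A
      using partial_deriv_compose[of "lp c e" "\<lambda>z'. ((q t, y t), z')" "?yd t" "axis A 1" "(0, axis A 1)"] d\<omega>[OF that]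
      by (simp add: P_def local_lagrangian_lp[OF ad, abs_def] \<omega>_def zero_prod_def)
    ultimately show ?thesis by (simp add: vec_eq_iff)
  qed
  have nM: "n t \<in> snd (M c e) ` fst (M c e)" if "t \<in> I" for t
    unfolding cotangent_chart_image[OF smooth_TE T_in_TE[OF ad]] n_def using emb_image[OF ad \<omega>[OF that]] by blast
  have m: "m t \<in> fst (M c e)" "snd (M c e) (m t) = n t" if "t \<in> I" for t
    unfolding m_def by (rule chart_inv_in[OF nM[OF that]], rule chart_inv_right[OF nM[OF that]])
  have v: "fst (m t) = chart_inv (T c e) (emb c e (\<omega> t))" if t: "t \<in> I" for t
  proof -
    obtain v' \<eta> where "v' \<in> fst (T c e)" "m t = (v', covec TE (T c e) v' \<eta>)"
      using m(1)[OF t] unfolding mem_cotangent_chart[OF smooth_TE T_in_TE[OF ad]] by blast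
    moreover have "snd (T c e) (fst (m t)) = emb c e (\<omega> t)"
      using Psi_map_coords(3)[OF ad m(1)[OF t]] m(2)[OF t] by (simp add: n_def)
    ultimately show ?thesis using chart_inv_left[OF ch_T[OF ad], of v'] by simp
  qed
  have zc: "zc c e (fst (m t)) = \<omega> t" if "t \<in> I" for t
    unfolding v[OF that] by (rule zc_emb[OF ad \<omega>[OF that]])
  have mS: "m t \<in> Sigma_L Q E L" if t: "t \<in> I" for t
    unfolding Sigma_L_coords[OF ad m(1)[OF t]]
  proof (intro conjI allI)
    show "fst (m t) \<in> D2" unfolding v[OF t] by (rule emb_admissible(1)[OF ad \<omega>[OF t]])
    fix \<delta> :: "((real^'n) \<times> (real^'k)) \<times> (real^'k)"
    have "linear (\<lambda>b. fd (lp c e) (\<omega> t) (b, 0) - lam t \<bullet> fd (anchor_map c e) (q t, y t) b)"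
      by (intro linear_compose_sub linear_fd_slots(1)[OF d\<omega>[OF t]]
          linear_compose[OF linear_fd[OF da[OF t]], of "\<lambda>v. lam t \<bullet> v", unfolded o_def] bounded_linear.linear bounded_linear_inner_right)
    from linear_functional_inner[OF this, of "fst \<delta>"]
    have "\<mu> t \<bullet> fst \<delta> = fd (lp c e) (\<omega> t) (fst \<delta>, 0) - lam t \<bullet> fd (anchor_map c e) (q t, y t) (fst \<delta>)"
      by (simp add: \<mu>_def)
    moreover have "P t \<bullet> snd \<delta> = fd (lp c e) (\<omega> t) (0, snd \<delta>)"
      unfolding P_eq[OF t] by (rule linear_functional_inner[OF linear_fd_slots(2)[OF d\<omega>[OF t]]])
    moreover have "fst (\<omega> t) = (q t, y t)" by (simp add: \<omega>_def)
    ultimately show "fst (snd (snd (M c e) (m t))) \<bullet> fst \<delta>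
        + fst (snd (snd (snd (M c e) (m t)))) \<bullet> fd (anchor_map c e) (fst (zc c e (fst (m t)))) (fst \<delta>)
        + snd (snd (snd (snd (M c e) (m t)))) \<bullet> snd \<delta> = fd (lp c e) (zc c e (fst (m t))) \<delta>"
      using fd_inner_split[OF d\<omega>[OF t], of "fst \<delta>" "snd \<delta>"] by (simp add: m(2)[OF t] n_def zc[OF t])
  qed
  have x: "x t = Psi_map E (m t)" "x t \<in> fst (K c e)" "snd (K c e) (x t) = ((q t, y t), (lam t, P t))"
    if t: "t \<in> I" for t
  proof -
    note Psi = Psi_map_coords[OF ad m(1)[OF t]]
    have "snd (K c e) (Psi_map E (m t)) = ((q t, y t), (lam t, P t))"
      unfolding Psi(2) m(2)[OF t] by (simp add: n_def emb_eq[OF ad] \<omega>_def)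
    with chart_inv_left[OF ch_K[OF ad] Psi(1)] Psi(1)
    show "x t = Psi_map E (m t)" "x t \<in> fst (K c e)" "snd (K c e) (x t) = ((q t, y t), (lam t, P t))"
      by (simp_all add: x_def)
  qed
  obtain W s where W: "openin (atlas_topology (cotangent_atlas TE)) W" "m t0 \<in> W"
    and leg: "legendre_inverse Q E L (Psi_map E ` (Sigma_L Q E L \<inter> W)) s"
    and sPsi: "\<And>\<tau>. \<tau> \<in> Sigma_L Q E L \<inter> W \<Longrightarrow> s (Psi_map E \<tau>) = \<tau>"
    by (rule legendre_local_inverse[OF reg mS[OF t0]]) (rule that)
  define U where "U = Psi_map E ` (Sigma_L Q E L \<inter> W)"
  note c = constrained_euler_lagrange_continuous[OF cel]
  \<comment> \<open>Here continuity of the velocity of y enters. It makes n continuous, which keeps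
    m t in W for t near t0.\<close>
  have c\<omega>: "continuous_on I \<omega>" unfolding \<omega>_def by (intro continuous_on_Pair c cont)
  have cfd: "continuous_on I (\<lambda>t. fd (lp c e) (\<omega> t) b)" for b
    by (rule continuous_on_compose2[OF smooth_on_imp_continuous[OF smooth_on_fd_dir[OF smooth_on_lp[OF ad]]] c\<omega>])
       (use \<omega> in blast)
  have cfa: "continuous_on I (\<lambda>t. fd (anchor_map c e) (q t, y t) b)" for b
    by (rule continuous_on_compose2[OF smooth_on_imp_continuous[OF smooth_on_fd_dir[OF smooth_on_anchor_map[OF ad]]]
          continuous_on_Pair[OF c(1,2)]]) (use w in blast)
  have "continuous_on I (\<lambda>t. \<Sum>b\<in>Basis. fd (lp c e) (\<omega> t) (0, b) *\<^sub>R b)"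
    by (intro continuous_on_sum continuous_on_scaleR cfd continuous_on_const)
  then have "continuous_on I P" by (rule continuous_on_eq) (simp add: P_eq)
  moreover have "continuous_on I (\<lambda>t. emb c e (\<omega> t))"
    by (rule continuous_on_compose2[OF smooth_on_imp_continuous[OF smooth_on_emb[OF ad]] c\<omega>]) (use \<omega> in blast)
  moreover have "continuous_on I \<mu>"
    unfolding \<mu>_def by (intro continuous_on_sum continuous_on_scaleR continuous_on_diff continuous_on_inner cfd cfa c continuous_on_const)
  ultimately have "continuous_on I n" unfolding n_def by (intro continuous_on_Pair c)
  from continuous_open_preimage[OF this I openin_atlasD[OF smooth_cotangent_atlas[OF smooth_TE] W(1) M_in_CTE[OF ad]]]
  have "open (I \<inter> n -` (snd (M c e) ` (W \<inter> fst (M c e))))" .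
  moreover have "t0 \<in> I \<inter> n -` (snd (M c e) ` (W \<inter> fst (M c e)))"
    using t0 imageI[of "m t0" "W \<inter> fst (M c e)" "snd (M c e)"] m[OF t0] W(2) by simp
  ultimately obtain \<epsilon> where \<epsilon>: "\<epsilon> > 0" "ball t0 \<epsilon> \<subseteq> I \<inter> n -` (snd (M c e) ` (W \<inter> fst (M c e)))"
    unfolding open_contains_ball by blast
  define J where "J = ball t0 \<epsilon>"
  have J: "open J" "is_interval J" "t0 \<in> J" "J \<subseteq> I"
    using \<epsilon> by (auto simp: J_def ball_eq_greaterThanLessThan is_interval_oo)
  have mW: "m t \<in> W" if t: "t \<in> J" for t
  proof -
    have "n t \<in> snd (M c e) ` (W \<inter> fst (M c e))" using \<epsilon>(2) t unfolding J_def by blast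
    then obtain m' where m': "m' \<in> W" "m' \<in> fst (M c e)" "n t = snd (M c e) m'" by blast
    have "t \<in> I" using t J(4) by blast
    then have "m t = m'"
      using chart_eqI[OF is_chart_cotangent[OF smooth_TE T_in_TE[OF ad]] m(1) m'(2)] m(2) m'(3) by simp
    with m'(1) show ?thesis by simp
  qed
  have xU: "x t \<in> U" "s (x t) = m t" if t: "t \<in> J" for t
  proof -
    have tI: "t \<in> I" using t J(4) by blast
    have mt: "m t \<in> Sigma_L Q E L \<inter> W" using mS[OF tI] mW[OF t] by blast
    show "x t \<in> U" unfolding U_def x(1)[OF tI] using mt by (rule imageI)
    show "s (x t) = m t" unfolding x(1)[OF tI] by (rule sPsi[OF mt])
  qed
  note leg' = leg[folded U_def]
  have xUK: "x ` J \<subseteq> U \<inter> fst (K c e)" using xU(1) x(2) J(4) by blast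
  have PJ: "P t $ A = partial_deriv (local_lagrangian E D L c e (q t) (y t)) (?yd t) (axis A 1)" for t A
    by (simp add: P_def)
  \<comment> \<open>With the velocity of y itself in the place of z, the side conditions of the
    equivalence hold by construction. That \<open>zeta\<close> takes the same value along the curve
    follows because s recovers m t.\<close>
  have "explicit_equations (rho c e) (local_lagrangian E D L c e) J q y lam P ?yd"
    by (subst explicit_equations_iff_euler_lagrange[OF J(1)])
       (use constrained_euler_lagrange_subset[OF cel J(4)] PJ in simp_all)
  then have "explicit_equations (rho c e) (local_lagrangian E D L c e) J
      (\<lambda>t. fst (fst (snd (K c e) (x t)))) (\<lambda>t. snd (fst (snd (K c e) (x t))))
      (\<lambda>t. fst (snd (snd (K c e) (x t)))) (\<lambda>t. snd (snd (snd (K c e) (x t))))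
      (\<lambda>t. zeta c e s (snd (K c e) (x t)))"
  proof (rule explicit_equations_cong[OF J(1), rotated])
    fix t assume t: "t \<in> J"
    then have tI: "t \<in> I" using J(4) by blast
    have "zeta c e s (snd (K c e) (x t)) = ?yd t"
      using legendre_inverse_coords(7)[OF ad leg' xU(1)[OF t] x(2)[OF tI]]
      by (simp add: xU(2)[OF t] zc[OF tI] \<omega>_def)
    then show "q t = fst (fst (snd (K c e) (x t))) \<and> y t = snd (fst (snd (K c e) (x t))) \<and>
        lam t = fst (snd (snd (K c e) (x t))) \<and> P t = snd (snd (snd (K c e) (x t))) \<and>
        ?yd t = zeta c e s (snd (K c e) (x t))"
      by (simp add: x(3)[OF tI])
  qed
  then have "\<forall>t\<in>J. ((\<lambda>t. snd (K c e) (x t)) has_vector_derivative ham_vec (h0 c e s) (snd (K c e) (x t))) (at t)"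
    by (subst ham_vec_iff_explicit[OF ad leg']) (use xUK in blast)+
  then have "integral_curve (cotangent_atlas E) (hamiltonian_field E (hamiltonian L s)) J x"
    unfolding integral_curve_iff_ham_vec[OF leg' ad J(1,2) xUK] .
  with leg' J xUK show ?thesis by blast
qed

end

end

theorem mainTheorem3:
  fixes Q :: "('a, real^'n::finite) atlas"
    and D :: "'a tpoint set"
    and E :: "('a tpoint, (real^'n) \<times> (real^'k::finite)) atlas"
    and L :: "'a tpoint tpoint \<Rightarrow> real"
  assumes manifold: "smooth_manifold Q"
    and dist: "distribution TYPE('k) Q D"
    and nonintegrable: "\<not> integrable_distribution TYPE('k) Q D"
    and E: "E = dist_atlas Q D"
    and L: "smooth_map_on (tangent_atlas E) (admissible_velocities Q E) euclidean_atlas L"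
    and regular: "regular_system Q E L"
  shows
    \<comment> \<open>the Legendre transform has smooth local inverses around every point\<close>
    "(\<forall>\<sigma>\<in>Sigma_L Q E L. \<exists>W s.
        openin (atlas_topology (cotangent_atlas (tangent_atlas E))) W \<and> \<sigma> \<in> W \<and>
        legendre_inverse Q E L (Psi_map E ` (Sigma_L Q E L \<inter> W)) s \<and>
        (\<forall>\<tau>\<in>Sigma_L Q E L \<inter> W. s (Psi_map E \<tau>) = \<tau>)) \<and>
     (\<forall>U s. legendre_inverse Q E L U s \<longrightarrow>
       (let H = hamiltonian L s; X = hamiltonian_field E H in
         \<comment> \<open>the Hamiltonian vector field is well defined by \<open>i\<^sub>X \<omega> = dH\<close>\<close>
         (\<forall>a\<in>U. smooth_at (cotangent_atlas E) euclidean_atlas H a \<and>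
            (\<exists>!Y. is_hamiltonian_vector E H a Y)) \<and>
         \<comment> \<open>its flow preserves the canonical symplectic form\<close>
         (\<forall>\<Omega> F. is_flow (cotangent_atlas E) X U \<Omega> F \<longrightarrow>
            flow_preserves (cotangent_atlas E) \<Omega> F (canonical_symplectic E)) \<and>
         \<comment> \<open>coordinate expressions\<close>
         (\<forall>c (e :: 'k \<Rightarrow> 'a \<Rightarrow> 'a tvec). adapted_chart Q D c e \<longrightarrow>
           (let T = tangent_chart E (dist_chart D c e);
                K = cotangent_chart E (dist_chart D c e);
                M = cotangent_chart (tangent_atlas E) T;
                q = (\<lambda>a. fst (fst (snd K a)));
                y = (\<lambda>a. snd (fst (snd K a)));
                p = (\<lambda>a. fst (snd (snd K a)));
                P = (\<lambda>a. snd (snd (snd K a)));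
                z = (\<lambda>a. snd (snd (snd T (fst (s a)))));
                r = rho c e;
                l = local_lagrangian E D L c e;
                h = (\<lambda>q y p P. H (chart_inv K ((q, y), (p, P))))
            in
             \<comment> \<open>\<open>p\<^sub>i = \<gamma>\<^sub>i\<close> and \<open>p\<^sub>A = \<gamma>\<^sub>A = \<partial>L/\<partial>ydot\<^sup>A\<close>\<close>
             (\<forall>a\<in>U \<inter> fst K.
                snd T (fst (s a)) = ((q a, y a), (\<chi> i. \<Sum>A\<in>UNIV. r A i (q a) * y a $ A, z a)) \<and>
                snd (snd (snd M (s a))) = (p a, P a) \<and>
                (\<forall>A. P a $ A = partial_deriv (l (q a) (y a)) (z a) (axis A 1))) \<and>
             \<comment> \<open>\<open>ydot\<^sup>A = ydot\<^sup>A(q\<^sup>i, y\<^sup>A, p\<^sub>A)\<close> and the local form of \<open>H\<close>\<close>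
             (\<forall>a0\<in>U \<inter> fst K. \<exists>V N (Y :: ((real^'n) \<times> (real^'k)) \<times> (real^'k) \<Rightarrow> real^'k).
                openin (atlas_topology (cotangent_atlas E)) V \<and> a0 \<in> V \<and> V \<subseteq> U \<inter> fst K \<and>
                open N \<and> smooth_on N Y \<and>
                (\<forall>a\<in>V. ((q a, y a), P a) \<in> N \<and> z a = Y ((q a, y a), P a) \<and>
                   H a = (\<Sum>A\<in>UNIV. P a $ A * Y ((q a, y a), P a) $ A)
                     + (\<Sum>i\<in>UNIV. \<Sum>A\<in>UNIV. p a $ i * r A i (q a) * y a $ A)
                     - l (q a) (y a) (Y ((q a, y a), P a)))) \<and>
             \<comment> \<open>the equations of motion\<close>
             (\<forall>I x. open I \<and> is_interval I \<and> x ` I \<subseteq> U \<inter> fst K \<longrightarrow>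
                (integral_curve (cotangent_atlas E) X I x \<longleftrightarrow>
                   hamilton_equations h I (q \<circ> x) (y \<circ> x) (p \<circ> x) (P \<circ> x)) \<and>
                (hamilton_equations h I (q \<circ> x) (y \<circ> x) (p \<circ> x) (P \<circ> x) \<longleftrightarrow>
                   explicit_equations r l I (q \<circ> x) (y \<circ> x) (p \<circ> x) (P \<circ> x) (z \<circ> x)) \<and>
                (integral_curve (cotangent_atlas E) X I x \<longleftrightarrow>
                   constrained_euler_lagrange r l I (q \<circ> x) (y \<circ> x) (p \<circ> x) \<and>
                   (\<forall>t\<in>I. vector_derivative (y \<circ> x) (at t) = z (x t) \<and>
                      (\<forall>A. P (x t) $ A = partial_deriv (l (q (x t)) (y (x t)))
                         (vector_derivative (y \<circ> x) (at t)) (axis A 1))))))))) \<and>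
     \<comment> \<open>every solution of the constrained Euler-Lagrange equations solves, locally in time, Hamilton's
        equations for some local inverse of the Legendre transform\<close>
     (\<forall>c (e :: 'k \<Rightarrow> 'a \<Rightarrow> 'a tvec) I q y lam.
        let K = cotangent_chart E (dist_chart D c e);
            l = local_lagrangian E D L c e;
            x = (\<lambda>t. chart_inv K ((q t, y t), (lam t,
                  \<chi> A. partial_deriv (l (q t) (y t)) (vector_derivative y (at t)) (axis A 1))))
        in adapted_chart Q D c e \<and> open I \<and> is_interval I \<and> (\<forall>t\<in>I. q t \<in> snd c ` fst c) \<and>
           continuous_on I (\<lambda>t. vector_derivative y (at t)) \<and>
           constrained_euler_lagrange (rho c e) l I q y lam \<longrightarrow>
           (\<forall>t0\<in>I. \<exists>U s J. legendre_inverse Q E L U s \<and>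
              open J \<and> is_interval J \<and> t0 \<in> J \<and> J \<subseteq> I \<and> x ` J \<subseteq> U \<and>
              integral_curve (cotangent_atlas E) (hamiltonian_field E (hamiltonian L s)) J x))"
proof -
  interpret lagrangian_system Q D E L
    by unfold_locales (use manifold dist E L in \<open>simp_all add: smooth_manifold_def\<close>)
  have 1: "\<exists>W s. openin (atlas_topology (cotangent_atlas (tangent_atlas E))) W \<and> \<sigma> \<in> W \<and>
        legendre_inverse Q E L (Psi_map E ` (Sigma_L Q E L \<inter> W)) s \<and>
        (\<forall>\<tau>\<in>Sigma_L Q E L \<inter> W. s (Psi_map E \<tau>) = \<tau>)" if "\<sigma> \<in> Sigma_L Q E L" for \<sigma>
    by (rule legendre_local_inverse[OF regular that]) blast
  show ?thesis
    unfolding Let_def o_def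
    apply (intro conjI allI impI)
    subgoal using 1 by blast
    subgoal using smooth_at_hamiltonian hamiltonian_vector_ex1_U by blast
    subgoal by (rule hamiltonian_flow_preserves_U)
    subgoal by (rule coordinate_relations_U)
    subgoal by (rule velocity_function_U)
    subgoal by (elim conjE) (rule equations_of_motion(1))
    subgoal by (elim conjE) (rule equations_of_motion(2))
    subgoal by (elim conjE) (rule equations_of_motion(3))
    subgoal by (elim conjE) (intro ballI euler_lagrange_imp_integral_curve[OF _ regular]; simp)
    done
qed

end
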